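(* Let $\ell_0>0$, let $w\in C^0([0,+\infty))$ be absolutely continuous on $[0,T]$ for every $T>0$, and let $\kappa\in C^0([\ell_0,+\infty))$ with $\kappa(x)>0$ for every $x\ge\ell_0$. Set $\phi_\kappa(x):=x^2\kappa(x)$ and assume that $\phi_\kappa$ is strictly increasing on $[\ell_0,+\infty)$ and $\dot\phi_\kappa(x)>0$ for a.e. $x\in(\ell_0,+\infty)$. Then a pair $(v,\lambda)$ is an energetic evolution if and only if it is a quasistatic evolution. In particular, if in addition $\lim_{x\to+\infty}\phi_\kappa(x)>\frac12\max_{t\in[0,T]}w(t)^2$ for every $T>0$ and $\phi_\kappa(\ell_0)\ge\frac12w(0)^2$, then the only quasistatic evolution $(\bar v,\bar\lambda)$ is given by $$\bar v(t,x)=w(t)\Big(1-\frac{x}{\bar\lambda(t)}\Big)\chi_{[0,\bar\lambda(t)]}(x)\quad\text{for every }(t,x)\in[0,+\infty)\times[0,+\infty),$$ $$\bar\lambda(t)=\phi_\kappa^{-1}\Big(\max\Big\{\tfrac12(w^2)_*(t),\ \phi_\kappa(\ell_0)\Big\}\Big)\quad\text{for every }t\in[0,+\infty),$$ where $(w^2)_*(t):=\max_{s\in[0,t]}w(s)^2$.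
   Context: A dot denotes the derivative of a one-variable function. Admissible pairs: $\lambda:[0,+\infty)\to[\ell_0,+\infty)$ is nondecreasing with $\lambda(0)=\ell_0$, and $v:[0,+\infty)\times[0,+\infty)\to\mathbb R$ is such that for every $t\ge0$: $v(t,\cdot)\in H^1(0,+\infty)$, $v(t,0)=w(t)$, $v(t,x)=0$ for $x\ge\lambda(t)$; and $v_x(t,0)$ exists for a.e. $t>0$. An admissible pair $(v,\lambda)$ is an energetic evolution if for every $t\in[0,+\infty)$: (S) $\frac12\int_0^{\lambda(t)}v_x(t,\sigma)^2d\sigma+\int_{\ell_0}^{\lambda(t)}\kappa(\sigma)d\sigma\le\frac12\int_0^{\hat\lambda}\dot{\hat v}(\sigma)^2d\sigma+\int_{\ell_0}^{\hat\lambda}\kappa(\sigma)d\sigma$ for every $\hat\lambda\ge\lambda(t)$ and every $\hat v\in H^1(0,\hat\lambda)$ with $\hat v(0)=w(t)$, $\hat v(\hat\lambda)=0$; (EB) $\frac12\int_0^{\lambda(t)}v_x(t,\sigma)^2d\sigma+\int_{\ell_0}^{\lambda(t)}\kappa(\sigma)d\sigma+\int_0^t\dot w(\tau)v_x(\tau,0)d\tau=\frac12\int_0^{\ell_0}v_x(0,\sigma)^2d\sigma$. An admissible pair $(v,\lambda)$ is a quasistatic evolution if: (i) $\lambda$ is absolutely continuous on $[0,T]$ for every $T>0$ and $\lambda(0)=\ell_0$; (ii) $v(t,x)=w(t)\big(1-\frac{x}{\lambda(t)}\big)\chi_{[0,\lambda(t)]}(x)$ for every $(t,x)\in[0,+\infty)\times[0,+\infty)$;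 (iii) for a.e. $t\in(0,+\infty)$: $\dot\lambda(t)\ge0$, $\frac12\frac{w(t)^2}{\lambda(t)^2}\le\kappa(\lambda(t))$, and $\big[\frac12\frac{w(t)^2}{\lambda(t)^2}-\kappa(\lambda(t))\big]\dot\lambda(t)=0$. *)

theory Defs
  imports "HOL-Analysis.Analysis"
begin

section \<open>Absolute continuity\<close>

definition abs_continuous_on :: "real set \<Rightarrow> (real \<Rightarrow> real) \<Rightarrow> bool" where
  "abs_continuous_on I f \<longleftrightarrow>
     (\<forall>\<epsilon>>0. \<exists>\<delta>>0. \<forall>(n::nat) a b.
        (\<forall>i<n. a i \<le> b i \<and> {a i..b i} \<subseteq> I) \<and>
        (\<forall>i<n. \<forall>j<n. i \<noteq> j \<longrightarrow> {a i<..<b i} \<inter> {a j<..<b j} = {}) \<and>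
        (\<Sum>i<n. b i - a i) < \<delta>
        \<longrightarrow> (\<Sum>i<n. \<bar>f (b i) - f (a i)\<bar>) < \<epsilon>)"


section \<open>The Sobolev space $H^1$ of an open interval\<close>

definition square_integrable_on :: "real set \<Rightarrow> (real \<Rightarrow> real) \<Rightarrow> bool" where
  "square_integrable_on I f \<longleftrightarrow>
     set_borel_measurable lebesgue I f \<and> set_integrable lebesgue I (\<lambda>x. (f x)\<^sup>2)"

definition test_function :: "real set \<Rightarrow> (real \<Rightarrow> real) \<Rightarrow> bool" where
  "test_function I \<phi> \<longleftrightarrow>
     \<phi> C1_differentiable_on UNIV \<and>
     compact (closure {x. \<phi> x \<noteq> 0}) \<and> closure {x. \<phi> x \<noteq> 0} \<subseteq> I"

definition weak_derivative :: "real set \<Rightarrow> (real \<Rightarrow> real) \<Rightarrow> (real \<Rightarrow> real) \<Rightarrow> bool" where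
  "weak_derivative I u g \<longleftrightarrow>
     (\<forall>\<phi>. test_function I \<phi> \<longrightarrow>
        (LINT x:I|lebesgue. u x * deriv \<phi> x) = - (LINT x:I|lebesgue. g x * \<phi> x))"

text \<open>Elements of $H^1(I)$ are identified with their continuous representative on the closure
  of \<open>I\<close>, so that boundary values and other pointwise values make sense.\<close>

definition H1 :: "real set \<Rightarrow> (real \<Rightarrow> real) set" where
  "H1 I = {u. continuous_on (closure I) u \<and> square_integrable_on I u \<and>
              (\<exists>g. square_integrable_on I g \<and> weak_derivative I u g)}"

text \<open>The weak derivative is determined only up to null sets; below it occurs only under integrals.\<close>

definition wderiv :: "real set \<Rightarrow> (real \<Rightarrow> real) \<Rightarrow> real \<Rightarrow> real" where
  "wderiv I u = (SOME g. square_integrable_on I g \<and> weak_derivative I u g)"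


section \<open>Evolutions\<close>

text \<open>Functions on $[0,\infty)$ or $[\ell_0,\infty)$ are represented by total functions on the
  reals whose values outside that set are irrelevant. The datum \<open>w\<close>, the toughness \<open>\<kappa>\<close> and
  $\ell_0$ are parameters.\<close>

text \<open>$v_x(t,0)$ is the one-sided derivative at the endpoint \<open>0\<close> of $v(t,\cdot)$.\<close>

definition admissible_pair ::
    "real \<Rightarrow> (real \<Rightarrow> real) \<Rightarrow> (real \<Rightarrow> real \<Rightarrow> real) \<Rightarrow> (real \<Rightarrow> real) \<Rightarrow> bool" where
  "admissible_pair l0 w v lam \<longleftrightarrow>
     (\<forall>t\<ge>0. lam t \<ge> l0) \<and> mono_on {0..} lam \<and> lam 0 = l0 \<and>
     (\<forall>t\<ge>0. v t \<in> H1 {0<..} \<and> v t 0 = w t \<and> (\<forall>x\<ge>lam t. v t x = 0)) \<and>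
     (AE t in lebesgue. t > 0 \<longrightarrow> v t differentiable (at_right 0))"

definition energy ::
    "real \<Rightarrow> (real \<Rightarrow> real) \<Rightarrow> (real \<Rightarrow> real) \<Rightarrow> real \<Rightarrow> real" where
  "energy l0 \<kappa> g l =
     1/2 * (LINT \<sigma>:{0..l}|lebesgue. (g \<sigma>)\<^sup>2) + (LINT \<sigma>:{l0..l}|lebesgue. \<kappa> \<sigma>)"

text \<open>The integrability of $\dot w\, v_x(\cdot,0)$ is what gives meaning to the last
  integral in the energy balance, and is therefore part of that condition.\<close>

definition energetic_evolution ::
    "real \<Rightarrow> (real \<Rightarrow> real) \<Rightarrow> (real \<Rightarrow> real) \<Rightarrow> (real \<Rightarrow> real \<Rightarrow> real) \<Rightarrow> (real \<Rightarrow> real) \<Rightarrow> bool" where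
  "energetic_evolution l0 w \<kappa> v lam \<longleftrightarrow>
     admissible_pair l0 w v lam \<and>
     (\<forall>t\<ge>0.
        (\<forall>l\<ge>lam t. \<forall>u \<in> H1 {0<..<l}. u 0 = w t \<and> u l = 0 \<longrightarrow>
           energy l0 \<kappa> (wderiv {0<..} (v t)) (lam t) \<le> energy l0 \<kappa> (wderiv {0<..<l} u) l) \<and>
        set_integrable lebesgue {0..t}
          (\<lambda>\<tau>. deriv w \<tau> * vector_derivative (v \<tau>) (at_right 0)) \<and>
        energy l0 \<kappa> (wderiv {0<..} (v t)) (lam t)
          + (LINT \<tau>:{0..t}|lebesgue. deriv w \<tau> * vector_derivative (v \<tau>) (at_right 0))
          = 1/2 * (LINT \<sigma>:{0..l0}|lebesgue. (wderiv {0<..} (v 0) \<sigma>)\<^sup>2))"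

definition quasistatic_evolution ::
    "real \<Rightarrow> (real \<Rightarrow> real) \<Rightarrow> (real \<Rightarrow> real) \<Rightarrow> (real \<Rightarrow> real \<Rightarrow> real) \<Rightarrow> (real \<Rightarrow> real) \<Rightarrow> bool" where
  "quasistatic_evolution l0 w \<kappa> v lam \<longleftrightarrow>
     admissible_pair l0 w v lam \<and>
     (\<forall>T>0. abs_continuous_on {0..T} lam) \<and> lam 0 = l0 \<and>
     (\<forall>t\<ge>0. \<forall>x\<ge>0. v t x = w t * (1 - x / lam t) * indicat_real {0..lam t} x) \<and>
     (AE t in lebesgue. t > 0 \<longrightarrow>
        (\<exists>D. (lam has_real_derivative D) (at t) \<and> D \<ge> 0 \<and>
             1/2 * ((w t)\<^sup>2 / (lam t)\<^sup>2) \<le> \<kappa> (lam t) \<and>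
             (1/2 * ((w t)\<^sup>2 / (lam t)\<^sup>2) - \<kappa> (lam t)) * D = 0))"

definition phi :: "(real \<Rightarrow> real) \<Rightarrow> real \<Rightarrow> real" where
  "phi \<kappa> x = x\<^sup>2 * \<kappa> x"

text \<open>The maximum of $w^2$ over $[0,t]$; the supremum is attained since \<open>w\<close> will be continuous.\<close>

definition max_square :: "(real \<Rightarrow> real) \<Rightarrow> real \<Rightarrow> real" where
  "max_square w t = (SUP s\<in>{0..t}. (w s)\<^sup>2)"

definition lam_bar :: "real \<Rightarrow> (real \<Rightarrow> real) \<Rightarrow> (real \<Rightarrow> real) \<Rightarrow> real \<Rightarrow> real" where
  "lam_bar l0 w \<kappa> t = inv_into {l0..} (phi \<kappa>) (max (1/2 * max_square w t) (phi \<kappa> l0))"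

definition v_bar :: "real \<Rightarrow> (real \<Rightarrow> real) \<Rightarrow> (real \<Rightarrow> real) \<Rightarrow> real \<Rightarrow> real \<Rightarrow> real" where
  "v_bar l0 w \<kappa> t x =
     w t * (1 - x / lam_bar l0 w \<kappa> t) * indicat_real {0..lam_bar l0 w \<kappa> t} x"

end

theory Submission
  imports Defs
begin

text \<open>Both notions of evolution are equivalent to a third, explicit one: \<open>v\<close> is affine in \<open>x\<close> up to the front,
and the front satisfies \<open>\<phi>\<^sub>\<kappa>(\<lambda>(t)) = max {(w\<^sup>2)\<^sub>*(t) / 2, \<phi>\<^sub>\<kappa>(\<ell>\<^sub>0)}\<close> for all \<open>t\<close>. This is
\<open>evolutions_iff_load\<close>. Injectivity of \<open>\<phi>\<^sub>\<kappa>\<close> then gives uniqueness, and the conditions on the range of \<open>\<phi>\<^sub>\<kappa>\<close> and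
on the initial load give existence.

An energetic evolution is affine because the affine function is the unique minimizer of the Dirichlet energy
for its boundary values (\<open>H1_dirichlet_energy\<close>). The total energy of an affine profile of length \<open>l\<close> is
\<open>w\<^sup>2 / (2 l) + \<integral> \<kappa>\<close>, with \<open>l\<close>-derivative \<open>(\<phi>\<^sub>\<kappa>(l) - w\<^sup>2 / 2) / l\<^sup>2\<close>. As \<open>\<phi>\<^sub>\<kappa>\<close> increases, global stability
is the same as \<open>w(t)\<^sup>2 / 2 \<le> \<phi>\<^sub>\<kappa>(\<lambda>(t))\<close>. So \<open>\<phi>\<^sub>\<kappa>(\<lambda>(t))\<close> is at least the running maximum; were it larger,
the front would have advanced further than the available energy allows (\<open>front_phi_eq_load\<close>).

If \<open>\<phi>\<^sub>\<kappa> \<circ> \<lambda>\<close> is the running maximum, then it is absolutely continuous. Since \<open>\<phi>\<^sub>\<kappa>\<close> has a positive derivative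
almost everywhere, its inverse is absolutely continuous as well (\<open>abs_continuous_on_of_increasing_image\<close>), so \<open>\<lambda>\<close>
is absolutely continuous, and it can move only at times when \<open>w\<^sup>2 / 2\<close> attains the maximum (\<open>front_from_load\<close>).

A quasistatic evolution satisfies the stability inequality at almost every time, hence by continuity always, and the
energy balance is the integrated chain rule (\<open>griffith_imp_stable\<close>, \<open>griffith_imp_balanced\<close>).

Two analytic tools carry these steps: absolutely continuous functions are the integrals of their almost everywhere
existing derivatives (\<open>abs_continuous_fundamental_theorem\<close>, by Jordan decomposition and the Radon-Nikodym
theorem), and the increments of a continuous function are the integrals of its weak derivative
(\<open>weak_derivative_imp_increment\<close>).\<close>

section \<open>Absolutely continuous functions and their variation\<close>

text \<open>The index set is arbitrary, rather than an initial segment of the naturals, so that refinements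
of a family can be indexed by pairs and divisions by their own members.\<close>

definition interval_family :: "real \<Rightarrow> real \<Rightarrow> 'i set \<Rightarrow> ('i \<Rightarrow> real) \<Rightarrow> ('i \<Rightarrow> real) \<Rightarrow> bool" where
  "interval_family c d K a b \<longleftrightarrow> finite K \<and> (\<forall>i\<in>K. c \<le> a i \<and> a i \<le> b i \<and> b i \<le> d) \<and>
     (\<forall>i\<in>K. \<forall>j\<in>K. i \<noteq> j \<longrightarrow> {a i<..<b i} \<inter> {a j<..<b j} = {})"

lemma interval_family_length:
  assumes "interval_family c d K a b" "c \<le> d"
  shows "(\<Sum>i\<in>K. b i - a i) \<le> d - c"
proof -
  have fin: "finite K" and sub: "\<And>i. i \<in> K \<Longrightarrow> c \<le> a i \<and> a i \<le> b i \<and> b i \<le> d"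
    and dis: "disjoint_family_on (\<lambda>i. {a i<..<b i}) K"
    using assms by (auto simp: interval_family_def disjoint_family_on_def)
  have "(\<Sum>i\<in>K. b i - a i) = (\<Sum>i\<in>K. measure lborel {a i<..<b i})"
    using sub by (intro sum.cong) auto
  also have "\<dots> = measure lborel (\<Union>i\<in>K. {a i<..<b i})"
  proof (rule measure_finite_Union[symmetric])
    show "\<And>i. i \<in> K \<Longrightarrow> emeasure lborel {a i<..<b i} \<noteq> \<infinity>"
      using sub by (auto simp: emeasure_lborel_Ioo)
  qed (use fin dis in auto)
  also have "\<dots> \<le> measure lborel {c..d}"
  proof (rule measure_mono_fmeasurable)
    show "(\<Union>i\<in>K. {a i<..<b i}) \<subseteq> {c..d}" using sub by fastforce
    show "(\<Union>i\<in>K. {a i<..<b i}) \<in> sets lborel" using fin by auto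
  qed (auto simp: fmeasurable_def emeasure_lborel_Icc_eq)
  finally show ?thesis using assms by simp
qed

lemma abs_continuous_on_iff_interval_family:
  "abs_continuous_on {c..d} F \<longleftrightarrow> (\<forall>\<epsilon>>0. \<exists>\<delta>>0. \<forall>n a b. interval_family c d {..<n::nat} a b \<longrightarrow>
     (\<Sum>i<n. b i - a i) < \<delta> \<longrightarrow> (\<Sum>i<n. \<bar>F (b i) - F (a i)\<bar>) < \<epsilon>)"
proof -
  have "((\<forall>i<n. a i \<le> b i \<and> {a i..b i} \<subseteq> {c..d}) \<and>
        (\<forall>i<n. \<forall>j<n. i \<noteq> j \<longrightarrow> {a i<..<b i} \<inter> {a j<..<b j} = {}) \<and> R \<longrightarrow> S) \<longleftrightarrow>
      (interval_family c d {..<n} a b \<longrightarrow> R \<longrightarrow> S)" for n :: nat and a b :: "nat \<Rightarrow> real" and R S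
  proof -
    have "(\<forall>i<n. a i \<le> b i \<and> {a i..b i} \<subseteq> {c..d}) \<longleftrightarrow> (\<forall>i<n. c \<le> a i \<and> a i \<le> b i \<and> b i \<le> d)"
      by (intro all_cong) auto
    then show ?thesis
      by (simp only: interval_family_def finite_lessThan lessThan_iff Ball_def simp_thms imp_conjL)
  qed
  then show ?thesis unfolding abs_continuous_on_def by presburger
qed

lemma abs_continuous_on_intervalI:
  assumes "\<And>\<epsilon>. \<epsilon> > 0 \<Longrightarrow> \<exists>\<delta>>0. \<forall>n a b. interval_family c d {..<n::nat} a b \<longrightarrow>
     (\<Sum>i<n. b i - a i) < \<delta> \<longrightarrow> (\<Sum>i<n. \<bar>F (b i) - F (a i)\<bar>) < \<epsilon>"
  shows "abs_continuous_on {c..d} F"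
  unfolding abs_continuous_on_iff_interval_family using assms by blast

lemma abs_continuous_on_interval_family:
  assumes "abs_continuous_on {c..d} F" "\<epsilon> > 0"
  obtains \<delta> where "\<delta> > 0"
    "\<And>(K :: 'i set) a b. interval_family c d K a b \<Longrightarrow> (\<Sum>i\<in>K. b i - a i) < \<delta> \<Longrightarrow>
        (\<Sum>i\<in>K. \<bar>F (b i) - F (a i)\<bar>) < \<epsilon>"
proof -
  from assms(1)[unfolded abs_continuous_on_iff_interval_family, rule_format, OF assms(2)]
  obtain \<delta> where \<delta>: "\<delta> > 0" and H: "\<forall>n a b. interval_family c d {..<n::nat} a b \<longrightarrow>
     (\<Sum>i<n. b i - a i) < \<delta> \<longrightarrow> (\<Sum>i<n. \<bar>F (b i) - F (a i)\<bar>) < \<epsilon>" by blast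
  have "(\<Sum>i\<in>K. \<bar>F (b i) - F (a i)\<bar>) < \<epsilon>"
    if fam: "interval_family c d K a b" and len: "(\<Sum>i\<in>K. b i - a i) < \<delta>" for K :: "'i set" and a b
  proof -
    have "finite K" using fam by (simp add: interval_family_def)
    then obtain h where h: "bij_betw h {..<card K} K"
      using ex_bij_betw_nat_finite[of K] by (auto simp: atLeast0LessThan)
    have hK: "h i \<in> K" if "i < card K" for i using bij_betwE[OF h] that by auto
    have inj: "h i \<noteq> h j" if "i < card K" "j < card K" "i \<noteq> j" for i j
      using bij_betw_imp_inj_on[OF h] that by (auto simp: inj_on_def)
    have "interval_family c d {..<card K} (\<lambda>i. a (h i)) (\<lambda>i. b (h i))"
      unfolding interval_family_def
    proof (intro conjI ballI impI)
      fix i j assume "i \<in> {..<card K}" "j \<in> {..<card K}" "i \<noteq> j"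
      then have "h i \<in> K" "h j \<in> K" "h i \<noteq> h j" using hK inj by auto
      then show "{a (h i)<..<b (h i)} \<inter> {a (h j)<..<b (h j)} = {}"
        using fam unfolding interval_family_def by blast
    qed (use fam hK in \<open>auto simp: interval_family_def\<close>)
    moreover have "(\<Sum>i<card K. b (h i) - a (h i)) < \<delta>"
      using len sum.reindex_bij_betw[OF h, of "\<lambda>i. b i - a i"] by simp
    ultimately have "(\<Sum>i<card K. \<bar>F (b (h i)) - F (a (h i))\<bar>) < \<epsilon>"
      using H[rule_format, of "card K" "\<lambda>i. a (h i)" "\<lambda>i. b (h i)"] by blast
    then show ?thesis
      using sum.reindex_bij_betw[OF h, of "\<lambda>i. \<bar>F (b i) - F (a i)\<bar>"] by simp
  qed
  then show thesis by (rule that[OF \<delta>])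
qed

lemma interval_family_mono:
  assumes "interval_family c' d' K a b" "c \<le> c'" "d' \<le> d"
  shows "interval_family c d K a b"
  using assms unfolding interval_family_def by (meson order_trans)

lemma abs_continuous_on_subinterval:
  assumes F: "abs_continuous_on {c..d} F" and "c \<le> c'" "d' \<le> d"
  shows "abs_continuous_on {c'..d'} F"
proof (rule abs_continuous_on_intervalI)
  fix \<epsilon> :: real assume "\<epsilon> > 0"
  obtain \<delta> where \<delta>: "\<delta> > 0" and H: "\<And>(K :: nat set) a b. interval_family c d K a b \<Longrightarrow>
      (\<Sum>i\<in>K. b i - a i) < \<delta> \<Longrightarrow> (\<Sum>i\<in>K. \<bar>F (b i) - F (a i)\<bar>) < \<epsilon>"
    by (rule abs_continuous_on_interval_family[OF F \<open>\<epsilon> > 0\<close>]) (rule that)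
  show "\<exists>\<delta>>0. \<forall>n a b. interval_family c' d' {..<n::nat} a b \<longrightarrow>
     (\<Sum>i<n. b i - a i) < \<delta> \<longrightarrow> (\<Sum>i<n. \<bar>F (b i) - F (a i)\<bar>) < \<epsilon>"
    by (intro exI[of _ \<delta>] conjI allI impI \<delta> H interval_family_mono[OF _ assms(2,3)])
qed

lemma abs_continuous_on_imp_continuous_on:
  assumes "abs_continuous_on {c..d} F"
  shows "continuous_on {c..d} F"
  unfolding continuous_on_iff
proof (intro ballI allI impI)
  fix x \<epsilon> :: real assume x: "x \<in> {c..d}" and "\<epsilon> > 0"
  obtain \<delta> where \<delta>: "\<delta> > 0" and H: "\<And>(K :: unit set) a b. interval_family c d K a b \<Longrightarrow>
      (\<Sum>i\<in>K. b i - a i) < \<delta> \<Longrightarrow> (\<Sum>i\<in>K. \<bar>F (b i) - F (a i)\<bar>) < \<epsilon>"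
    by (rule abs_continuous_on_interval_family[OF assms \<open>\<epsilon> > 0\<close>]) (rule that)
  have "dist (F y) (F x) < \<epsilon>" if y: "y \<in> {c..d}" "dist y x < \<delta>" for y
  proof -
    have "(\<Sum>i\<in>{()}. \<bar>F (max x y) - F (min x y)\<bar>) < \<epsilon>"
    proof (rule H[of "{()}" "\<lambda>_. min x y" "\<lambda>_. max x y"])
      show "interval_family c d {()} (\<lambda>_. min x y) (\<lambda>_. max x y)"
        using x y by (auto simp: interval_family_def)
    qed (use y in \<open>auto simp: dist_real_def max_def min_def\<close>)
    then show ?thesis by (auto simp: dist_real_def max_def min_def split: if_splits)
  qed
  then show "\<exists>\<delta>>0. \<forall>y\<in>{c..d}. dist y x < \<delta> \<longrightarrow> dist (F y) (F x) < \<epsilon>"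
    using \<delta> by blast
qed

text \<open>All closure properties that are needed (sums, products with bounded factors, composition
with Lipschitz functions) are instances of domination of the increments.\<close>

lemma abs_continuous_on_dominated:
  assumes F: "abs_continuous_on {c..d} F" and G: "abs_continuous_on {c..d} G"
    and dom: "\<And>x y. c \<le> x \<Longrightarrow> x \<le> y \<Longrightarrow> y \<le> d \<Longrightarrow>
       \<bar>E y - E x\<bar> \<le> A * \<bar>F y - F x\<bar> + B * \<bar>G y - G x\<bar>"
  shows "abs_continuous_on {c..d} E"
proof (rule abs_continuous_on_intervalI)
  fix \<epsilon> :: real assume \<epsilon>: "\<epsilon> > 0"
  define C where "C = \<bar>A\<bar> + \<bar>B\<bar> + 1"
  have C: "C > 0" "A \<le> C" "B \<le> C" by (auto simp: C_def)
  then have e: "\<epsilon> / (2 * C) > 0" using \<epsilon> by simp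
  obtain \<delta>1 where \<delta>1: "\<delta>1 > 0" "\<And>(K :: nat set) a b. interval_family c d K a b \<Longrightarrow>
      (\<Sum>i\<in>K. b i - a i) < \<delta>1 \<Longrightarrow> (\<Sum>i\<in>K. \<bar>F (b i) - F (a i)\<bar>) < \<epsilon> / (2 * C)"
    by (rule abs_continuous_on_interval_family[OF F e]) (rule that)
  obtain \<delta>2 where \<delta>2: "\<delta>2 > 0" "\<And>(K :: nat set) a b. interval_family c d K a b \<Longrightarrow>
      (\<Sum>i\<in>K. b i - a i) < \<delta>2 \<Longrightarrow> (\<Sum>i\<in>K. \<bar>G (b i) - G (a i)\<bar>) < \<epsilon> / (2 * C)"
    by (rule abs_continuous_on_interval_family[OF G e]) (rule that)
  have "(\<Sum>i<n. \<bar>E (b i) - E (a i)\<bar>) < \<epsilon>"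
    if fam: "interval_family c d {..<n::nat} a b" and len: "(\<Sum>i<n. b i - a i) < min \<delta>1 \<delta>2" for n a b
  proof -
    have "(\<Sum>i<n. \<bar>E (b i) - E (a i)\<bar>) \<le> (\<Sum>i<n. C * \<bar>F (b i) - F (a i)\<bar> + C * \<bar>G (b i) - G (a i)\<bar>)"
    proof (rule sum_mono)
      fix i assume "i \<in> {..<n}"
      then have "c \<le> a i" "a i \<le> b i" "b i \<le> d" using fam by (auto simp: interval_family_def)
      from dom[OF this] have "\<bar>E (b i) - E (a i)\<bar> \<le> A * \<bar>F (b i) - F (a i)\<bar> + B * \<bar>G (b i) - G (a i)\<bar>" .
      also have "\<dots> \<le> C * \<bar>F (b i) - F (a i)\<bar> + C * \<bar>G (b i) - G (a i)\<bar>"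
        using C by (intro add_mono mult_right_mono) auto
      finally show "\<bar>E (b i) - E (a i)\<bar> \<le> C * \<bar>F (b i) - F (a i)\<bar> + C * \<bar>G (b i) - G (a i)\<bar>" .
    qed
    also have "\<dots> = C * (\<Sum>i<n. \<bar>F (b i) - F (a i)\<bar>) + C * (\<Sum>i<n. \<bar>G (b i) - G (a i)\<bar>)"
      by (simp add: sum.distrib sum_distrib_left)
    also have "\<dots> < C * (\<epsilon> / (2 * C)) + C * (\<epsilon> / (2 * C))"
      using \<delta>1(2)[OF fam] \<delta>2(2)[OF fam] len C by (intro add_strict_mono mult_strict_left_mono) auto
    also have "\<dots> = \<epsilon>" using C by (simp add: field_simps)
    finally show ?thesis .
  qed
  then show "\<exists>\<delta>>0. \<forall>n a b. interval_family c d {..<n::nat} a b \<longrightarrow>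
     (\<Sum>i<n. b i - a i) < \<delta> \<longrightarrow> (\<Sum>i<n. \<bar>E (b i) - E (a i)\<bar>) < \<epsilon>"
    using \<delta>1(1) \<delta>2(1) by (intro exI[of _ "min \<delta>1 \<delta>2"]) auto
qed

definition variation :: "(real \<Rightarrow> real) \<Rightarrow> real \<Rightarrow> real \<Rightarrow> real" where
  "variation F c d = Sup {\<Sum>i<n. \<bar>F (b i) - F (a i)\<bar> | n a b. interval_family c d {..<n::nat} a b}"

text \<open>Cutting a family at \<open>m\<close> by clipping all end points keeps the index set: an interval on one
side of \<open>m\<close> degenerates to a point on the other side and contributes nothing there.\<close>

lemma interval_family_split:
  fixes K :: "'i set" and F :: "real \<Rightarrow> real"
  assumes fam: "interval_family c e K a b" and m: "c \<le> m" "m \<le> e"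
  shows "interval_family c m K (\<lambda>i. min (a i) m) (\<lambda>i. min (b i) m)"
    and "interval_family m e K (\<lambda>i. max (a i) m) (\<lambda>i. max (b i) m)"
    and "(\<Sum>i\<in>K. \<bar>F (b i) - F (a i)\<bar>) \<le> (\<Sum>i\<in>K. \<bar>F (min (b i) m) - F (min (a i) m)\<bar>) +
           (\<Sum>i\<in>K. \<bar>F (max (b i) m) - F (max (a i) m)\<bar>)"
proof -
  have K: "\<And>i. i \<in> K \<Longrightarrow> c \<le> a i \<and> a i \<le> b i \<and> b i \<le> e" "finite K"
    and D: "\<And>i j. i \<in> K \<Longrightarrow> j \<in> K \<Longrightarrow> i \<noteq> j \<Longrightarrow> {a i<..<b i} \<inter> {a j<..<b j} = {}"
    using fam unfolding interval_family_def by blast+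
  have "{min (a i) m<..<min (b i) m} \<inter> {min (a j) m<..<min (b j) m} = {}"
    "{max (a i) m<..<max (b i) m} \<inter> {max (a j) m<..<max (b j) m} = {}"
    if "i \<in> K" "j \<in> K" "i \<noteq> j" for i j
  proof -
    have "{min (a k) m<..<min (b k) m} \<subseteq> {a k<..<b k}" "{max (a k) m<..<max (b k) m} \<subseteq> {a k<..<b k}" for k
      by auto
    then show "{min (a i) m<..<min (b i) m} \<inter> {min (a j) m<..<min (b j) m} = {}"
      "{max (a i) m<..<max (b i) m} \<inter> {max (a j) m<..<max (b j) m} = {}"
      using D[OF that] by blast+
  qed
  moreover have "c \<le> min (a i) m \<and> min (a i) m \<le> min (b i) m \<and> min (b i) m \<le> m"
    "m \<le> max (a i) m \<and> max (a i) m \<le> max (b i) m \<and> max (b i) m \<le> e" if "i \<in> K" for i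
    using K(1)[OF that] m by (auto simp: min_def max_def)
  ultimately show "interval_family c m K (\<lambda>i. min (a i) m) (\<lambda>i. min (b i) m)"
    "interval_family m e K (\<lambda>i. max (a i) m) (\<lambda>i. max (b i) m)"
    unfolding interval_family_def using K(2) by auto
  show "(\<Sum>i\<in>K. \<bar>F (b i) - F (a i)\<bar>) \<le> (\<Sum>i\<in>K. \<bar>F (min (b i) m) - F (min (a i) m)\<bar>) +
           (\<Sum>i\<in>K. \<bar>F (max (b i) m) - F (max (a i) m)\<bar>)"
    unfolding sum.distrib[symmetric]
  proof (rule sum_mono)
    fix i assume "i \<in> K"
    then have "a i \<le> b i" using K by blast
    then show "\<bar>F (b i) - F (a i)\<bar> \<le> \<bar>F (min (b i) m) - F (min (a i) m)\<bar> + \<bar>F (max (b i) m) - F (max (a i) m)\<bar>"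
      by (auto simp: min_def max_def)
  qed
qed


text \<open>Absolute continuity for \<open>\<epsilon> = 1\<close> bounds the variation on each piece of length \<open>\<delta> / 2\<close> by 1, and
finitely many such pieces cover the interval.\<close>

lemma abs_continuous_on_bounded_variation:
  assumes F: "abs_continuous_on {c..d} F" and "c \<le> d"
  shows "bdd_above {\<Sum>i<n. \<bar>F (b i) - F (a i)\<bar> | n a b. interval_family c d {..<n::nat} a b}"
proof -
  obtain \<delta> where \<delta>: "\<delta> > 0" and H: "\<And>(K :: nat set) a b. interval_family c d K a b \<Longrightarrow>
      (\<Sum>i\<in>K. b i - a i) < \<delta> \<Longrightarrow> (\<Sum>i\<in>K. \<bar>F (b i) - F (a i)\<bar>) < 1"
    by (rule abs_continuous_on_interval_family[OF F zero_less_one]) (rule that)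
  have *: "\<forall>e K a b. c \<le> e \<longrightarrow> e \<le> d \<longrightarrow> e - c \<le> real k * (\<delta> / 2) \<longrightarrow> interval_family c e (K :: nat set) a b \<longrightarrow>
     (\<Sum>i\<in>K. \<bar>F (b i) - F (a i)\<bar>) \<le> real k + 1" for k
  proof (induction k)
    case 0
    show ?case
    proof (intro allI impI)
      fix e K a b assume e: "c \<le> e" "e \<le> d" "e - c \<le> real 0 * (\<delta> / 2)"
        and fam: "interval_family c e (K :: nat set) a b"
      have "interval_family c d K a b" using fam e by (fastforce simp: interval_family_def)
      moreover have "(\<Sum>i\<in>K. b i - a i) < \<delta>"
        using interval_family_length[OF fam] e \<delta> by linarith
      ultimately show "(\<Sum>i\<in>K. \<bar>F (b i) - F (a i)\<bar>) \<le> real 0 + 1" using H by fastforce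
    qed
  next
    case (Suc k)
    show ?case
    proof (intro allI impI)
      fix e K a b assume e: "c \<le> e" "e \<le> d" "e - c \<le> real (Suc k) * (\<delta> / 2)"
        and fam: "interval_family c e (K :: nat set) a b"
      define m where "m = max c (e - \<delta> / 2)"
      have m: "c \<le> m" "m \<le> e" "m \<le> d" "e - m < \<delta>" "m - c \<le> real k * (\<delta> / 2)"
        using e \<delta> by (auto simp: m_def max_def algebra_simps)
      note s = interval_family_split[OF fam m(1,2)]
      have "(\<Sum>i\<in>K. \<bar>F (min (b i) m) - F (min (a i) m)\<bar>) \<le> real k + 1"
        using Suc.IH s(1) m by blast
      moreover have "(\<Sum>i\<in>K. \<bar>F (max (b i) m) - F (max (a i) m)\<bar>) < 1"
      proof (rule H)
        show "interval_family c d K (\<lambda>i. max (a i) m) (\<lambda>i. max (b i) m)"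
          using s(2) e m by (fastforce simp: interval_family_def)
        show "(\<Sum>i\<in>K. max (b i) m - max (a i) m) < \<delta>"
          using interval_family_length[OF s(2)] m by linarith
      qed
      ultimately show "(\<Sum>i\<in>K. \<bar>F (b i) - F (a i)\<bar>) \<le> real (Suc k) + 1"
        using s(3)[of F] by simp
    qed
  qed
  obtain k where k: "d - c \<le> real k * (\<delta> / 2)"
    using real_arch_simple[of "(d - c) / (\<delta> / 2)"] \<delta> by (auto simp: field_simps)
  show ?thesis
    unfolding bdd_above_def using *[of k] k \<open>c \<le> d\<close> by (intro exI[of _ "real k + 1"]) blast
qed

lemma variation_upper:
  assumes F: "abs_continuous_on {c..d} F" and "c \<le> d" and "interval_family c d {..<n::nat} a b"
  shows "(\<Sum>i<n. \<bar>F (b i) - F (a i)\<bar>) \<le> variation F c d"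
  unfolding variation_def
  by (rule cSup_upper[OF _ abs_continuous_on_bounded_variation[OF F \<open>c \<le> d\<close>]]) (use assms(3) in blast)

lemma variation_least:
  assumes "\<And>n a b. interval_family c d {..<n::nat} a b \<Longrightarrow> (\<Sum>i<n. \<bar>F (b i) - F (a i)\<bar>) \<le> B"
  shows "variation F c d \<le> B"
  unfolding variation_def
proof (rule cSup_least)
  have "interval_family c d {..<0::nat} a b" for a b by (simp add: interval_family_def)
  then show "{\<Sum>i<n. \<bar>F (b i) - F (a i)\<bar> | n a b. interval_family c d {..<n::nat} a b} \<noteq> {}" by blast
qed (use assms in blast)

lemma variation_nearly_attained:
  assumes F: "abs_continuous_on {c..d} F" and "c \<le> d" "\<epsilon> > 0"
  shows "\<exists>n a b. interval_family c d {..<n::nat} a b \<and> variation F c d - \<epsilon> < (\<Sum>i<n. \<bar>F (b i) - F (a i)\<bar>)"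
proof (rule ccontr)
  assume "\<not> ?thesis"
  then have "variation F c d \<le> variation F c d - \<epsilon>" by (intro variation_least) (meson not_less)
  then show False using assms(3) by simp
qed

lemma variation_split_le:
  assumes F: "abs_continuous_on {c..e} F" and m: "c \<le> m" "m \<le> e"
  shows "variation F c e \<le> variation F c m + variation F m e"
proof (rule variation_least)
  fix n a b assume "interval_family c e {..<n::nat} a b"
  note s = interval_family_split[OF this m]
  have "abs_continuous_on {c..m} F" "abs_continuous_on {m..e} F"
    using abs_continuous_on_subinterval[OF F] m by auto
  from variation_upper[OF this(1) m(1) s(1)] variation_upper[OF this(2) m(2) s(2)] s(3)[of F]
  show "(\<Sum>i<n. \<bar>F (b i) - F (a i)\<bar>) \<le> variation F c m + variation F m e" by linarith
qed

lemma variation_append_ge: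
  assumes F: "abs_continuous_on {c..e} F" and m: "c \<le> m" "m \<le> e"
  shows "variation F c m + \<bar>F e - F m\<bar> \<le> variation F c e"
proof -
  have "variation F c m \<le> variation F c e - \<bar>F e - F m\<bar>"
  proof (rule variation_least)
    fix n a b assume fam: "interval_family c m {..<n::nat} a b"
    have "interval_family c e {..<Suc n} (\<lambda>i. if i < n then a i else m) (\<lambda>i. if i < n then b i else e)"
      unfolding interval_family_def
    proof (intro conjI ballI impI)
      fix i j assume ij: "i \<in> {..<Suc n}" "j \<in> {..<Suc n}" "i \<noteq> j"
      have bm: "b k \<le> m" if "k < n" for k using fam that by (auto simp: interval_family_def)
      have ab: "{a i<..<b i} \<inter> {a j<..<b j} = {}" if "i < n" "j < n"
        using fam that ij(3) unfolding interval_family_def by blast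
      consider "i < n" "j < n" | "i < n" "j = n" | "i = n" "j < n" using ij by force
      then show "{(if i < n then a i else m)<..<(if i < n then b i else e)} \<inter>
          {(if j < n then a j else m)<..<(if j < n then b j else e)} = {}"
      proof cases
        case 1 then show ?thesis using ab by simp
      next
        case 2 then show ?thesis using bm[of i] by (auto simp: min_le_iff_disj le_max_iff_disj)
      next
        case 3 then show ?thesis using bm[of j] by (auto simp: min_le_iff_disj le_max_iff_disj)
      qed
    next
      fix i assume "i \<in> {..<Suc n}"
      show "c \<le> (if i < n then a i else m)"
        "(if i < n then a i else m) \<le> (if i < n then b i else e)"
        "(if i < n then b i else e) \<le> e"
        using fam m unfolding interval_family_def by force+
    qed simp
    from variation_upper[OF F _ this] m
    have "(\<Sum>i<Suc n. \<bar>F (if i < n then b i else e) - F (if i < n then a i else m)\<bar>) \<le> variation F c e" by simp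
    then show "(\<Sum>i<n. \<bar>F (b i) - F (a i)\<bar>) \<le> variation F c e - \<bar>F e - F m\<bar>"
      by simp
  qed
  then show ?thesis by simp
qed

text \<open>On each interval of a short family the variation is nearly attained by a subfamily. The union
of these subfamilies is again short, so the increments of \<open>F\<close> along it are small.\<close>

lemma abs_continuous_on_variation:
  assumes F: "abs_continuous_on {c..d} F"
  shows "abs_continuous_on {c..d} (variation F c)"
proof (rule abs_continuous_on_intervalI)
  fix \<epsilon> :: real assume "\<epsilon> > 0"
  then have "\<epsilon> / 2 > 0" by simp
  obtain \<delta> where \<delta>: "\<delta> > 0" and H: "\<And>(K :: (nat \<times> nat) set) a b. interval_family c d K a b \<Longrightarrow>
      (\<Sum>i\<in>K. b i - a i) < \<delta> \<Longrightarrow> (\<Sum>i\<in>K. \<bar>F (b i) - F (a i)\<bar>) < \<epsilon> / 2"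
    by (rule abs_continuous_on_interval_family[OF F \<open>\<epsilon> / 2 > 0\<close>]) (rule that)
  have "(\<Sum>j<m. \<bar>variation F c (q j) - variation F c (p j)\<bar>) < \<epsilon>"
    if fam: "interval_family c d {..<m::nat} p q" and len: "(\<Sum>j<m. q j - p j) < \<delta>" for m p q
  proof -
    define \<eta> where "\<eta> = \<epsilon> / (2 * (real m + 1))"
    have \<eta>: "\<eta> > 0" "real m * \<eta> < \<epsilon> / 2" using \<open>\<epsilon> > 0\<close> by (auto simp: \<eta>_def field_simps)
    have pq: "c \<le> p j" "p j \<le> q j" "q j \<le> d" if "j < m" for j
      using fam that by (auto simp: interval_family_def)
    have ac: "abs_continuous_on {p j..q j} F" if "j < m" for j
      using abs_continuous_on_subinterval[OF F] pq[OF that] by auto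
    define good where "good = (\<lambda>j (n, a, b). interval_family (p j) (q j) {..<n::nat} a b \<and>
        variation F (p j) (q j) - \<eta> < (\<Sum>i<n. \<bar>F (b i) - F (a i)\<bar>))"
    have "\<exists>x. good j x" if "j < m" for j
      using variation_nearly_attained[OF ac[OF that] pq(2)[OF that] \<eta>(1)]
      unfolding good_def by (simp only: split_paired_Ex prod.case)
    then have "\<forall>j\<in>{..<m}. \<exists>x. good j x" by simp
    then obtain f where f: "\<forall>j\<in>{..<m}. good j (f j)" by (rule bchoice[THEN exE])
    define n a b where "n = (\<lambda>j. fst (f j))" and "a = (\<lambda>j. fst (snd (f j)))" and "b = (\<lambda>j. snd (snd (f j)))"
    have nab: "interval_family (p j) (q j) {..<n j} (a j) (b j)"
      "variation F (p j) (q j) - \<eta> < (\<Sum>i<n j. \<bar>F (b j i) - F (a j i)\<bar>)" if "j < m" for j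
      using f[rule_format, of j] that by (simp_all add: good_def n_def a_def b_def split_beta)
    define K where "K = (SIGMA j:{..<m}. {..<n j})"
    define a' where "a' = (\<lambda>(j,i). a j i)"
    define b' where "b' = (\<lambda>(j,i). b j i)"
    have ab: "p j \<le> a j i" "a j i \<le> b j i" "b j i \<le> q j" if "j < m" "i < n j" for i j
      using nab(1)[OF that(1)] that(2) by (auto simp: interval_family_def)
    have "interval_family c d K a' b'"
      unfolding interval_family_def
    proof (intro conjI ballI impI)
      show "finite K" by (simp add: K_def)
    next
      fix x assume "x \<in> K"
      then obtain j i where x: "x = (j, i)" and lt: "j < m" "i < n j" by (auto simp: K_def)
      show "c \<le> a' x" "a' x \<le> b' x" "b' x \<le> d"
        using ab[OF lt] pq[OF lt(1)] by (simp_all add: x a'_def b'_def)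
    next
      fix x y assume xy: "x \<in> K" "y \<in> K" "x \<noteq> y"
      obtain j i where x: "x = (j, i)" by fastforce
      obtain j' i' where y: "y = (j', i')" by fastforce
      have lt: "j < m" "j' < m" "i < n j" "i' < n j'" using xy x y by (auto simp: K_def)
      show "{a' x<..<b' x} \<inter> {a' y<..<b' y} = {}"
      proof (cases "j = j'")
        case True
        then have "i \<noteq> i'" using xy x y by auto
        then have "{a j i<..<b j i} \<inter> {a j i'<..<b j i'} = {}"
          using nab(1)[OF lt(1)] lt True unfolding interval_family_def by blast
        then show ?thesis using True by (simp add: x y a'_def b'_def)
      next
        case False
        then have "{p j<..<q j} \<inter> {p j'<..<q j'} = {}" using fam lt unfolding interval_family_def by blast
        moreover have "{a' x<..<b' x} \<subseteq> {p j<..<q j}" "{a' y<..<b' y} \<subseteq> {p j'<..<q j'}"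
          using ab[OF lt(1,3)] ab[OF lt(2,4)] unfolding x y a'_def b'_def greaterThanLessThan_subseteq_greaterThanLessThan
          by auto
        ultimately show ?thesis by blast
      qed
    qed
    moreover have "(\<Sum>x\<in>K. b' x - a' x) < \<delta>"
    proof -
      have "(\<Sum>x\<in>K. b' x - a' x) = (\<Sum>j<m. \<Sum>i<n j. b j i - a j i)"
        unfolding K_def a'_def b'_def by (simp add: sum.Sigma split_beta)
      also have "\<dots> \<le> (\<Sum>j<m. q j - p j)"
        using interval_family_length[OF nab(1)] pq by (intro sum_mono) auto
      finally show ?thesis using len by simp
    qed
    ultimately have "(\<Sum>x\<in>K. \<bar>F (b' x) - F (a' x)\<bar>) < \<epsilon> / 2" by (rule H)
    moreover have "(\<Sum>x\<in>K. \<bar>F (b' x) - F (a' x)\<bar>) = (\<Sum>j<m. \<Sum>i<n j. \<bar>F (b j i) - F (a j i)\<bar>)"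
      unfolding K_def a'_def b'_def by (simp add: sum.Sigma split_beta)
    moreover have "(\<Sum>j<m. \<bar>variation F c (q j) - variation F c (p j)\<bar>) \<le>
        (\<Sum>j<m. (\<Sum>i<n j. \<bar>F (b j i) - F (a j i)\<bar>) + \<eta>)"
    proof (rule sum_mono)
      fix j assume "j \<in> {..<m}"
      then have j: "j < m" by simp
      have cq: "abs_continuous_on {c..q j} F" using abs_continuous_on_subinterval[OF F] pq[OF j] by auto
      show "\<bar>variation F c (q j) - variation F c (p j)\<bar> \<le> (\<Sum>i<n j. \<bar>F (b j i) - F (a j i)\<bar>) + \<eta>"
        using variation_split_le[OF cq pq(1,2)[OF j]] variation_append_ge[OF cq pq(1,2)[OF j]] nab(2)[OF j]
        by linarith
    qed
    ultimately show ?thesis using \<eta>(2) by (simp add: sum.distrib)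
  qed
  then show "\<exists>\<delta>>0. \<forall>m p q. interval_family c d {..<m::nat} p q \<longrightarrow>
     (\<Sum>j<m. q j - p j) < \<delta> \<longrightarrow> (\<Sum>j<m. \<bar>variation F c (q j) - variation F c (p j)\<bar>) < \<epsilon>"
    by (intro exI[of _ \<delta>] conjI allI impI \<delta>)
qed

text \<open>Jordan decomposition: the variation \<open>V\<close> and \<open>V - F\<close> are both increasing, and both inherit absolute
continuity.\<close>

lemma abs_continuous_on_difference_of_increasing:
  assumes F: "abs_continuous_on {c..d} F"
  obtains P Q where "abs_continuous_on {c..d} P" "abs_continuous_on {c..d} Q"
    "mono_on {c..d} P" "mono_on {c..d} Q" "\<And>x. F x = P x - Q x"
proof (rule that)
  let ?V = "variation F c"
  have inc: "\<bar>F y - F x\<bar> \<le> ?V y - ?V x" if "c \<le> x" "x \<le> y" "y \<le> d" for x y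
    using variation_append_ge[OF abs_continuous_on_subinterval[OF F, of c y] that(1,2)] that by auto
  show V: "abs_continuous_on {c..d} ?V" by (rule abs_continuous_on_variation[OF F])
  show "mono_on {c..d} ?V" by (intro mono_onI) (use inc in fastforce)
  show "mono_on {c..d} (\<lambda>x. ?V x - F x)" by (intro mono_onI) (use inc in fastforce)
  show "abs_continuous_on {c..d} (\<lambda>x. ?V x - F x)"
    by (rule abs_continuous_on_dominated[OF V F, where A = 1 and B = 1]) auto
qed simp

section \<open>The fundamental theorem of calculus for absolutely continuous functions\<close>

lemma absolutely_integrable_cong_AE:
  fixes f g :: "real \<Rightarrow> real"
  assumes f: "f absolutely_integrable_on S" and eq: "AE x in lebesgue. x \<in> S \<longrightarrow> f x = g x"
  shows "g absolutely_integrable_on S"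
    and "(LINT x:S|lebesgue. f x) = (LINT x:S|lebesgue. g x)"
proof -
  define N where "N = {x. \<not> (x \<in> S \<longrightarrow> f x = g x)}"
  have N: "negligible N"
    using eq unfolding N_def negligible_iff_null_sets completion.AE_iff_null_sets by simp
  show g: "g absolutely_integrable_on S"
    by (rule absolutely_integrable_spike[OF f N]) (auto simp: N_def)
  have "integral S f = integral S g"
    by (rule integral_spike[OF N]) (auto simp: N_def)
  then show "(LINT x:S|lebesgue. f x) = (LINT x:S|lebesgue. g x)"
    by (simp add: set_lebesgue_integral_eq_integral(2)[OF f] set_lebesgue_integral_eq_integral(2)[OF g])
qed

text \<open>The Stieltjes measure of \<open>F\<close>, extended by constants outside \<open>{c..d}\<close>, is absolutely continuous
with respect to Lebesgue measure: a null set lies in an open set \<open>U\<close> of measure below \<open>\<delta>\<close>, finite unions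
of closed intervals exhaust \<open>U\<close>, and each of them divides into a family to which the \<open>\<epsilon>\<close>-\<open>\<delta>\<close> condition
applies. The Radon-Nikodym density then represents the increments of \<open>F\<close>.\<close>

lemma increasing_abs_continuous_density:
  assumes F: "abs_continuous_on {c..d} F" and mono: "mono_on {c..d} F" and "c \<le> d"
  obtains f where "integrable lborel f"
    "\<And>x y. c \<le> x \<Longrightarrow> x \<le> y \<Longrightarrow> y \<le> d \<Longrightarrow> integral {x..y} f = F y - F x"
proof -
  define clip where "clip = (\<lambda>x. max c (min d x))"
  define G where "G = (\<lambda>x. F (clip x))"
  have clip: "clip x \<in> {c..d}" "x \<le> y \<Longrightarrow> clip x \<le> clip y" "x \<in> {c..d} \<Longrightarrow> clip x = x" for x y
    using \<open>c \<le> d\<close> by (auto simp: clip_def)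
  have monoG: "\<And>x y. x \<le> y \<Longrightarrow> G x \<le> G y"
    unfolding G_def using clip by (intro mono_onD[OF mono]) auto
  have "continuous_on UNIV clip" unfolding clip_def by (intro continuous_intros)
  then have contG: "continuous_on UNIV G"
    unfolding G_def by (rule continuous_on_compose2[OF abs_continuous_on_imp_continuous_on[OF F]]) (use clip in auto)
  then have right: "continuous (at_right a) G" for a
    by (meson continuous_at_imp_continuous_at_within continuous_on_eq_continuous_at open_UNIV UNIV_I)
  define \<mu> where "\<mu> = interval_measure G"
  have Icc: "emeasure \<mu> {x..y} = ennreal (G y - G x)" if "x \<le> y" for x y
    unfolding \<mu>_def by (rule emeasure_interval_measure_Icc[OF that monoG contG])
  have sets[measurable_cong]: "sets \<mu> = sets lborel" by (simp add: \<mu>_def)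
  \<comment> \<open>Stated with the \<open>\<epsilon>\<close>-\<open>\<delta>\<close> property of \<open>F\<close> as a premise; division members serve as their own indices.\<close>
  have open_small: "emeasure \<mu> U \<le> \<epsilon>"
    if U: "open U" "emeasure lborel U < ennreal \<delta>"
      and \<delta>: "\<And>(K :: real set set) a b. interval_family c d K a b \<Longrightarrow>
        (\<Sum>i\<in>K. b i - a i) < \<delta> \<Longrightarrow> (\<Sum>i\<in>K. \<bar>F (b i) - F (a i)\<bar>) < \<epsilon>" for U \<epsilon> \<delta>
  proof -
    obtain D where D: "countable D" "D \<subseteq> Pow U" "\<And>X. X \<in> D \<Longrightarrow> \<exists>a b. X = cbox a b" "\<Union>D = U"
      using open_countable_Union_open_cbox[OF U(1)] by metis
    show ?thesis
    proof (cases "D = {}")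
      case True
      then show ?thesis using D by auto
    next
      case False
      define B where "B = (\<lambda>n. \<Union>i<n::nat. from_nat_into D i)"
      have Dn: "from_nat_into D i \<in> D" for i by (rule from_nat_into[OF False])
      have "(\<Union>n. B n) = U"
      proof -
        have "(\<Union>n. B n) = (\<Union>i. from_nat_into D i)" unfolding B_def by auto
        also have "\<dots> = U" using D(4) range_from_nat_into[OF False D(1)] by simp
        finally show ?thesis .
      qed
      moreover have "range B \<subseteq> sets \<mu>"
      proof -
        have "from_nat_into D i \<in> sets borel" for i using D(3)[OF Dn[of i]] by auto
        then have "B n \<in> sets borel" for n unfolding B_def by (intro sets.finite_UN) auto
        then show ?thesis by (auto simp: sets)
      qed
      moreover have "incseq B" unfolding B_def by (intro incseq_SucI) (auto simp: less_Suc_eq)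
      ultimately have "emeasure \<mu> U = (SUP n. emeasure \<mu> (B n))"
        using SUP_emeasure_incseq[of B \<mu>] by simp
      also have "\<dots> \<le> \<epsilon>"
      proof (rule SUP_least)
        fix n
        have "\<exists>p. p division_of B n"
          unfolding B_def using elementary_unions_intervals[of "from_nat_into D ` {..<n}"] D(3)[OF Dn] by (metis finite_imageI finite_lessThan imageE)
        then obtain p where p: "p division_of B n" ..
        define l u where "l = (\<lambda>k::real set. clip (Inf k))" and "u = (\<lambda>k::real set. clip (Sup k))"
        have k: "\<exists>x y. x \<le> y \<and> k = {x..y} \<and> Inf k = x \<and> Sup k = y" if kp: "k \<in> p" for k
          using division_ofD(3,4)[OF p kp] by fastforce
        have "finite p" using p by blast
        have "interval_family c d p l u"
          unfolding interval_family_def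
        proof (intro conjI ballI impI)
          fix k k' assume kk: "k \<in> p" "k' \<in> p" "k \<noteq> k'"
          obtain x y where xy: "x \<le> y" "k = {x..y}" "Inf k = x" "Sup k = y" using k[OF kk(1)] by blast
          obtain x' y' where xy': "x' \<le> y'" "k' = {x'..y'}" "Inf k' = x'" "Sup k' = y'" using k[OF kk(2)] by blast
          have "{x<..<y} \<inter> {x'<..<y'} = {}"
            using division_ofD(5)[OF p kk] unfolding xy(2) xy'(2) interior_atLeastAtMost_real .
          moreover have "{clip a<..<clip b} \<subseteq> {a<..<b}" for a b
            unfolding clip_def by auto
          ultimately show "{l k<..<u k} \<inter> {l k'<..<u k'} = {}"
            unfolding l_def u_def xy(3,4) xy'(3,4) by blast
        next
          fix i assume "i \<in> p"
          then show "c \<le> l i" "l i \<le> u i" "u i \<le> d"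
            using k[of i] clip unfolding l_def u_def by auto
        qed (rule \<open>finite p\<close>)
        moreover have "(\<Sum>k\<in>p. u k - l k) < \<delta>"
        proof -
          have fin: "emeasure lborel U < \<infinity>" using order_less_trans[OF U(2) ennreal_less_top] by simp
          have "(\<Sum>k\<in>p. u k - l k) \<le> (\<Sum>k\<in>p. measure lebesgue k)"
          proof (rule sum_mono)
            fix k' assume "k' \<in> p"
            then obtain x y where xy: "x \<le> y" "k' = {x..y}" "Inf k' = x" "Sup k' = y" using k by blast
            have "clip y - clip x \<le> y - x" using xy(1) unfolding clip_def by (auto simp: max_def min_def)
            then show "u k' - l k' \<le> measure lebesgue k'" using xy by (simp add: l_def u_def)
          qed
          also have "\<dots> = measure lebesgue (B n)" by (rule content_division[OF p])
          also have "\<dots> \<le> measure lebesgue U"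
          proof (rule measure_mono_fmeasurable)
            show "B n \<subseteq> U" using \<open>(\<Union>n. B n) = U\<close> by blast
            show "B n \<in> sets lebesgue" using \<open>range B \<subseteq> sets \<mu>\<close> by (auto simp: sets)
            show "U \<in> lmeasurable" using U(1) fin by (auto simp: fmeasurable_def)
          qed
          also have "\<dots> = measure lborel U" using U(1) by (simp add: measure_completion)
          also have "\<dots> < \<delta>"
            using U(2) fin by (simp add: emeasure_eq_ennreal_measure ennreal_less_iff)
          finally show ?thesis .
        qed
        ultimately have "(\<Sum>k\<in>p. \<bar>F (u k) - F (l k)\<bar>) < \<epsilon>" by (rule \<delta>)
        moreover have "emeasure \<mu> (B n) \<le> (\<Sum>k\<in>p. emeasure \<mu> k)"
        proof -
          have "B n = (\<Union>k\<in>p. k)" using division_ofD(6)[OF p] by simp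
          moreover have "k' \<in> sets \<mu>" if kp: "k' \<in> p" for k'
          proof -
            obtain x y where "k' = {x..y}" using k[OF kp] by blast
            then show ?thesis by (simp add: sets)
          qed
          ultimately show ?thesis using emeasure_subadditive_finite[OF \<open>finite p\<close>, of "\<lambda>k. k" \<mu>] by auto
        qed
        moreover have "(\<Sum>k\<in>p. emeasure \<mu> k) = (\<Sum>k\<in>p. ennreal \<bar>F (u k) - F (l k)\<bar>)"
        proof (rule sum.cong[OF refl])
          fix k' assume "k' \<in> p"
          then obtain x y where xy: "x \<le> y" "k' = {x..y}" "Inf k' = x" "Sup k' = y" using k by blast
          then show "emeasure \<mu> k' = ennreal \<bar>F (u k') - F (l k')\<bar>"
            using Icc[OF xy(1)] monoG[OF xy(1)] by (simp add: l_def u_def G_def)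
        qed
        ultimately have "emeasure \<mu> (B n) \<le> ennreal (\<Sum>k\<in>p. \<bar>F (u k) - F (l k)\<bar>)"
          by (simp add: sum_ennreal)
        also have "\<dots> \<le> ennreal \<epsilon>"
          by (rule ennreal_leI) (use \<open>(\<Sum>k\<in>p. \<bar>F (u k) - F (l k)\<bar>) < \<epsilon>\<close> in simp)
        finally show "emeasure \<mu> (B n) \<le> ennreal \<epsilon>" .
      qed
      finally show ?thesis .
    qed
  qed
  have "absolutely_continuous lborel \<mu>"
    unfolding absolutely_continuous_def
  proof
    fix N :: "real set" assume N: "N \<in> null_sets lborel"
    then have Nb: "N \<in> sets borel" and N0: "emeasure lborel N = 0" by auto
    have "emeasure \<mu> N \<le> 0 + ennreal \<epsilon>" if "\<epsilon> > 0" for \<epsilon> :: real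
    proof -
      obtain \<delta> where \<delta>: "\<delta> > 0" and H: "\<And>(K :: real set set) a b. interval_family c d K a b \<Longrightarrow>
          (\<Sum>i\<in>K. b i - a i) < \<delta> \<Longrightarrow> (\<Sum>i\<in>K. \<bar>F (b i) - F (a i)\<bar>) < \<epsilon>"
        by (rule abs_continuous_on_interval_family[OF F \<open>\<epsilon> > 0\<close>]) (rule that)
      obtain U where U: "open U" "N \<subseteq> U" "emeasure lborel (U - N) < \<delta>"
        by (rule outer_regular_lborel[OF Nb \<delta>])
      have "emeasure lborel U = emeasure lborel (U - N)"
        by (rule emeasure_Diff_null_set[OF N, symmetric]) (use U in auto)
      then have "emeasure lborel U < ennreal \<delta>" using U(3) by (rule ssubst)
      then have "emeasure \<mu> U \<le> ennreal \<epsilon>" by (rule open_small[OF U(1)]) (rule H)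
      moreover have "emeasure \<mu> N \<le> emeasure \<mu> U" using U(1,2) by (intro emeasure_mono) (auto simp: sets)
      ultimately show ?thesis by (simp only: add_0_left)
    qed
    then have "emeasure \<mu> N \<le> 0" by (rule ennreal_le_epsilon)
    then show "N \<in> null_sets \<mu>" using Nb by (intro null_setsI) (simp_all add: sets)
  qed
  from sigma_finite_measure.Radon_Nikodym[OF sigma_finite_lborel this sets] obtain g where
    g[measurable]: "g \<in> borel_measurable lborel" and dens: "density lborel g = \<mu>" by blast
  have total: "emeasure \<mu> UNIV \<le> ennreal (F d - F c)"
  proof -
    have "emeasure \<mu> UNIV = (SUP n. emeasure \<mu> {-real n..real n})"
    proof -
      have "(\<Union>n. {-real n..real n}) = UNIV"
      proof (rule set_eqI, rule iffI)
        fix x :: real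
        obtain n where "\<bar>x\<bar> \<le> real n" using real_arch_simple by blast
        then show "x \<in> (\<Union>n. {-real n..real n})" by (auto intro!: exI[of _ n])
      qed simp
      moreover have "incseq (\<lambda>n. {-real n..real n})" by (auto simp: incseq_def)
      moreover have "range (\<lambda>n. {-real n..real n}) \<subseteq> sets \<mu>" by (auto simp: sets)
      ultimately show ?thesis using SUP_emeasure_incseq[of "\<lambda>n. {-real n..real n}" \<mu>] by simp
    qed
    also have "\<dots> \<le> ennreal (F d - F c)"
    proof (rule SUP_least)
      fix n
      have "G (real n) \<le> F d" "F c \<le> G (- real n)"
        unfolding G_def using clip \<open>c \<le> d\<close> by (auto intro!: mono_onD[OF mono])
      then show "emeasure \<mu> {-real n..real n} \<le> ennreal (F d - F c)"
        by (subst Icc) (auto intro!: ennreal_leI)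
    qed
    finally show ?thesis .
  qed
  have int_g: "(\<integral>\<^sup>+x\<in>A. g x \<partial>lborel) = emeasure \<mu> A" if "A \<in> sets borel" for A
    using that by (simp add: dens[symmetric] emeasure_density)
  have "(\<integral>\<^sup>+x. g x \<partial>lborel) \<le> ennreal (F d - F c)" using int_g[of UNIV] total by simp
  then have gfin: "(\<integral>\<^sup>+x. g x \<partial>lborel) < \<infinity>" by (simp add: order_le_less_trans)
  then have "AE x in lborel. g x \<noteq> \<infinity>" by (intro nn_integral_noteq_infinite) auto
  then have ge: "AE x in lborel. g x = ennreal (enn2real (g x))" by eventually_elim (simp add: less_top)
  define f where "f = (\<lambda>x. enn2real (g x))"
  have f[measurable]: "f \<in> borel_measurable lborel" and f0: "\<And>x. f x \<ge> 0" by (simp_all add: f_def)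
  have "integrable lborel f"
  proof (rule integrableI_nonneg)
    have "(\<integral>\<^sup>+x. ennreal (f x) \<partial>lborel) = (\<integral>\<^sup>+x. g x \<partial>lborel)"
      by (rule nn_integral_cong_AE) (use ge in eventually_elim, simp add: f_def)
    then show "(\<integral>\<^sup>+x. ennreal (f x) \<partial>lborel) < \<infinity>" using gfin by simp
  qed (use f0 in auto)
  moreover have "integral {x..y} f = F y - F x" if "c \<le> x" "x \<le> y" "y \<le> d" for x y
  proof -
    have si: "set_integrable lborel {x..y} f"
      unfolding set_integrable_def using \<open>integrable lborel f\<close> by (intro integrable_mult_indicator) auto
    have "integral {x..y} f = (LINT t:{x..y}|lborel. f t)"
      using set_borel_integral_eq_integral(2)[OF si] by simp
    also have "\<dots> = enn2real (\<integral>\<^sup>+t. ennreal (indicator {x..y} t *\<^sub>R f t) \<partial>lborel)"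
      unfolding set_lebesgue_integral_def by (rule integral_eq_nn_integral) (use f0 in auto)
    also have "(\<integral>\<^sup>+t. ennreal (indicator {x..y} t *\<^sub>R f t) \<partial>lborel) = (\<integral>\<^sup>+t\<in>{x..y}. g t \<partial>lborel)"
      by (rule nn_integral_cong_AE) (use ge in eventually_elim, simp add: f_def indicator_def)
    also have "\<dots> = ennreal (G y - G x)" using int_g[of "{x..y}"] Icc[OF that(2)] by simp
    finally show ?thesis using monoG[OF that(2)] that clip(3)[of x] clip(3)[of y] by (simp add: G_def)
  qed
  ultimately show thesis by (rule that)
qed

text \<open>Almost everywhere convergence of averages over \<open>[x, x + h]\<close> gives the right derivative; the left
derivative follows by reflecting \<open>f\<close>.\<close>

lemma indefinite_integral_has_derivative_AE:
  fixes f :: "real \<Rightarrow> real"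
  assumes fi: "\<And>a b. f integrable_on cbox a b"
    and F: "\<And>x y. c \<le> x \<Longrightarrow> x \<le> y \<Longrightarrow> y \<le> d \<Longrightarrow> integral {x..y} f = F y - F x"
  shows "AE x in lebesgue. c < x \<and> x < d \<longrightarrow> (F has_real_derivative f x) (at x)"
proof -
  have f': "(\<lambda>x. f (- x)) integrable_on cbox a b" for a b
    using fi[of "-b" "-a"] Henstock_Kurzweil_Integration.integrable_reflect_real[where f=f and a="-b" and b="-a"] by simp
  obtain N where N: "negligible N" and right: "\<And>x e. \<lbrakk>x \<notin> N; 0 < e\<rbrakk> \<Longrightarrow>
     \<exists>d>0. \<forall>h. 0 < h \<and> h < d \<longrightarrow> norm (integral (cbox x (x + h *\<^sub>R One)) f /\<^sub>R h ^ DIM(real) - f x) < e"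
    by (rule integrable_ccontinuous_explicit[OF fi]) (rule that)
  obtain N' where N': "negligible N'" and left: "\<And>x e. \<lbrakk>x \<notin> N'; 0 < e\<rbrakk> \<Longrightarrow>
     \<exists>d>0. \<forall>h. 0 < h \<and> h < d \<longrightarrow> norm (integral (cbox x (x + h *\<^sub>R One)) (\<lambda>x. f (- x)) /\<^sub>R h ^ DIM(real) - f (- x)) < e"
    by (rule integrable_ccontinuous_explicit[OF f']) (rule that)
  have neg: "negligible (N \<union> uminus ` N')"
    using N N' by (intro negligible_Un negligible_differentiable_image_negligible)
      (auto simp: differentiable_on_def intro!: derivative_intros)
  have "(F has_real_derivative f x) (at x)" if x: "x \<notin> N \<union> uminus ` N'" "c < x" "x < d" for x
    unfolding DERIV_def LIM_eq
  proof (intro allI impI)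
    fix e :: real assume e: "e > 0"
    have xN: "x \<notin> N" "- x \<notin> N'" using x(1) by (auto simp: image_iff)
    obtain d1 where d1: "d1 > 0" "\<And>h. 0 < h \<Longrightarrow> h < d1 \<Longrightarrow> \<bar>integral {x..x+h} f / h - f x\<bar> < e"
      using right[OF xN(1) e] by (auto simp: divide_inverse mult.commute)
    obtain d2 where d2: "d2 > 0" "\<And>h. 0 < h \<Longrightarrow> h < d2 \<Longrightarrow> \<bar>integral {-x..-x+h} (\<lambda>x. f (- x)) / h - f x\<bar> < e"
      using left[OF xN(2) e] by (auto simp: divide_inverse mult.commute)
    define r where "r = min (min d1 d2) (min (x - c) (d - x))"
    have "\<bar>(F (x + h) - F x) / h - f x\<bar> < e" if h: "h \<noteq> 0" "\<bar>h\<bar> < r" for h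
    proof (cases "h > 0")
      case True
      then have "integral {x..x+h} f = F (x + h) - F x" using h x by (intro F) (auto simp: r_def)
      then show ?thesis using d1(2)[of h] True h by (simp add: r_def)
    next
      case False
      then have h0: "0 < - h" using h by simp
      have "integral {-x..-x-h} (\<lambda>x. f (- x)) = integral {x+h..x} f"
        using Henstock_Kurzweil_Integration.integral_reflect_real[where b=x and a="x+h" and f=f] by simp
      also have "\<dots> = F x - F (x + h)" using h h0 x by (intro F) (auto simp: r_def)
      finally have "integral {-x..-x + - h} (\<lambda>x. f (- x)) = - (F (x + h) - F x)" by simp
      then have "integral {-x..-x + - h} (\<lambda>x. f (- x)) / - h = (F (x + h) - F x) / h"
        by (simp only: minus_divide_divide)
      moreover have "- h < d2" using h(2) h0 by (simp add: r_def)
      ultimately show ?thesis using d2(2)[OF h0] by simp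
    qed
    moreover have "r > 0" using d1 d2 x by (simp add: r_def)
    ultimately show "\<exists>s>0. \<forall>h. h \<noteq> 0 \<and> norm (h - 0) < s \<longrightarrow> norm ((F (x + h) - F x) / h - f x) < e"
      by (intro exI[of _ r]) auto
  qed
  then show ?thesis
    using neg unfolding negligible_iff_null_sets by (intro AE_I'[of "N \<union> uminus ` N'"]) auto
qed

text \<open>Both parts of the Jordan decomposition are indefinite integrals, hence so is \<open>F\<close>, and the
integrand can be replaced by the pointwise derivative because the two agree almost everywhere.\<close>

theorem abs_continuous_fundamental_theorem:
  assumes F: "abs_continuous_on {c..d} F" and "c \<le> d"
  shows "AE x in lebesgue. c < x \<and> x < d \<longrightarrow> (F has_real_derivative deriv F x) (at x)"
    and "deriv F absolutely_integrable_on {c..d}"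
    and "\<And>x y. c \<le> x \<Longrightarrow> x \<le> y \<Longrightarrow> y \<le> d \<Longrightarrow> (LINT t:{x..y}|lebesgue. deriv F t) = F y - F x"
proof -
  obtain P Q where P: "abs_continuous_on {c..d} P" "mono_on {c..d} P"
    and Q: "abs_continuous_on {c..d} Q" "mono_on {c..d} Q" and PQ: "\<And>x. F x = P x - Q x"
    by (rule abs_continuous_on_difference_of_increasing[OF F]) (rule that)
  obtain p where p: "integrable lborel p"
    "\<And>x y. c \<le> x \<Longrightarrow> x \<le> y \<Longrightarrow> y \<le> d \<Longrightarrow> integral {x..y} p = P y - P x"
    by (rule increasing_abs_continuous_density[OF P \<open>c \<le> d\<close>]) (rule that)
  obtain q where q: "integrable lborel q"
    "\<And>x y. c \<le> x \<Longrightarrow> x \<le> y \<Longrightarrow> y \<le> d \<Longrightarrow> integral {x..y} q = Q y - Q x"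
    by (rule increasing_abs_continuous_density[OF Q \<open>c \<le> d\<close>]) (rule that)
  define f where "f = (\<lambda>x. p x - q x)"
  have f: "integrable lborel f" unfolding f_def using p(1) q(1) by simp
  have int: "g integrable_on cbox x y" if "integrable lborel g" for g :: "real \<Rightarrow> real" and x y
    using has_integral_integral_lborel[OF that] integrable_on_subcbox[where f=g and S=UNIV and a=x and b=y] by (auto simp: integrable_on_def)
  have fF: "integral {x..y} f = F y - F x" if "c \<le> x" "x \<le> y" "y \<le> d" for x y
    unfolding f_def using that p q using int[OF p(1), of x y] int[OF q(1), of x y] by (simp add: integral_diff PQ)
  have ae: "AE x in lebesgue. c < x \<and> x < d \<longrightarrow> (F has_real_derivative f x) (at x)"
    by (rule indefinite_integral_has_derivative_AE[OF int[OF f] fF])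
  then show "AE x in lebesgue. c < x \<and> x < d \<longrightarrow> (F has_real_derivative deriv F x) (at x)"
    by eventually_elim (auto simp: DERIV_imp_deriv)
  have "AE x in lebesgue. x \<notin> {c, d}"
    by (rule AE_not_in) (simp flip: negligible_iff_null_sets)
  with ae have eq: "AE x in lebesgue. x \<in> {c..d} \<longrightarrow> deriv F x = f x"
    by eventually_elim (auto simp: DERIV_imp_deriv)
  have "f absolutely_integrable_on {x..y}" for x y
    unfolding set_integrable_def using f by (intro integrable_mult_indicator integrable_completion[THEN iffD2]) auto
  note af = this
  have eq': "AE x in lebesgue. x \<in> {c..d} \<longrightarrow> f x = deriv F x" using eq by eventually_elim auto
  show "deriv F absolutely_integrable_on {c..d}"
    by (rule absolutely_integrable_cong_AE(1)[OF af eq'])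
  show "(LINT t:{x..y}|lebesgue. deriv F t) = F y - F x" if xy: "c \<le> x" "x \<le> y" "y \<le> d" for x y
  proof -
    have "AE t in lebesgue. t \<in> {x..y} \<longrightarrow> f t = deriv F t"
      using eq' by eventually_elim (use xy in auto)
    then have "(LINT t:{x..y}|lebesgue. deriv F t) = (LINT t:{x..y}|lebesgue. f t)"
      by (rule absolutely_integrable_cong_AE(2)[OF af, symmetric])
    also have "\<dots> = F y - F x" using fF[OF xy] set_lebesgue_integral_eq_integral(2)[OF af] by simp
    finally show ?thesis .
  qed
qed

section \<open>Weak derivatives and increments\<close>

text \<open>A continuously differentiable step of width \<open>r\<close> from 0 to 1: the integral of a tent function,
written as a second difference of the truncated square so that its derivative is explicit.\<close>

definition ramp :: "real \<Rightarrow> real \<Rightarrow> real" where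
  "ramp r s = 2 / r\<^sup>2 * ((max 0 s)\<^sup>2 - 2 * (max 0 (s - r/2))\<^sup>2 + (max 0 (s - r))\<^sup>2)"

text \<open>The tent of height \<open>2 / r\<close> on \<open>[0, r]\<close>, the derivative of the step above.\<close>

definition hat :: "real \<Rightarrow> real \<Rightarrow> real" where
  "hat r s = 4 / r\<^sup>2 * (max 0 s - 2 * max 0 (s - r/2) + max 0 (s - r))"

lemma has_derivative_positive_part_squared:
  "((\<lambda>s::real. (max 0 s)\<^sup>2) has_real_derivative 2 * max 0 s) (at s)"
proof -
  consider "s < 0" | "s > 0" | "s = 0" by linarith
  then show ?thesis
  proof cases
    case 1
    have "((\<lambda>s::real. 0) has_real_derivative 2 * max 0 s) (at s)" using 1 by simp
    then show ?thesis
      by (rule has_field_derivative_transform_within_open[of _ _ _ "{..<0}"]) (use 1 in auto)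
  next
    case 2
    have "((\<lambda>s::real. s\<^sup>2) has_real_derivative 2 * max 0 s) (at s)"
      using 2 by (auto intro!: derivative_eq_intros)
    then show ?thesis
      by (rule has_field_derivative_transform_within_open[of _ _ _ "{0<..}"]) (use 2 in auto)
  next
    case 3
    have "((\<lambda>h::real. (max 0 h)\<^sup>2 / h) \<longlongrightarrow> 0) (at 0)"
    proof (rule Lim_null_comparison[where g = "\<lambda>h. \<bar>h\<bar>"])
      show "\<forall>\<^sub>F h in at 0. norm ((max 0 h)\<^sup>2 / h) \<le> \<bar>h::real\<bar>"
        by (intro always_eventually) (auto simp: max_def power2_eq_square)
      show "((\<lambda>h::real. \<bar>h\<bar>) \<longlongrightarrow> 0) (at 0)" by (intro tendsto_eq_intros) auto
    qed
    then show ?thesis unfolding DERIV_def by (simp add: 3)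
  qed
qed

lemma ramp_has_derivative: "((\<lambda>s. ramp r (s - x)) has_real_derivative hat r (s - x)) (at s)"
proof -
  have *: "((\<lambda>s. (max 0 (s - y))\<^sup>2) has_real_derivative 2 * max 0 (s - y)) (at s)" for y
    using DERIV_chain2[where f = "\<lambda>s. (max 0 s)\<^sup>2" and g = "\<lambda>s. s - y" and x = s and s = UNIV,
        OF has_derivative_positive_part_squared[of "s - y"], of 1]
      DERIV_diff[OF DERIV_ident DERIV_const[of y]]
    by simp
  have "((\<lambda>s. 2 / r\<^sup>2 * ((max 0 (s - x))\<^sup>2 - 2 * (max 0 (s - (x + r/2)))\<^sup>2 + (max 0 (s - (x + r)))\<^sup>2))
      has_real_derivative 2 / r\<^sup>2 * (2 * max 0 (s - x) - 2 * (2 * max 0 (s - (x + r/2))) + 2 * max 0 (s - (x + r)))) (at s)"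
    by (intro DERIV_cmult DERIV_add DERIV_diff *)
  moreover have "hat r (s - x) =
      2 / r\<^sup>2 * (2 * max 0 (s - x) - 2 * (2 * max 0 (s - (x + r/2))) + 2 * max 0 (s - (x + r)))"
    by (simp add: hat_def algebra_simps add_divide_distrib diff_divide_distrib)
  ultimately show ?thesis unfolding ramp_def by (simp add: diff_diff_eq)
qed

lemma continuous_on_hat: "continuous_on A (\<lambda>s. hat r (s - x))"
  unfolding hat_def by (intro continuous_intros)

lemma ramp_bounds:
  assumes "r > 0"
  shows "s \<le> 0 \<Longrightarrow> ramp r s = 0" "s \<ge> r \<Longrightarrow> ramp r s = 1" "0 \<le> ramp r s" "ramp r s \<le> 1"
    "hat r s \<ge> 0" "s \<le> 0 \<Longrightarrow> hat r s = 0" "s \<ge> r \<Longrightarrow> hat r s = 0"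
proof -
  show z: "s \<le> 0 \<Longrightarrow> ramp r s = 0" for s using assms by (simp add: ramp_def)
  show o: "s \<ge> r \<Longrightarrow> ramp r s = 1" for s
    using assms by (simp add: ramp_def max_def field_simps power2_eq_square)
  show h: "hat r s \<ge> 0" for s
    unfolding hat_def using assms by (intro mult_nonneg_nonneg) (auto simp: max_def)
  show "s \<le> 0 \<Longrightarrow> hat r s = 0" using assms by (simp add: hat_def)
  show "s \<ge> r \<Longrightarrow> hat r s = 0" using assms by (simp add: hat_def max_def field_simps)
  have mono: "ramp r s \<le> ramp r t" if "s \<le> t" for s t
    using that ramp_has_derivative[of r 0] h by (intro DERIV_nonneg_imp_nondecreasing[of s t "ramp r"]) auto
  show "0 \<le> ramp r s" using mono[of "min s 0" s] z[of "min s 0"] by simp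
  show "ramp r s \<le> 1" using mono[of s "max s r"] o[of "max s r"] by simp
qed

text \<open>The tent has mass 1 and support in \<open>[x, x + r]\<close>, so its average of a continuous function tends to
the value at \<open>x\<close>.\<close>

lemma hat_approximate_identity:
  assumes u: "continuous_on {a..b} u" and x: "a \<le> x" "x < b"
  shows "((\<lambda>r. integral {a..b} (\<lambda>s. u s * hat r (s - x))) \<longlongrightarrow> u x) (at_right 0)"
  unfolding tendsto_iff
proof (intro allI impI)
  fix e :: real assume e: "e > 0"
  then obtain \<delta> where \<delta>: "\<delta> > 0" "\<And>s. s \<in> {a..b} \<Longrightarrow> dist s x < \<delta> \<Longrightarrow> dist (u s) (u x) < e / 2"
    using u x unfolding continuous_on_iff by (metis atLeastAtMost_iff half_gt_zero less_imp_le)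
  have "dist (integral {a..b} (\<lambda>s. u s * hat r (s - x))) (u x) < e" if r: "0 < r" "r < min \<delta> (b - x)" for r
  proof -
    have hi: "((\<lambda>s. hat r (s - x)) has_integral ramp r (b - x) - ramp r (a - x)) {a..b}"
      using x ramp_has_derivative
      by (intro fundamental_theorem_of_calculus)
        (auto simp flip: has_real_derivative_iff_has_vector_derivative intro: has_field_derivative_at_within)
    then have one: "((\<lambda>s. hat r (s - x)) has_integral 1) {a..b}"
      using ramp_bounds(1,2)[OF r(1)] r x by simp
    have i1: "(\<lambda>s. u s * hat r (s - x)) integrable_on {a..b}"
      by (intro integrable_continuous_real continuous_intros u continuous_on_hat)
    have "integral {a..b} (\<lambda>s. u s * hat r (s - x)) - u x
        = integral {a..b} (\<lambda>s. u s * hat r (s - x)) - integral {a..b} (\<lambda>s. u x * hat r (s - x))"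
      using one by (simp add: integral_unique)
    also have "\<dots> = integral {a..b} (\<lambda>s. u s * hat r (s - x) - u x * hat r (s - x))"
      by (intro integral_diff[symmetric] i1 integrable_continuous_real continuous_intros continuous_on_hat)
    finally have "norm (integral {a..b} (\<lambda>s. u s * hat r (s - x)) - u x)
        = norm (integral {a..b} (\<lambda>s. u s * hat r (s - x) - u x * hat r (s - x)))" by simp
    also have "\<dots> \<le> integral {a..b} (\<lambda>s. e / 2 * hat r (s - x))"
    proof (rule integral_norm_bound_integral)
      fix s assume s: "s \<in> {a..b}"
      show "norm (u s * hat r (s - x) - u x * hat r (s - x)) \<le> e / 2 * hat r (s - x)"
      proof (cases "0 < s - x \<and> s - x < r")
        case True
        then have "\<bar>u s - u x\<bar> \<le> e / 2" using \<delta>(2)[OF s] r by (auto simp: dist_real_def)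
        then show ?thesis using ramp_bounds(5)[OF r(1), of "s - x"]
          using mult_right_mono[of "\<bar>u s - u x\<bar>" "e / 2" "hat r (s - x)"]
          by (simp add: left_diff_distrib[symmetric] abs_mult)
      next
        case False
        then have "hat r (s - x) = 0" using ramp_bounds(6,7)[OF r(1)] by force
        then show ?thesis by simp
      qed
    qed (intro integrable_continuous_real continuous_intros u continuous_on_hat)+
    also have "\<dots> = e / 2" using one by (simp add: integral_unique)
    finally show ?thesis using e by (simp add: dist_norm)
  qed
  then show "\<forall>\<^sub>F r in at_right 0. dist (integral {a..b} (\<lambda>s. u s * hat r (s - x))) (u x) < e"
    unfolding eventually_at_right_field using \<delta>(1) x by (intro exI[of _ "min \<delta> (b - x)"]) auto
qed

lemma test_function_vanishes:
  assumes "test_function I \<phi>" "x \<notin> I"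
  shows "\<phi> x = 0"
  using assms closure_subset[of "{x. \<phi> x \<noteq> 0}"] by (auto simp: test_function_def)

lemma test_functionI:
  assumes "\<And>s. (\<phi> has_real_derivative \<psi> s) (at s)" "continuous_on UNIV \<psi>"
    and "\<And>s. s \<notin> {a..b} \<Longrightarrow> \<phi> s = 0" "{a..b} \<subseteq> I"
  shows "test_function I \<phi>"
proof -
  have sub: "{x. \<phi> x \<noteq> 0} \<subseteq> {a..b}" using assms(3) by blast
  then have "closure {x. \<phi> x \<noteq> 0} \<subseteq> {a..b}" by (rule closure_minimal) simp
  moreover have "compact (closure {x. \<phi> x \<noteq> 0})"
    using sub bounded_subset[OF bounded_closed_interval] by (simp add: compact_closure)
  moreover have "\<phi> C1_differentiable_on UNIV"
    unfolding C1_differentiable_on_def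
    using assms(1,2) by (auto simp: has_real_derivative_iff_has_vector_derivative)
  ultimately show ?thesis using assms(4) by (auto simp: test_function_def)
qed

lemma set_lebesgue_integral_restrict:
  fixes f :: "real \<Rightarrow> real"
  assumes "A \<subseteq> B" "\<And>x. x \<in> B \<Longrightarrow> x \<notin> A \<Longrightarrow> f x = 0"
  shows "(LINT x:B|M. f x) = (LINT x:A|M. f x)"
proof -
  have "indicator B x *\<^sub>R f x = indicator A x *\<^sub>R f x" for x
    using assms by (auto simp: indicator_def)
  then show ?thesis unfolding set_lebesgue_integral_def by presburger
qed

text \<open>Test with a plateau: a step up at \<open>x\<close> minus a step up at \<open>y\<close>. As the width of the steps tends to 0, the
plateau converges to the indicator of \<open>(x, y]\<close>, while its derivative acts on the continuous \<open>u\<close> as a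
difference of two approximate identities.\<close>

lemma weak_derivative_imp_increment_interior:
  assumes wd: "weak_derivative I u g" and sub: "{c<..<d} \<subseteq> I" and u: "continuous_on {c<..<d} u"
    and g: "g absolutely_integrable_on {c..d}" and xy: "c < x" "x < y" "y < d"
  shows "integral {x..y} g = u y - u x"
proof -
  define r0 where "r0 = (d - y) / 2"
  have r0: "r0 > 0" "y + r0 < d" using xy by (auto simp: r0_def field_simps)
  define r where "r = (\<lambda>n. r0 / real (Suc n))"
  have r: "0 < r n" "r n \<le> r0" for n using r0 by (auto simp: r_def field_simps)
  have rlim: "r \<longlonglongrightarrow> 0" unfolding r_def using LIMSEQ_Suc[OF lim_const_over_n[of r0]] by simp
  then have rright: "filterlim r (at_right 0) sequentially"
    using r by (auto simp: filterlim_at intro!: always_eventually) (metis less_irrefl)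
  define J where "J = {x..y + r0}"
  have J: "J \<subseteq> I" "J \<subseteq> {c<..<d}" using sub xy r0 by (auto simp: J_def)
  have uJ: "continuous_on J u" using u J(2) by (rule continuous_on_subset)
  have gJ: "g absolutely_integrable_on J"
    by (rule set_integrable_subset[OF g]) (use J in \<open>auto simp: J_def\<close>)
  define \<phi> where "\<phi> = (\<lambda>n s. ramp (r n) (s - x) - ramp (r n) (s - y))"
  define \<psi> where "\<psi> = (\<lambda>n s. hat (r n) (s - x) - hat (r n) (s - y))"
  have d: "(\<phi> n has_real_derivative \<psi> n s) (at s)" for n s
    unfolding \<phi>_def \<psi>_def by (intro DERIV_diff ramp_has_derivative)
  have cont: "continuous_on A (\<psi> n)" for A n
    unfolding \<psi>_def by (intro continuous_on_diff continuous_on_hat)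
  \<comment> \<open>The bound \<open>r n \<le> r0\<close> keeps the second step inside \<open>J\<close>, hence inside \<open>I\<close>.\<close>
  have supp: "\<phi> n s = 0" "\<psi> n s = 0" if "s \<notin> J" for n s
  proof -
    have "s \<le> x \<and> s \<le> y \<or> s \<ge> x + r n \<and> s \<ge> y + r n"
      using that r[of n] xy by (auto simp: J_def)
    then show "\<phi> n s = 0" "\<psi> n s = 0"
      using ramp_bounds[OF r(1)[of n]] by (auto simp: \<phi>_def \<psi>_def)
  qed
  have "test_function I (\<phi> n)" for n
    by (rule test_functionI[OF d cont, where a = x and b = "y + r0"]) (use supp J in \<open>auto simp: J_def\<close>)
  then have "(LINT s:I|lebesgue. u s * deriv (\<phi> n) s) = - (LINT s:I|lebesgue. g s * \<phi> n s)" for n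
    using wd unfolding weak_derivative_def by blast
  then have weak: "(LINT s:J|lebesgue. u s * \<psi> n s) = - (LINT s:J|lebesgue. g s * \<phi> n s)" for n
    using set_lebesgue_integral_restrict[OF J(1), of "\<lambda>s. u s * \<psi> n s" lebesgue]
      set_lebesgue_integral_restrict[OF J(1), of "\<lambda>s. g s * \<phi> n s" lebesgue] supp
    by (simp add: DERIV_imp_deriv[OF d])
  have "(LINT s:J|lebesgue. u s * \<psi> n s)
      = integral J (\<lambda>s. u s * hat (r n) (s - x)) - integral J (\<lambda>s. u s * hat (r n) (s - y))" for n
  proof -
    have "(LINT s:J|lebesgue. u s * \<psi> n s) = integral J (\<lambda>s. u s * \<psi> n s)"
      unfolding J_def by (intro set_lebesgue_integral_eq_integral(2) absolutely_integrable_continuous_real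
        continuous_on_mult cont) (use uJ in \<open>simp add: J_def\<close>)
    also have "\<dots> = integral J (\<lambda>s. u s * hat (r n) (s - x) - u s * hat (r n) (s - y))"
      by (simp add: \<psi>_def right_diff_distrib)
    also have "\<dots> = integral J (\<lambda>s. u s * hat (r n) (s - x)) - integral J (\<lambda>s. u s * hat (r n) (s - y))"
      unfolding J_def by (intro integral_diff integrable_continuous_real continuous_on_mult continuous_on_hat)
        (use uJ in \<open>simp_all add: J_def\<close>)
    finally show ?thesis .
  qed
  moreover have "(\<lambda>n. integral J (\<lambda>s. u s * hat (r n) (s - z))) \<longlonglongrightarrow> u z" if "z = x \<or> z = y" for z
    using uJ that xy r0 unfolding J_def
    by (intro filterlim_compose[OF hat_approximate_identity rright]) auto
  ultimately have "(\<lambda>n. LINT s:J|lebesgue. u s * \<psi> n s) \<longlonglongrightarrow> u x - u y"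
    by (simp add: tendsto_diff)
  moreover have "(\<lambda>n. LINT s:J|lebesgue. g s * \<phi> n s) \<longlonglongrightarrow> (LINT s:{x<..y}|lebesgue. g s)"
    unfolding set_lebesgue_integral_def
  proof (rule integral_dominated_convergence[where w = "\<lambda>s. norm (indicator J s *\<^sub>R g s)"])
    show "integrable lebesgue (\<lambda>s. norm (indicator J s *\<^sub>R g s))"
      using gJ unfolding set_integrable_def by (rule integrable_norm)
    have "continuous_on UNIV (\<phi> n)" for n
      by (rule DERIV_continuous_on[where D = "\<psi> n"]) (rule has_field_derivative_at_within[OF d])
    then have [measurable]: "\<phi> n \<in> borel_measurable lebesgue" for n
      by (intro measurable_completion) (simp add: borel_measurable_continuous_onI)
    have [measurable]: "(\<lambda>s. indicator J s *\<^sub>R g s) \<in> borel_measurable lebesgue"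
      using gJ unfolding set_integrable_def by simp
    have "(\<lambda>s. (indicator J s *\<^sub>R g s) * \<phi> n s) \<in> borel_measurable lebesgue" for n by measurable
    then show "(\<lambda>s. indicator J s *\<^sub>R (g s * \<phi> n s)) \<in> borel_measurable lebesgue" for n
      by (simp add: mult.assoc)
    have "set_integrable lebesgue {x<..y} g"
      by (rule set_integrable_subset[OF g]) (use xy in auto)
    then show "(\<lambda>s. indicator {x<..y} s *\<^sub>R g s) \<in> borel_measurable lebesgue"
      unfolding set_integrable_def by simp
    show "AE s in lebesgue. norm (indicator J s *\<^sub>R (g s * \<phi> n s)) \<le> norm (indicator J s *\<^sub>R g s)" for n
    proof (intro always_eventually allI)
      fix s
      have "\<bar>\<phi> n s\<bar> \<le> 1"
        using ramp_bounds(3,4)[OF r(1)[of n], of "s - x"] ramp_bounds(3,4)[OF r(1)[of n], of "s - y"]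
        by (auto simp: \<phi>_def)
      then have "\<bar>g s\<bar> * \<bar>\<phi> n s\<bar> \<le> \<bar>g s\<bar>" by (simp add: mult_left_le)
      then show "norm (indicator J s *\<^sub>R (g s * \<phi> n s)) \<le> norm (indicator J s *\<^sub>R g s)"
        by (auto simp: indicator_def abs_mult)
    qed
    show "AE s in lebesgue. (\<lambda>n. indicator J s *\<^sub>R (g s * \<phi> n s)) \<longlonglongrightarrow> indicator {x<..y} s *\<^sub>R g s"
    proof (intro always_eventually allI)
      fix s
      have *: "(\<lambda>n. ramp (r n) (s - z)) \<longlonglongrightarrow> (if s \<le> z then 0 else 1)" for z
      proof (cases "s \<le> z")
        case True
        then show ?thesis using ramp_bounds(1)[OF r(1)] by simp
      next
        case False
        then have "\<forall>\<^sub>F n in sequentially. r n < s - z" using rlim by (intro order_tendstoD(2)) auto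
        then have "\<forall>\<^sub>F n in sequentially. ramp (r n) (s - z) = 1"
          by eventually_elim (use ramp_bounds(2)[OF r(1)] in auto)
        then show ?thesis using False by (simp add: tendsto_eventually)
      qed
      have "(\<lambda>n. g s * \<phi> n s) \<longlonglongrightarrow> g s * ((if s \<le> x then 0 else 1) - (if s \<le> y then 0 else 1))"
        unfolding \<phi>_def by (intro tendsto_intros *)
      then have "(\<lambda>n. indicator J s *\<^sub>R (g s * \<phi> n s)) \<longlonglongrightarrow>
          indicator J s *\<^sub>R (g s * ((if s \<le> x then 0 else 1) - (if s \<le> y then 0 else 1)))"
        by (rule tendsto_scaleR[OF tendsto_const])
      moreover have "indicator J s *\<^sub>R (g s * ((if s \<le> x then 0 else 1) - (if s \<le> y then 0 else 1))) = indicator {x<..y} s *\<^sub>R g s"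
        using xy r0 by (auto simp: J_def indicator_def)
      ultimately show "(\<lambda>n. indicator J s *\<^sub>R (g s * \<phi> n s)) \<longlonglongrightarrow> indicator {x<..y} s *\<^sub>R g s"
        by (simp only:)
    qed
  qed
  ultimately have "u x - u y = - (LINT s:{x<..y}|lebesgue. g s)"
    unfolding weak by (intro LIMSEQ_unique) (auto intro: tendsto_minus)
  moreover have "(LINT s:{x<..y}|lebesgue. g s) = integral {x<..y} g"
    by (intro set_lebesgue_integral_eq_integral(2) set_integrable_subset[OF g]) (use xy in auto)
  moreover have "integral {x<..y} g = integral {x..y} g"
  proof (rule integral_spike_set)
    show "negligible {s \<in> {x<..y} - {x..y}. g s \<noteq> 0}" by (rule negligible_subset[of "{}"]) auto
    show "negligible {s \<in> {x..y} - {x<..y}. g s \<noteq> 0}" by (rule negligible_subset[of "{x}"]) auto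
  qed
  ultimately show ?thesis by simp
qed

text \<open>Continuity of \<open>u\<close> and of the indefinite integral of \<open>g\<close> extends the interior formula to the end
points, where no test function lives.\<close>

theorem weak_derivative_imp_increment:
  assumes wd: "weak_derivative I u g" and sub: "{c<..<d} \<subseteq> I" and u: "continuous_on {c..d} u"
    and g: "g absolutely_integrable_on {c..d}" and xy: "c \<le> x" "x \<le> y" "y \<le> d"
  shows "integral {x..y} g = u y - u x"
proof (cases "c < d")
  case False
  then have "y = x" using xy by simp
  then show ?thesis by simp
next
  case True
  have gi: "g integrable_on {c..d}" using g by (rule set_lebesgue_integral_eq_integral(1))
  define H where "H = (\<lambda>z. u z - integral {c..z} g)"
  have H: "continuous_on {c..d} H"
    unfolding H_def by (intro continuous_on_diff u indefinite_integral_continuous_1 gi)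
  have ui: "continuous_on {c<..<d} u" by (rule continuous_on_subset[OF u]) auto
  have comb: "integral {c..p} g + integral {p..q} g = integral {c..q} g" if "c \<le> p" "p \<le> q" "q \<le> d" for p q
    by (rule Henstock_Kurzweil_Integration.integral_combine[OF that(1,2)]) (rule integrable_on_subinterval[OF gi], use that in auto)
  define m where "m = (c + d) / 2"
  have "H z = H m" if z: "z \<in> {c<..<d}" for z
  proof -
    have *: "H q = H p" if "c < p" "p < q" "q < d" for p q
      using weak_derivative_imp_increment_interior[OF wd sub ui g that] comb[of p q] that
      by (auto simp: H_def)
    have "c < m" "m < d" using True by (auto simp: m_def)
    then show ?thesis using *[of z m] *[of m z] z by (cases z m rule: linorder_cases) auto
  qed
  then have "H z = H m" if "z \<in> {c..d}" for z
    by (rule continuous_constant_on_closure[of "{c<..<d}" H "H m" z, rotated]) (use H True that in auto)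
  then have "H x = H y" using xy by simp
  then show ?thesis using comb[OF xy] by (simp add: H_def)
qed

section \<open>Dirichlet energy of functions with prescribed boundary values\<close>

text \<open>On a bounded interval \<open>\<bar>g\<bar> \<le> 1 + g\<^sup>2\<close> is an integrable majorant.\<close>

lemma square_integrable_imp_absolutely_integrable:
  assumes g: "square_integrable_on I g" and sub: "{c<..<d} \<subseteq> I"
  shows "g absolutely_integrable_on {c..d}" "(\<lambda>x. (g x)\<^sup>2) absolutely_integrable_on {c..d}"
proof -
  have Ioo_Icc: "f absolutely_integrable_on {c..d}" if "f absolutely_integrable_on {c<..<d}" for f :: "real \<Rightarrow> real"
  proof -
    have "negligible {x \<in> {c<..<d} - {c..d}. f x \<noteq> 0}" by (rule negligible_subset[of "{}"]) auto
    moreover have "negligible {x \<in> {c..d} - {c<..<d}. f x \<noteq> 0}" by (rule negligible_subset[of "{c, d}"]) auto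
    ultimately show ?thesis using that absolutely_integrable_spike_set_eq by blast
  qed
  have sq: "(\<lambda>x. (g x)\<^sup>2) absolutely_integrable_on {c<..<d}"
    by (rule set_integrable_subset[OF _ _ sub]) (use g in \<open>auto simp: square_integrable_on_def\<close>)
  then show "(\<lambda>x. (g x)\<^sup>2) absolutely_integrable_on {c..d}" by (rule Ioo_Icc)
  have one: "(\<lambda>x. 1::real) absolutely_integrable_on {c<..<d}"
    by (rule set_integrable_subset[OF absolutely_integrable_continuous_real[of c d]]) auto
  have m: "(\<lambda>x. indicator {c<..<d} x *\<^sub>R g x) \<in> borel_measurable lebesgue"
  proof -
    have "(\<lambda>x. indicator I x *\<^sub>R g x) \<in> borel_measurable lebesgue"
      using g by (simp add: square_integrable_on_def set_borel_measurable_def)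
    then have "(\<lambda>x. indicator {c<..<d} x *\<^sub>R (indicator I x *\<^sub>R g x)) \<in> borel_measurable lebesgue"
      by (rule borel_measurable_scaleR[rotated]) (auto intro!: borel_measurable_indicator)
    moreover have "indicator {c<..<d} x *\<^sub>R (indicator I x *\<^sub>R g x) = indicator {c<..<d} x *\<^sub>R g x" for x
      using sub by (auto simp: indicator_def)
    ultimately show ?thesis by (simp only:)
  qed
  have "g absolutely_integrable_on {c<..<d}"
    unfolding set_integrable_def
  proof (rule Bochner_Integration.integrable_bound[OF _ m])
    show "integrable lebesgue (\<lambda>x. indicator {c<..<d} x *\<^sub>R (1::real) + indicator {c<..<d} x *\<^sub>R (g x)\<^sup>2)"
      using one sq unfolding set_integrable_def by (rule Bochner_Integration.integrable_add)
    have "\<bar>y\<bar> \<le> 1 + y\<^sup>2" for y :: real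
    proof -
      have "0 \<le> (\<bar>y\<bar> - 1)\<^sup>2" by simp
      then show ?thesis using abs_ge_zero[of y] by (simp add: power2_diff) 
    qed
    then show "AE x in lebesgue. norm (indicator {c<..<d} x *\<^sub>R g x)
        \<le> norm (indicator {c<..<d} x *\<^sub>R (1::real) + indicator {c<..<d} x *\<^sub>R (g x)\<^sup>2)"
      by (auto simp: indicator_def)
  qed
  then show "g absolutely_integrable_on {c..d}" by (rule Ioo_Icc)
qed

lemma square_integrable_on_continuous:
  assumes f: "\<And>x. x \<in> I \<Longrightarrow> f x = (if x < L then h x else 0)" and h: "continuous_on {0..L} h"
    and I: "{0<..<L} \<subseteq> I" "I \<subseteq> {0<..}"
  shows "square_integrable_on I f"
proof -
  have ind: "indicator I x *\<^sub>R F (f x) = indicator {0<..<L} x *\<^sub>R F (h x)" if "F 0 = 0" for F :: "real \<Rightarrow> real" and x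
    using f[of x] I that by (auto simp: indicator_def)
  have hi: "h absolutely_integrable_on {0<..<L}"
    by (rule set_integrable_subset[OF absolutely_integrable_continuous_real[OF h]]) auto
  have h2: "(\<lambda>x. (h x)\<^sup>2) absolutely_integrable_on {0<..<L}"
    by (rule set_integrable_subset[OF absolutely_integrable_continuous_real[OF continuous_on_power[OF h, of 2]]]) auto
  show ?thesis
    unfolding square_integrable_on_def set_borel_measurable_def set_integrable_def
    using hi h2 ind[of "\<lambda>y. y"] ind[of "\<lambda>y. y\<^sup>2"] unfolding set_integrable_def by simp
qed

text \<open>One computation serves the half line, where the profile vanishes beyond \<open>L\<close>, and the bounded
interval \<open>(0, L)\<close>: test functions vanish at 0 because 0 is outside \<open>I\<close>, and the profile itself vanishes at \<open>L\<close>.\<close>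

lemma affine_profile_weak_derivative:
  assumes L: "0 < L" and I: "{0<..<L} \<subseteq> I" "I \<subseteq> {0<..}"
    and v: "\<And>x. x \<in> I \<Longrightarrow> v x = (if x < L then a * (1 - x / L) else 0)"
  shows "weak_derivative I v (\<lambda>x. if x < L then - a / L else 0)"
  unfolding weak_derivative_def
proof (intro allI impI)
  fix \<phi> assume t: "test_function I \<phi>"
  then obtain \<psi> where \<psi>: "\<And>x. (\<phi> has_real_derivative \<psi> x) (at x)" "continuous_on UNIV \<psi>"
    unfolding test_function_def C1_differentiable_on_def
    by (auto simp: has_real_derivative_iff_has_vector_derivative)
  have \<phi>0: "\<phi> 0 = 0" using I by (intro test_function_vanishes[OF t]) auto
  have c\<phi>: "continuous_on A \<phi>" for A
    by (rule DERIV_continuous_on[where D = \<psi>]) (rule has_field_derivative_at_within[OF \<psi>(1)])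
  have c\<psi>: "continuous_on A \<psi>" for A using \<psi>(2) by (rule continuous_on_subset) simp
  have restrict: "(LINT x:I|lebesgue. F x) = integral {0..L} G"
    if FG: "\<And>x. x \<in> I \<Longrightarrow> F x = (if x < L then G x else 0)" and G: "continuous_on {0..L} G" for F G :: "real \<Rightarrow> real"
  proof -
    have Gi: "G absolutely_integrable_on {0..L}" by (rule absolutely_integrable_continuous_real[OF G])
    have "indicator I x *\<^sub>R F x = indicator {0<..<L} x *\<^sub>R G x" for x
      using FG[of x] I by (auto simp: indicator_def)
    then have "(LINT x:I|lebesgue. F x) = (LINT x:{0<..<L}|lebesgue. G x)"
      unfolding set_lebesgue_integral_def by presburger
    also have "\<dots> = integral {0<..<L} G"
      by (intro set_lebesgue_integral_eq_integral(2) set_integrable_subset[OF Gi]) auto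
    also have "\<dots> = integral {0..L} G" by (rule integral_open_interval_real[symmetric])
    finally show ?thesis .
  qed
  have "((\<lambda>x. a * (1 - x / L) * \<psi> x + (- a / L) * \<phi> x) has_integral
      a * (1 - L / L) * \<phi> L - a * (1 - 0 / L) * \<phi> 0) {0..L}"
  proof (rule fundamental_theorem_of_calculus)
    fix x assume "x \<in> {0..L}"
    have "((\<lambda>x. a * (1 - x / L)) has_real_derivative - a / L) (at x)"
      using L by (auto intro!: derivative_eq_intros simp: field_simps)
    from DERIV_mult[OF this \<psi>(1)]
    have "((\<lambda>x. a * (1 - x / L) * \<phi> x) has_real_derivative a * (1 - x / L) * \<psi> x + (- a / L) * \<phi> x) (at x)"
      by (simp add: algebra_simps)
    then show "((\<lambda>x. a * (1 - x / L) * \<phi> x) has_vector_derivative a * (1 - x / L) * \<psi> x + (- a / L) * \<phi> x) (at x within {0..L})"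
      by (simp add: has_real_derivative_iff_has_vector_derivative has_vector_derivative_at_within)
  qed (use L in simp)
  then have "integral {0..L} (\<lambda>x. a * (1 - x / L) * \<psi> x + (- a / L) * \<phi> x) = 0"
    using L \<phi>0 by (simp add: integral_unique)
  moreover have "integral {0..L} (\<lambda>x. a * (1 - x / L) * \<psi> x + (- a / L) * \<phi> x)
      = integral {0..L} (\<lambda>x. a * (1 - x / L) * \<psi> x) + integral {0..L} (\<lambda>x. (- a / L) * \<phi> x)"
    using L by (intro integral_add integrable_continuous_real continuous_intros c\<phi> c\<psi>) auto
  moreover have "(LINT x:I|lebesgue. v x * deriv \<phi> x) = integral {0..L} (\<lambda>x. a * (1 - x / L) * \<psi> x)"
    by (rule restrict) (use L in \<open>auto simp: v DERIV_imp_deriv[OF \<psi>(1)] intro!: continuous_intros c\<psi>\<close>)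
  moreover have "(LINT x:I|lebesgue. (if x < L then - a / L else 0) * \<phi> x) = integral {0..L} (\<lambda>x. (- a / L) * \<phi> x)"
    by (rule restrict) (use L in \<open>auto intro!: continuous_intros c\<phi>\<close>)
  ultimately show "(LINT x:I|lebesgue. v x * deriv \<phi> x) = - (LINT x:I|lebesgue. (if x < L then - a / L else 0) * \<phi> x)"
    by linarith
qed

lemma affine_profile_in_H1:
  assumes L: "0 < L" and I: "{0<..<L} \<subseteq> I" "I \<subseteq> {0<..}" and cont: "continuous_on (closure I) v"
    and v: "\<And>x. x \<in> I \<Longrightarrow> v x = (if x < L then a * (1 - x / L) else 0)"
  shows "v \<in> H1 I"
  unfolding H1_def
proof (intro CollectI conjI exI)
  show "square_integrable_on I v"
    by (rule square_integrable_on_continuous[OF v _ I]) (use L in \<open>auto intro!: continuous_intros\<close>)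
  show "square_integrable_on I (\<lambda>x. if x < L then - a / L else 0)"
    by (rule square_integrable_on_continuous[OF refl _ I]) auto
  show "weak_derivative I v (\<lambda>x. if x < L then - a / L else 0)"
    by (rule affine_profile_weak_derivative[OF L I v])
qed (rule cont)

text \<open>This identifies a weak derivative, which is known only through its integrals, with the slope of an
affine function.\<close>

lemma affine_increment_imp_constant_AE:
  fixes g :: "real \<Rightarrow> real"
  assumes g: "g absolutely_integrable_on {c..d}"
    and F: "\<And>x y. c \<le> x \<Longrightarrow> x \<le> y \<Longrightarrow> y \<le> d \<Longrightarrow> integral {x..y} g = \<beta> * y - \<beta> * x"
  shows "AE x in lebesgue. x \<in> {c..d} \<longrightarrow> g x = \<beta>"
proof -
  define f where "f = (\<lambda>x. if x \<in> {c..d} then g x else 0)"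
  have "f integrable_on UNIV"
    using set_lebesgue_integral_eq_integral(1)[OF g] unfolding f_def by (simp only: integrable_restrict_UNIV)
  then have fi: "f integrable_on cbox a b" for a b by (rule integrable_on_subcbox) simp
  have "integral {x..y} f = \<beta> * y - \<beta> * x" if "c \<le> x" "x \<le> y" "y \<le> d" for x y
  proof -
    have "integral {x..y} f = integral {x..y} g"
      by (rule Henstock_Kurzweil_Integration.integral_cong) (use that in \<open>auto simp: f_def\<close>)
    then show ?thesis using F[OF that] by simp
  qed
  then have "AE x in lebesgue. c < x \<and> x < d \<longrightarrow> ((\<lambda>x. \<beta> * x) has_real_derivative f x) (at x)"
    by (rule indefinite_integral_has_derivative_AE[OF fi])
  moreover have "AE x in lebesgue. x \<notin> {c, d}"
    by (rule AE_not_in) (simp flip: negligible_iff_null_sets)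
  ultimately show ?thesis
  proof eventually_elim
    case (elim x)
    show ?case
    proof
      assume x: "x \<in> {c..d}"
      then have "((\<lambda>x. \<beta> * x) has_real_derivative f x) (at x)" using elim by auto
      moreover have "((\<lambda>x. \<beta> * x) has_real_derivative \<beta>) (at x)" by (auto intro!: derivative_eq_intros)
      ultimately have "f x = \<beta>" by (rule DERIV_unique)
      then show "g x = \<beta>" using x by (simp add: f_def)
    qed
  qed
qed

text \<open>With \<open>\<beta> = - a / l\<close> and \<open>g\<close> the weak derivative, expanding the square and using
\<open>\<integral> g = u l - u 0 = - a\<close> gives \<open>\<integral> (g - \<beta>)\<^sup>2 = D - a\<^sup>2 / l\<close>. So the affine function is the unique minimizer.\<close>

theorem H1_dirichlet_energy:
  assumes u: "u \<in> H1 I" and I: "{0<..<l} \<subseteq> I" and l: "0 < l" and bc: "u 0 = a" "u l = 0"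
  defines "D \<equiv> LINT x:{0..l}|lebesgue. (wderiv I u x)\<^sup>2"
  shows "a\<^sup>2 / l \<le> D" and "D = a\<^sup>2 / l \<longleftrightarrow> (\<forall>x\<in>{0..l}. u x = a * (1 - x / l))"
proof -
  define g where "g = wderiv I u"
  define \<beta> where "\<beta> = - a / l"
  have "\<exists>g. square_integrable_on I g \<and> weak_derivative I u g" using u by (simp add: H1_def)
  then have "square_integrable_on I g \<and> weak_derivative I u g"
    unfolding g_def wderiv_def by (rule someI_ex)
  then have g: "square_integrable_on I g" "weak_derivative I u g" by auto
  have gi: "g absolutely_integrable_on {0..l}" and g2: "(\<lambda>x. (g x)\<^sup>2) absolutely_integrable_on {0..l}"
    by (rule square_integrable_imp_absolutely_integrable[OF g(1) I])+
  have "{0..l} = closure {0<..<l}" using l by simp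
  also have "\<dots> \<subseteq> closure I" by (rule closure_mono[OF I])
  finally have uc: "continuous_on {0..l} u" using u by (auto simp: H1_def intro: continuous_on_subset)
  have incr: "integral {x..y} g = u y - u x" if "0 \<le> x" "x \<le> y" "y \<le> l" for x y
    by (rule weak_derivative_imp_increment[OF g(2) I uc gi that])
  have gI: "g integrable_on {0..l}" "(\<lambda>x. (g x)\<^sup>2) integrable_on {0..l}"
    using gi g2 by (auto dest: set_lebesgue_integral_eq_integral(1))
  have D: "D = integral {0..l} (\<lambda>x. (g x)\<^sup>2)"
    unfolding D_def g_def[symmetric] by (rule set_lebesgue_integral_eq_integral(2)[OF g2])
  have q: "((\<lambda>x. (g x - \<beta>)\<^sup>2) has_integral D - a\<^sup>2 / l) {0..l}"
  proof -
    have "((\<lambda>x. (g x)\<^sup>2 - 2 * \<beta> * g x + \<beta>\<^sup>2) has_integral (D - 2 * \<beta> * (u l - u 0) + \<beta>\<^sup>2 * l)) {0..l}"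
    proof (intro has_integral_add has_integral_diff has_integral_mult_right)
      show "((\<lambda>x. (g x)\<^sup>2) has_integral D) {0..l}" using gI(2) D by (simp add: integrable_integral)
      show "(g has_integral u l - u 0) {0..l}" using incr[of 0 l] l gI(1) by (simp add: has_integral_iff)
      show "((\<lambda>x. \<beta>\<^sup>2) has_integral \<beta>\<^sup>2 * l) {0..l}" using has_integral_const_real[of "\<beta>\<^sup>2" 0 l] l by (simp add: mult.commute)
    qed
    moreover have "D - 2 * \<beta> * (u l - u 0) + \<beta>\<^sup>2 * l = D - a\<^sup>2 / l"
      using l by (simp add: bc \<beta>_def power2_eq_square field_simps)
    moreover have "(g x)\<^sup>2 - 2 * \<beta> * g x + \<beta>\<^sup>2 = (g x - \<beta>)\<^sup>2" for x by (simp add: power2_diff)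
    ultimately show ?thesis by simp
  qed
  have "0 \<le> D - a\<^sup>2 / l" by (rule has_integral_nonneg[OF q]) simp
  then show "a\<^sup>2 / l \<le> D" by simp
  have const: "(\<forall>x\<in>{0..l}. u x = a * (1 - x / l))" if "D = a\<^sup>2 / l"
  proof -
    have "((\<lambda>x. (g x - \<beta>)\<^sup>2) has_integral 0) {0..l}" using q that by simp
    then have qi: "(\<lambda>x. (g x - \<beta>)\<^sup>2) absolutely_integrable_on {0..l}" and "integral {0..l} (\<lambda>x. (g x - \<beta>)\<^sup>2) = 0"
      by (auto intro: nonnegative_absolutely_integrable_1 simp: has_integral_iff)
    then have "(LINT x:{0..l}|lebesgue. (g x - \<beta>)\<^sup>2) = 0"
      using set_lebesgue_integral_eq_integral(2)[OF qi] by simp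
    then have "AE x in lebesgue. indicator {0..l} x *\<^sub>R (g x - \<beta>)\<^sup>2 = 0"
      using qi unfolding set_lebesgue_integral_def set_integrable_def
      by (subst (asm) integral_nonneg_eq_0_iff_AE) auto
    then have neg: "negligible {x. \<not> indicator {0..l} x *\<^sub>R (g x - \<beta>)\<^sup>2 = 0}"
      unfolding negligible_iff_null_sets completion.AE_iff_null_sets by simp
    show ?thesis
    proof
      fix x assume x: "x \<in> {0..l}"
      have "u x - u 0 = integral {0..x} g" using incr[of 0 x] x by simp
      also have "\<dots> = integral {0..x} (\<lambda>_. \<beta>)"
        by (rule integral_spike[OF neg]) (use x in auto)
      finally show "u x = a * (1 - x / l)" using x l by (simp add: bc \<beta>_def field_simps)
    qed
  qed
  have "D = a\<^sup>2 / l" if "\<forall>x\<in>{0..l}. u x = a * (1 - x / l)"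
  proof -
    have "integral {x..y} g = \<beta> * y - \<beta> * x" if "0 \<le> x" "x \<le> y" "y \<le> l" for x y
    proof -
      have "u y = a * (1 - y / l)" "u x = a * (1 - x / l)"
        using that \<open>\<forall>x\<in>{0..l}. u x = a * (1 - x / l)\<close> by auto
      then show ?thesis unfolding incr[OF that] \<beta>_def by (simp add: algebra_simps)
    qed
    then have "AE x in lebesgue. x \<in> {0..l} \<longrightarrow> g x = \<beta>" by (rule affine_increment_imp_constant_AE[OF gi])
    then have neg: "negligible {x. \<not> (x \<in> {0..l} \<longrightarrow> g x = \<beta>)}"
      unfolding negligible_iff_null_sets completion.AE_iff_null_sets by simp
    have "D - a\<^sup>2 / l = integral {0..l} (\<lambda>x. (g x - \<beta>)\<^sup>2)" using q by (simp add: integral_unique)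
    also have "\<dots> = integral {0..l} (\<lambda>x. 0)" by (rule integral_spike[OF neg]) auto
    finally show ?thesis by simp
  qed
  with const show "D = a\<^sup>2 / l \<longleftrightarrow> (\<forall>x\<in>{0..l}. u x = a * (1 - x / l))" by blast
qed

section \<open>Absolute continuity from an increasing image\<close>

text \<open>In effect the inverse of \<open>\<phi>\<close> is absolutely continuous: where \<open>\<phi>\<close> has a positive derivative it
expands distances locally by some fixed factor \<open>\<eta>\<close>. The closed sets \<open>G n\<close> of points with expansion factor and
radius \<open>\<eta> n\<close> increase to a set of full measure, so one of them misses measure less than \<open>\<epsilon> / 2\<close>. Within it,
an interval whose image is short has a trace of diameter at most the length of the image divided by \<open>\<eta> n\<close>.\<close>

lemma family_length_small_if_image_small:
  fixes \<phi> :: "real \<Rightarrow> real"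
  assumes cont: "continuous_on {a..b} \<phi>" and mono: "mono_on {a..b} \<phi>" and "a \<le> b"
    and pos: "AE x in lebesgue. a < x \<and> x < b \<longrightarrow> (\<exists>D>0. (\<phi> has_real_derivative D) (at x))"
    and "\<epsilon> > 0"
  obtains \<delta> where "\<delta> > 0"
    "\<And>(K :: 'i set) p q. interval_family a b K p q \<Longrightarrow> (\<Sum>i\<in>K. \<phi> (q i) - \<phi> (p i)) < \<delta> \<Longrightarrow>
        (\<Sum>i\<in>K. q i - p i) < \<epsilon>"
proof -
  define \<eta> where "\<eta> = (\<lambda>n. 1 / real (Suc n))"
  have \<eta>: "\<eta> n > 0" "m \<le> n \<Longrightarrow> \<eta> n \<le> \<eta> m" for m n by (auto simp: \<eta>_def frac_le)
  define G where "G = (\<lambda>n. {x\<in>{a..b}. \<forall>y\<in>{a..b}. \<bar>y - x\<bar> < \<eta> n \<longrightarrow> \<eta> n * \<bar>y - x\<bar> \<le> \<bar>\<phi> y - \<phi> x\<bar>})"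
  have Gsub: "G n \<subseteq> {a..b}" for n by (auto simp: G_def)
  have "closed (G n)" for n
    unfolding closed_sequential_limits
  proof (intro allI impI, elim conjE)
    fix s x assume s: "\<forall>k. s k \<in> G n" and lim: "s \<longlonglongrightarrow> x"
    have x: "x \<in> {a..b}"
      using closed_sequentially[of "{a..b}" s x] s lim Gsub by blast
    have \<phi>lim: "(\<lambda>k. \<phi> (s k)) \<longlonglongrightarrow> \<phi> x"
      using continuous_on_tendsto_compose[OF cont lim x] s Gsub by (metis (no_types, lifting) always_eventually subsetD)
    have "\<eta> n * \<bar>y - x\<bar> \<le> \<bar>\<phi> y - \<phi> x\<bar>" if y: "y \<in> {a..b}" "\<bar>y - x\<bar> < \<eta> n" for y
    proof (rule tendsto_le[of sequentially])
      show "(\<lambda>k. \<bar>\<phi> y - \<phi> (s k)\<bar>) \<longlonglongrightarrow> \<bar>\<phi> y - \<phi> x\<bar>" by (intro tendsto_intros \<phi>lim)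
      show "(\<lambda>k. \<eta> n * \<bar>y - s k\<bar>) \<longlonglongrightarrow> \<eta> n * \<bar>y - x\<bar>" by (intro tendsto_intros lim)
      have "(\<lambda>k. \<bar>y - s k\<bar>) \<longlonglongrightarrow> \<bar>y - x\<bar>" by (intro tendsto_intros lim)
      then have "\<forall>\<^sub>F k in sequentially. \<bar>y - s k\<bar> < \<eta> n" using y(2) by (rule order_tendstoD(2))
      then show "\<forall>\<^sub>F k in sequentially. \<eta> n * \<bar>y - s k\<bar> \<le> \<bar>\<phi> y - \<phi> (s k)\<bar>"
        by eventually_elim (use s y(1) in \<open>auto simp: G_def\<close>)
    qed simp
    then show "x \<in> G n" using x by (simp add: G_def)
  qed
  then have Gc: "compact (G n)" for n
    using bounded_subset[OF bounded_closed_interval Gsub] by (simp add: compact_eq_bounded_closed)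
  then have Gm: "G n \<in> lmeasurable" for n by (rule lmeasurable_compact)
  have "incseq G"
  proof (rule incseq_SucI, rule subsetI)
    fix n x assume x: "x \<in> G n"
    have e: "\<eta> (Suc n) \<le> \<eta> n" by (rule \<eta>(2)) simp
    have "\<eta> (Suc n) * \<bar>y - x\<bar> \<le> \<bar>\<phi> y - \<phi> x\<bar>" if "y \<in> {a..b}" "\<bar>y - x\<bar> < \<eta> (Suc n)" for y
    proof -
      have "\<eta> (Suc n) * \<bar>y - x\<bar> \<le> \<eta> n * \<bar>y - x\<bar>" using e by (rule mult_right_mono) simp
      also have "\<dots> \<le> \<bar>\<phi> y - \<phi> x\<bar>" using x that e by (simp add: G_def)
      finally show ?thesis .
    qed
    then show "x \<in> G (Suc n)" using x by (simp add: G_def)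
  qed
  have differentiable_in_G: "x \<in> (\<Union>n. G n)"
    if x: "x \<in> {a..b}" and D: "D > 0" "(\<phi> has_real_derivative D) (at x)" for x D
  proof -
    have "(\<lambda>h. (\<phi> (x + h) - \<phi> x) / h) \<midarrow>0\<rightarrow> D" using D(2) by (simp add: DERIV_def)
    then have "\<forall>\<^sub>F h in at 0. (\<phi> (x + h) - \<phi> x) / h > D / 2" using D(1) by (intro order_tendstoD(1)) auto
    then obtain r where r: "r > 0" "\<And>h. h \<noteq> 0 \<Longrightarrow> \<bar>h\<bar> < r \<Longrightarrow> (\<phi> (x + h) - \<phi> x) / h > D / 2"
      unfolding eventually_at by (auto simp: dist_real_def)
    obtain n where n: "\<eta> n < min r (D / 2)"
      using reals_Archimedean[of "min r (D / 2)"] r D by (auto simp: \<eta>_def inverse_eq_divide)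
    have "\<eta> n * \<bar>y - x\<bar> \<le> \<bar>\<phi> y - \<phi> x\<bar>" if "\<bar>y - x\<bar> < \<eta> n" for y
    proof (cases "y = x")
      case False
      have "D / 2 < (\<phi> y - \<phi> x) / (y - x)" using r(2)[of "y - x"] that n False by simp
      also have "\<dots> \<le> \<bar>(\<phi> y - \<phi> x) / (y - x)\<bar>" by (rule abs_ge_self)
      finally have "D / 2 < \<bar>(\<phi> y - \<phi> x) / (y - x)\<bar>" .
      moreover have "\<eta> n < D / 2" using n by simp
      ultimately have "\<eta> n < \<bar>(\<phi> y - \<phi> x) / (y - x)\<bar>" by (rule order_less_trans[rotated])
      then show ?thesis using False by (simp add: abs_divide pos_less_divide_eq)
    qed simp
    then show ?thesis using x by (auto simp: G_def)
  qed
  have UG: "measure lebesgue (\<Union>n. G n) = b - a"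
  proof -
    have "AE x in lebesgue. x \<notin> {a, b}"
      by (rule AE_not_in) (simp flip: negligible_iff_null_sets)
    with pos have "AE x in lebesgue. x \<in> (\<Union>n. G n) \<longleftrightarrow> x \<in> {a..b}"
    proof eventually_elim
      case (elim x)
      show ?case
      proof
        show "x \<in> (\<Union>n. G n) \<Longrightarrow> x \<in> {a..b}" using Gsub by blast
        assume "x \<in> {a..b}"
        then show "x \<in> (\<Union>n. G n)" using elim differentiable_in_G[of x] by fastforce
      qed
    qed
    then have "measure lebesgue (\<Union>n. G n) = measure lebesgue {a..b}"
      by (rule measure_eq_AE) (use Gm in \<open>auto simp: fmeasurableD\<close>)
    then show ?thesis using \<open>a \<le> b\<close> by simp
  qed
  have "(\<lambda>n. measure lebesgue (G n)) \<longlonglongrightarrow> measure lebesgue (\<Union>n. G n)"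
  proof (rule Lim_measure_incseq[OF _ \<open>incseq G\<close>])
    have "emeasure lebesgue (\<Union>n. G n) \<le> emeasure lebesgue {a..b}"
      by (rule emeasure_mono) (use Gsub in auto)
    then show "emeasure lebesgue (\<Union>n. G n) \<noteq> \<infinity>" using \<open>a \<le> b\<close> by (auto simp: top_unique)
  qed (use Gm in \<open>auto simp: fmeasurableD\<close>)
  then have "\<forall>\<^sub>F n in sequentially. measure lebesgue (G n) > b - a - \<epsilon> / 2"
    unfolding UG using \<open>\<epsilon> > 0\<close> by (intro order_tendstoD(1)) auto
  then obtain n where n: "measure lebesgue (G n) > b - a - \<epsilon> / 2"
    using eventually_sequentially by auto
  define e where "e = \<eta> n"
  have e: "e > 0" using \<eta> by (simp add: e_def)
  \<comment> \<open>The first bound keeps traces shorter than the radius \<open>e\<close>, the second bounds their total length by \<open>\<epsilon> / 2\<close>.\<close>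
  define \<delta> where "\<delta> = min (e * (e / 2)) (e * (\<epsilon> / 2))"
  have "\<delta> > 0" using e \<open>\<epsilon> > 0\<close> by (simp add: \<delta>_def)
  moreover have "(\<Sum>i\<in>K. q i - p i) < \<epsilon>"
    if fam: "interval_family a b K p q" and small: "(\<Sum>i\<in>K. \<phi> (q i) - \<phi> (p i)) < \<delta>" for K :: "'i set" and p q
  proof -
    have fin: "finite K" and pq: "\<And>i. i \<in> K \<Longrightarrow> a \<le> p i \<and> p i \<le> q i \<and> q i \<le> b"
      and dis: "disjoint_family_on (\<lambda>i. {p i<..<q i}) K"
      using fam by (auto simp: interval_family_def disjoint_family_on_def)
    have incr: "\<phi> x \<le> \<phi> y" if "a \<le> x" "x \<le> y" "y \<le> b" for x y
      by (rule mono_onD[OF mono]) (use that in auto)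
    have inG: "measure lebesgue (G n \<inter> {p i..q i}) \<le> (\<phi> (q i) - \<phi> (p i)) / e" if i: "i \<in> K" for i
    proof (cases "G n \<inter> {p i..q i} = {}")
      case True
      then show ?thesis using incr pq[OF i] e by simp
    next
      case False
      have c: "compact (G n \<inter> {p i..q i})" by (intro compact_Int Gc compact_Icc)
      \<comment> \<open>The trace of \<open>G n\<close> on the interval is compact, so its diameter is realized by two of its points.\<close>
      obtain l where l: "l \<in> G n \<inter> {p i..q i}" "\<forall>x\<in>G n \<inter> {p i..q i}. l \<le> x"
        using compact_attains_inf[OF c False] by blast
      obtain u where u: "u \<in> G n \<inter> {p i..q i}" "\<forall>x\<in>G n \<inter> {p i..q i}. x \<le> u"
        using compact_attains_sup[OF c False] by blast
      have "l \<le> u" using l u by blast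
      have expand: "e * (y - l) \<le> \<phi> (q i) - \<phi> (p i)" if y: "l \<le> y" "y \<le> u" "y - l < e" for y
      proof -
        have ly: "l \<in> G n" "y \<in> {a..b}" using l u y pq[OF i] by auto
        then have "\<bar>y - l\<bar> < \<eta> n \<longrightarrow> \<eta> n * \<bar>y - l\<bar> \<le> \<bar>\<phi> y - \<phi> l\<bar>" by (simp add: G_def)
        then have "e * (y - l) \<le> \<bar>\<phi> y - \<phi> l\<bar>" using y by (simp add: e_def)
        moreover have "\<phi> (p i) \<le> \<phi> l" "\<phi> l \<le> \<phi> y" "\<phi> y \<le> \<phi> (q i)"
          using l u y pq[OF i] by (auto intro!: incr)
        ultimately show ?thesis by linarith
      qed
      have "e * (u - l) \<le> \<phi> (q i) - \<phi> (p i)"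
      proof (cases "u - l < e")
        case True
        then show ?thesis using expand \<open>l \<le> u\<close> by simp
      next
        \<comment> \<open>A longer trace would expand a segment of length \<open>e / 2\<close> to an image of length at least \<open>\<delta>\<close>.\<close>
        case False
        then have "e * (e / 2) \<le> \<phi> (q i) - \<phi> (p i)" using expand[of "l + e / 2"] e by simp
        also have "\<dots> \<le> (\<Sum>i\<in>K. \<phi> (q i) - \<phi> (p i))"
          by (rule member_le_sum[OF i _ fin, of "\<lambda>i. \<phi> (q i) - \<phi> (p i)"]) (use incr pq in auto)
        finally show ?thesis using small by (simp add: \<delta>_def)
      qed
      then have "u - l \<le> (\<phi> (q i) - \<phi> (p i)) / e" using e by (simp add: pos_le_divide_eq mult.commute)
      moreover have "measure lebesgue (G n \<inter> {p i..q i}) \<le> measure lebesgue {l..u}"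
        by (rule measure_mono_fmeasurable) (use l u Gm in \<open>auto simp: fmeasurableD\<close>)
      ultimately show ?thesis using \<open>l \<le> u\<close> by simp
    qed
    have out: "(\<Sum>i\<in>K. measure lebesgue ({p i<..<q i} - G n)) < \<epsilon> / 2"
    proof -
      have "(\<Sum>i\<in>K. measure lebesgue ({p i<..<q i} - G n)) = measure lebesgue (\<Union>i\<in>K. {p i<..<q i} - G n)"
      proof (rule measure_finite_Union[OF fin, symmetric])
        show "disjoint_family_on (\<lambda>i. {p i<..<q i} - G n) K"
          using dis unfolding disjoint_family_on_def by blast
        fix i assume "i \<in> K"
        have "emeasure lebesgue ({p i<..<q i} - G n) \<le> emeasure lebesgue {p i..q i}"
          by (rule emeasure_mono) auto
        then show "emeasure lebesgue ({p i<..<q i} - G n) \<noteq> \<infinity>" using pq[OF \<open>i \<in> K\<close>] by (auto simp: top_unique)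
      qed (use Gm in \<open>auto simp: fmeasurableD\<close>)
      also have "\<dots> \<le> measure lebesgue ({a..b} - G n)"
      proof (rule measure_mono_fmeasurable)
        show "(\<Union>i\<in>K. {p i<..<q i} - G n) \<subseteq> {a..b} - G n" using pq by fastforce
        show "(\<Union>i\<in>K. {p i<..<q i} - G n) \<in> sets lebesgue"
          using Gm fin by (intro sets.finite_UN) (auto simp: fmeasurableD)
        show "{a..b} - G n \<in> lmeasurable" using Gm by (intro fmeasurable_Diff) (auto simp: fmeasurableD)
      qed
      also have "\<dots> = measure lebesgue {a..b} - measure lebesgue (G n)"
        using Gm Gsub by (intro measurable_measure_Diff) (auto simp: fmeasurableD)
      finally show ?thesis using n \<open>a \<le> b\<close> by simp
    qed
    have "(\<Sum>i\<in>K. q i - p i) \<le> (\<Sum>i\<in>K. measure lebesgue (G n \<inter> {p i..q i}) + measure lebesgue ({p i<..<q i} - G n))"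
    proof (rule sum_mono)
      fix i assume i: "i \<in> K"
      have "q i - p i = measure lebesgue {p i<..<q i}" using pq[OF i] by simp
      also have "\<dots> \<le> measure lebesgue ((G n \<inter> {p i..q i}) \<union> ({p i<..<q i} - G n))"
        by (rule measure_mono_fmeasurable) (use Gm in \<open>auto intro!: fmeasurable.Un fmeasurable_Diff fmeasurable_Int_fmeasurable simp: fmeasurableD\<close>)
      also have "\<dots> \<le> measure lebesgue (G n \<inter> {p i..q i}) + measure lebesgue ({p i<..<q i} - G n)"
        by (rule measure_Un_le) (use Gm in \<open>auto simp: fmeasurableD\<close>)
      finally show "q i - p i \<le> measure lebesgue (G n \<inter> {p i..q i}) + measure lebesgue ({p i<..<q i} - G n)" .
    qed
    also have "\<dots> \<le> (\<Sum>i\<in>K. \<phi> (q i) - \<phi> (p i)) / e + (\<Sum>i\<in>K. measure lebesgue ({p i<..<q i} - G n))"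
      unfolding sum.distrib sum_divide_distrib by (intro add_mono sum_mono inG order_refl)
    also have "(\<Sum>i\<in>K. \<phi> (q i) - \<phi> (p i)) / e \<le> \<epsilon> / 2"
      using small e by (simp add: \<delta>_def pos_divide_le_eq mult.commute)
    finally show ?thesis using out by simp
  qed
  ultimately show thesis by (rule that)
qed

text \<open>An increasing \<open>\<mu>\<close> maps families of intervals to families of intervals, so \<open>\<mu>\<close> is the composition
of the absolutely continuous \<open>\<phi> \<circ> \<mu>\<close> with the absolutely continuous inverse of \<open>\<phi>\<close>.\<close>

theorem abs_continuous_on_of_increasing_image:
  fixes \<phi> \<mu> :: "real \<Rightarrow> real"
  assumes cont: "continuous_on {a..b} \<phi>" and mono: "mono_on {a..b} \<phi>"
    and pos: "AE x in lebesgue. a < x \<and> x < b \<longrightarrow> (\<exists>D>0. (\<phi> has_real_derivative D) (at x))"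
    and \<mu>: "mono_on {c..d} \<mu>" "\<mu> ` {c..d} \<subseteq> {a..b}" and ac: "abs_continuous_on {c..d} (\<lambda>t. \<phi> (\<mu> t))" and "c \<le> d"
  shows "abs_continuous_on {c..d} \<mu>"
proof (rule abs_continuous_on_intervalI)
  have "\<mu> c \<in> {a..b}" using \<mu>(2) \<open>c \<le> d\<close> by fastforce
  then have ab: "a \<le> b" by simp
  fix \<epsilon> :: real assume \<epsilon>: "\<epsilon> > 0"
  obtain \<delta>' where \<delta>': "\<delta>' > 0" "\<And>(K :: nat set) p q. interval_family a b K p q \<Longrightarrow>
      (\<Sum>i\<in>K. \<phi> (q i) - \<phi> (p i)) < \<delta>' \<Longrightarrow> (\<Sum>i\<in>K. q i - p i) < \<epsilon>"
    by (rule family_length_small_if_image_small[OF cont mono ab pos \<epsilon>]) (rule that)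
  obtain \<delta> where \<delta>: "\<delta> > 0" "\<And>(K :: nat set) s t. interval_family c d K s t \<Longrightarrow>
      (\<Sum>i\<in>K. t i - s i) < \<delta> \<Longrightarrow> (\<Sum>i\<in>K. \<bar>\<phi> (\<mu> (t i)) - \<phi> (\<mu> (s i))\<bar>) < \<delta>'"
    by (rule abs_continuous_on_interval_family[OF ac \<delta>'(1)]) (rule that)
  have "(\<Sum>i<n. \<bar>\<mu> (t i) - \<mu> (s i)\<bar>) < \<epsilon>"
    if fam: "interval_family c d {..<n::nat} s t" and len: "(\<Sum>i<n. t i - s i) < \<delta>" for n s t
  proof -
    have st: "c \<le> s i" "s i \<le> t i" "t i \<le> d" if "i < n" for i
      using fam that by (auto simp: interval_family_def)
    have m: "\<mu> x \<le> \<mu> y" if "c \<le> x" "x \<le> y" "y \<le> d" for x y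
      by (rule mono_onD[OF \<mu>(1)]) (use that in auto)
    have im: "a \<le> \<mu> x \<and> \<mu> x \<le> b" if "c \<le> x" "x \<le> d" for x
      using \<mu>(2)[THEN subsetD, OF imageI, of x] that by simp
    have fam': "interval_family a b {..<n} (\<lambda>i. \<mu> (s i)) (\<lambda>i. \<mu> (t i))"
      unfolding interval_family_def
    proof (intro conjI ballI impI)
      fix i j assume ij: "i \<in> {..<n}" "j \<in> {..<n}" "i \<noteq> j"
      have "{s i<..<t i} \<inter> {s j<..<t j} = {}" using fam ij unfolding interval_family_def by blast
      then consider "s i = t i" | "s j = t j" | "t i \<le> s j" | "t j \<le> s i"
        using st[of i] st[of j] ij by (auto simp: min_le_iff_disj le_max_iff_disj)
      then show "{\<mu> (s i)<..<\<mu> (t i)} \<inter> {\<mu> (s j)<..<\<mu> (t j)} = {}"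
      proof cases
        case 3
        then have "\<mu> (t i) \<le> \<mu> (s j)" using st[of i] st[of j] ij by (intro m) auto
        then show ?thesis by (simp add: min_le_iff_disj le_max_iff_disj)
      next
        case 4
        then have "\<mu> (t j) \<le> \<mu> (s i)" using st[of i] st[of j] ij by (intro m) auto
        then show ?thesis by (simp add: min_le_iff_disj le_max_iff_disj)
      qed simp_all
    next
      fix i assume "i \<in> {..<n}"
      then have "c \<le> s i" "s i \<le> t i" "t i \<le> d" using st by auto
      then show "a \<le> \<mu> (s i)" "\<mu> (s i) \<le> \<mu> (t i)" "\<mu> (t i) \<le> b"
        using im[of "s i"] im[of "t i"] m by auto
    qed simp
    have "(\<Sum>i<n. \<phi> (\<mu> (t i)) - \<phi> (\<mu> (s i))) \<le> (\<Sum>i<n. \<bar>\<phi> (\<mu> (t i)) - \<phi> (\<mu> (s i))\<bar>)"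
      by (rule sum_mono) simp
    also have "\<dots> < \<delta>'" by (rule \<delta>(2)[OF fam len])
    finally have "(\<Sum>i<n. \<mu> (t i) - \<mu> (s i)) < \<epsilon>" by (rule \<delta>'(2)[OF fam'])
    moreover have "(\<Sum>i<n. \<bar>\<mu> (t i) - \<mu> (s i)\<bar>) = (\<Sum>i<n. \<mu> (t i) - \<mu> (s i))"
      by (rule sum.cong) (use st m in auto)
    ultimately show ?thesis by simp
  qed
  then show "\<exists>\<delta>>0. \<forall>n s t. interval_family c d {..<n::nat} s t \<longrightarrow>
      (\<Sum>i<n. t i - s i) < \<delta> \<longrightarrow> (\<Sum>i<n. \<bar>\<mu> (t i) - \<mu> (s i)\<bar>) < \<epsilon>"
    by (intro exI[of _ \<delta>] conjI allI impI \<delta>(1))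
qed

text \<open>This applies to running maxima: an increment of the maximum over \<open>[x, y]\<close> is dominated by the
increment of the function from \<open>x\<close> to a point where the new maximum is attained.\<close>

lemma abs_continuous_on_running_increment:
  assumes F: "abs_continuous_on {c..d} F"
    and E: "\<And>x y. c \<le> x \<Longrightarrow> x \<le> y \<Longrightarrow> y \<le> d \<Longrightarrow> \<exists>r\<in>{x..y}. \<bar>E y - E x\<bar> \<le> \<bar>F r - F x\<bar>"
  shows "abs_continuous_on {c..d} E"
proof (rule abs_continuous_on_intervalI)
  fix \<epsilon> :: real assume \<epsilon>: "\<epsilon> > 0"
  obtain \<delta> where \<delta>: "\<delta> > 0" "\<And>(K :: nat set) s t. interval_family c d K s t \<Longrightarrow>
      (\<Sum>i\<in>K. t i - s i) < \<delta> \<Longrightarrow> (\<Sum>i\<in>K. \<bar>F (t i) - F (s i)\<bar>) < \<epsilon>"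
    by (rule abs_continuous_on_interval_family[OF F \<epsilon>]) (rule that)
  have "(\<Sum>i<n. \<bar>E (t i) - E (s i)\<bar>) < \<epsilon>"
    if fam: "interval_family c d {..<n::nat} s t" and len: "(\<Sum>i<n. t i - s i) < \<delta>" for n s t
  proof -
    have st: "c \<le> s i" "s i \<le> t i" "t i \<le> d" if "i < n" for i
      using fam that by (auto simp: interval_family_def)
    have "\<forall>i\<in>{..<n}. \<exists>r. r \<in> {s i..t i} \<and> \<bar>E (t i) - E (s i)\<bar> \<le> \<bar>F r - F (s i)\<bar>"
      using E st unfolding Bex_def by simp
    then obtain r where "\<forall>i\<in>{..<n}. r i \<in> {s i..t i} \<and> \<bar>E (t i) - E (s i)\<bar> \<le> \<bar>F (r i) - F (s i)\<bar>"
      by (rule bchoice[THEN exE])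
    then have r: "s i \<le> r i" "r i \<le> t i" "\<bar>E (t i) - E (s i)\<bar> \<le> \<bar>F (r i) - F (s i)\<bar>" if "i < n" for i
      using that by auto
    have "interval_family c d {..<n} s r"
      unfolding interval_family_def
    proof (intro conjI ballI impI)
      fix i j assume ij: "i \<in> {..<n}" "j \<in> {..<n}" "i \<noteq> j"
      have "{s i<..<t i} \<inter> {s j<..<t j} = {}" using fam ij unfolding interval_family_def by blast
      moreover have "{s k<..<r k} \<subseteq> {s k<..<t k}" if "k < n" for k
        using r(2)[OF that] by auto
      ultimately show "{s i<..<r i} \<inter> {s j<..<r j} = {}" using ij by blast
    next
      fix i assume "i \<in> {..<n}"
      then show "c \<le> s i" "s i \<le> r i" "r i \<le> d" using st[of i] r[of i] by auto
    qed simp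
    moreover have "(\<Sum>i<n. r i - s i) < \<delta>"
    proof -
      have "(\<Sum>i<n. r i - s i) \<le> (\<Sum>i<n. t i - s i)" using r by (intro sum_mono) simp
      then show ?thesis using len by simp
    qed
    ultimately have "(\<Sum>i<n. \<bar>F (r i) - F (s i)\<bar>) < \<epsilon>" by (rule \<delta>(2))
    moreover have "(\<Sum>i<n. \<bar>E (t i) - E (s i)\<bar>) \<le> (\<Sum>i<n. \<bar>F (r i) - F (s i)\<bar>)"
      using r by (intro sum_mono) simp
    ultimately show ?thesis by simp
  qed
  then show "\<exists>\<delta>>0. \<forall>n s t. interval_family c d {..<n::nat} s t \<longrightarrow>
      (\<Sum>i<n. t i - s i) < \<delta> \<longrightarrow> (\<Sum>i<n. \<bar>E (t i) - E (s i)\<bar>) < \<epsilon>"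
    by (intro exI[of _ \<delta>] conjI allI impI \<delta>(1))
qed

section \<open>The reduced energy and the load\<close>

lemma continuous_nonneg_from_AE:
  fixes f :: "real \<Rightarrow> real"
  assumes f: "continuous_on {a..b} f" and "a < b" and ae: "AE x in lebesgue. a < x \<and> x < b \<longrightarrow> 0 \<le> f x"
    and x: "x \<in> {a..b}"
  shows "0 \<le> f x"
proof -
  define S where "S = {x \<in> {a<..<b}. f x \<in> {..<0}}"
  have "open S"
    unfolding S_def by (intro continuous_open_preimage[unfolded vimage_def Int_def mem_Collect_eq, simplified])
      (auto intro: continuous_on_subset[OF f])
  have "negligible {x. \<not> (a < x \<and> x < b \<longrightarrow> 0 \<le> f x)}"
    using ae unfolding negligible_iff_null_sets completion.AE_iff_null_sets by simp
  then have "negligible S" by (rule negligible_subset) (auto simp: S_def)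
  then have "S = {}" using \<open>open S\<close> open_not_negligible by blast
  then have "0 \<le> f y" if "y \<in> {a<..<b}" for y 
  proof -
    have "y \<notin> S" using \<open>S = {}\<close> by simp
    then show ?thesis using that by (auto simp: S_def)
  qed
  then show ?thesis
    using continuous_ge_on_closure[of "{a<..<b}" f x 0] f x \<open>a < b\<close> by simp
qed

lemma locally_abs_continuous_derivative_AE:
  assumes "\<forall>T>0. abs_continuous_on {0..T} F"
  shows "AE t in lebesgue. t > 0 \<longrightarrow> (F has_real_derivative deriv F t) (at t)"
proof -
  have "AE t in lebesgue. \<forall>n. 0 < t \<and> t < real (Suc n) \<longrightarrow> (F has_real_derivative deriv F t) (at t)"
    unfolding AE_all_countable
    by (intro allI abs_continuous_fundamental_theorem(1)) (use assms in auto)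
  then show ?thesis
  proof eventually_elim
    case (elim t)
    obtain n where "t < real n" using reals_Archimedean2 by blast
    then show ?case using elim[rule_format, of n] by simp
  qed
qed

locale debonding =
  fixes l0 :: real and w \<kappa> :: "real \<Rightarrow> real"
  assumes l0: "0 < l0" and w_cont: "continuous_on {0..} w"
    and w_ac: "\<forall>T>0. abs_continuous_on {0..T} w"
    and \<kappa>_cont: "continuous_on {l0..} \<kappa>"
    and phi_mono: "strict_mono_on {l0..} (phi \<kappa>)"
    and phi_deriv: "AE x in lebesgue. x > l0 \<longrightarrow> (\<exists>D>0. (phi \<kappa> has_real_derivative D) (at x))"
begin

text \<open>The value that \<open>phi \<kappa>\<close> takes at the debonding front: the running maximum of \<open>w\<^sup>2 / 2\<close>, but at least
the initial resistance.\<close>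

definition load :: "real \<Rightarrow> real" where
  "load t = max (1/2 * max_square w t) (phi \<kappa> l0)"

text \<open>The energy spent on debonding up to \<open>l\<close>.\<close>

definition fracture :: "real \<Rightarrow> real" where
  "fracture l = integral {l0..l} \<kappa>"

text \<open>These three facts characterize the load and replace its definition as a supremum in what follows.\<close>

lemma load_properties:
  assumes "0 \<le> t"
  shows "phi \<kappa> l0 \<le> load t" "\<And>s. 0 \<le> s \<Longrightarrow> s \<le> t \<Longrightarrow> 1/2 * (w s)\<^sup>2 \<le> load t"
    "load t = phi \<kappa> l0 \<or> (\<exists>s\<in>{0..t}. load t = 1/2 * (w s)\<^sup>2)"
proof -
  have c: "continuous_on {0..t} (\<lambda>s. (w s)\<^sup>2)"
    by (intro continuous_on_power continuous_on_subset[OF w_cont]) auto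
  obtain r where r: "r \<in> {0..t}" "\<forall>s\<in>{0..t}. (w s)\<^sup>2 \<le> (w r)\<^sup>2"
    using continuous_attains_sup[OF compact_Icc _ c] assms by auto
  have m: "max_square w t = (w r)\<^sup>2"
    unfolding max_square_def by (rule cSup_eq_maximum) (use r in auto)
  show "phi \<kappa> l0 \<le> load t" by (simp add: load_def)
  show "1/2 * (w s)\<^sup>2 \<le> load t" if "0 \<le> s" "s \<le> t" for s
    using r(2)[rule_format, of s] that by (simp add: load_def m)
  show "load t = phi \<kappa> l0 \<or> (\<exists>s\<in>{0..t}. load t = 1/2 * (w s)\<^sup>2)"
    using r(1) by (auto simp: load_def m max_def)
qed

lemma load_mono:
  assumes "0 \<le> s" "s \<le> t"
  shows "load s \<le> load t"
  using load_properties(3)[OF assms(1)] load_properties(1,2)[of t] assms by fastforce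

lemma phi_cont: "A \<subseteq> {l0..} \<Longrightarrow> continuous_on A (phi \<kappa>)"
  unfolding phi_def[abs_def] by (intro continuous_intros continuous_on_subset[OF \<kappa>_cont])

lemma phi_less: "l0 \<le> x \<Longrightarrow> x < y \<Longrightarrow> phi \<kappa> x < phi \<kappa> y"
  using strict_mono_onD[OF phi_mono] by simp

lemma phi_inj: "l0 \<le> x \<Longrightarrow> l0 \<le> y \<Longrightarrow> phi \<kappa> x = phi \<kappa> y \<Longrightarrow> x = y"
  using phi_less[of x y] phi_less[of y x] by linarith

lemma fracture_eq: "(LINT \<sigma>:{l0..l}|lebesgue. \<kappa> \<sigma>) = fracture l"
  unfolding fracture_def
  by (intro set_lebesgue_integral_eq_integral(2) absolutely_integrable_continuous_real
      continuous_on_subset[OF \<kappa>_cont]) auto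

lemma fracture_cont: "continuous_on {l0..b} fracture"
  unfolding fracture_def[abs_def]
  by (intro indefinite_integral_continuous_1 integrable_continuous_real continuous_on_subset[OF \<kappa>_cont]) auto

lemma fracture_derivative_within:
  assumes "l0 \<le> x"
  shows "(fracture has_real_derivative \<kappa> x) (at x within {l0..})"
proof -
  have "(fracture has_real_derivative \<kappa> x) (at x within {l0..x + 1})"
    unfolding fracture_def[abs_def] has_real_derivative_iff_has_vector_derivative
    by (rule integral_has_vector_derivative) (use assms in \<open>auto intro: continuous_on_subset[OF \<kappa>_cont]\<close>)
  moreover have "at x within {l0..x + 1} = at x within {l0..}"
    by (rule at_within_nhd[of x "{..<x+1}"]) (use assms in auto)
  ultimately show ?thesis by simp
qed

lemma fracture_derivative:
  assumes "l0 < x"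
  shows "(fracture has_real_derivative \<kappa> x) (at x)"
  using fracture_derivative_within[of x] assms at_within_interior[of x "{l0..}"] by simp

text \<open>With \<open>C = w\<^sup>2 / 2\<close> the function \<open>fracture l + C / l\<close> is the total energy of the affine profile on \<open>[0, l]\<close>.
The sign of its derivative compares \<open>phi \<kappa>\<close> with \<open>C\<close>, which is why monotonicity of \<open>phi \<kappa>\<close> turns the local
stability condition into a global one.\<close>

lemma reduced_energy_derivative:
  assumes "l0 < x"
  shows "((\<lambda>l. fracture l + C / l) has_real_derivative (phi \<kappa> x - C) / x\<^sup>2) (at x)"
proof -
  have "((\<lambda>l. fracture l + C / l) has_real_derivative \<kappa> x + - C / x\<^sup>2) (at x)"
    using assms l0 by (auto intro!: derivative_eq_intros fracture_derivative simp: power2_eq_square)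
  also have "\<kappa> x + - C / x\<^sup>2 = (phi \<kappa> x - C) / x\<^sup>2"
    using assms l0 by (simp add: phi_def field_simps)
  finally show ?thesis .
qed

lemma reduced_energy_cont: "l0 \<le> a \<Longrightarrow> continuous_on {a..b} (\<lambda>l. fracture l + C / l)"
  using l0 by (intro continuous_intros continuous_on_subset[OF fracture_cont[of b]]) auto

lemma reduced_energy_strict_increasing:
  assumes "l0 \<le> a" "a < b" "C \<le> phi \<kappa> a"
  shows "fracture a + C / a < fracture b + C / b"
proof (rule DERIV_pos_imp_increasing_open[of a b "\<lambda>l. fracture l + C / l"])
  fix x assume x: "a < x" "x < b"
  then have "(phi \<kappa> x - C) / x\<^sup>2 > 0"
    using phi_less[of a x] assms l0 by simp
  then show "\<exists>y. ((\<lambda>l. fracture l + C / l) has_real_derivative y) (at x) \<and> 0 < y"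
    using reduced_energy_derivative[of x C] x assms by auto
qed (use assms reduced_energy_cont in auto)

text \<open>The one-sided derivative at a minimum over \<open>[a, \<infinity>)\<close> cannot be negative.\<close>

lemma reduced_energy_minimal_imp:
  assumes a: "l0 \<le> a" and min: "\<And>l. a \<le> l \<Longrightarrow> fracture a + C / a \<le> fracture l + C / l"
  shows "C \<le> phi \<kappa> a"
proof (rule ccontr)
  assume "\<not> C \<le> phi \<kappa> a"
  moreover have "((phi \<kappa>) \<longlongrightarrow> phi \<kappa> a) (at a within {a..})"
    using phi_cont[of "{a..}"] a by (simp add: continuous_on)
  ultimately have "\<forall>\<^sub>F x in at a within {a..}. phi \<kappa> x < C"
    by (intro order_tendstoD(2)) auto
  then obtain d where d: "d > 0" "\<And>x. a < x \<Longrightarrow> x < a + d \<Longrightarrow> phi \<kappa> x < C"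
    unfolding eventually_at by (auto simp: dist_real_def)
  have "fracture (a + d) + C / (a + d) < fracture a + C / a"
  proof (rule DERIV_neg_imp_decreasing_open[of a "a + d" "\<lambda>l. fracture l + C / l"])
    fix x assume x: "a < x" "x < a + d"
    then have "(phi \<kappa> x - C) / x\<^sup>2 < 0"
      using d(2)[OF x] a l0 by (simp add: divide_neg_pos)
    then show "\<exists>y. ((\<lambda>l. fracture l + C / l) has_real_derivative y) (at x) \<and> y < 0"
      using reduced_energy_derivative[of x C] x a by auto
  qed (use d a reduced_energy_cont in auto)
  then show False using min[of "a + d"] d by simp
qed

text \<open>The chain rule \<open>(w\<^sup>2 / 2)' = w w'\<close> in integrated form.\<close>

lemma half_square:
  assumes "0 < T"
  shows "abs_continuous_on {0..T} (\<lambda>t. 1/2 * (w t)\<^sup>2)"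
    and "(\<lambda>t. deriv w t * w t) absolutely_integrable_on {0..T}"
    and "\<And>s t. 0 \<le> s \<Longrightarrow> s \<le> t \<Longrightarrow> t \<le> T \<Longrightarrow>
      integral {s..t} (\<lambda>t. deriv w t * w t) = 1/2 * (w t)\<^sup>2 - 1/2 * (w s)\<^sup>2"
proof -
  have wT: "abs_continuous_on {0..T} w" using w_ac assms by blast
  have "compact (w ` {0..T})"
    by (intro compact_continuous_image continuous_on_subset[OF w_cont]) auto
  then obtain M where M: "\<And>t. 0 \<le> t \<Longrightarrow> t \<le> T \<Longrightarrow> \<bar>w t\<bar> \<le> M"
    using compact_imp_bounded bounded_iff by (metis atLeastAtMost_iff imageI real_norm_def)
  show ac: "abs_continuous_on {0..T} (\<lambda>t. 1/2 * (w t)\<^sup>2)"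
  proof (rule abs_continuous_on_dominated[OF wT wT, where A = M and B = 0])
    fix x y :: real assume xy: "0 \<le> x" "x \<le> y" "y \<le> T"
    have "1/2 * (w y)\<^sup>2 - 1/2 * (w x)\<^sup>2 = (w y + w x) / 2 * (w y - w x)"
      by (simp add: power2_eq_square algebra_simps)
    moreover have "\<bar>(w y + w x) / 2\<bar> \<le> M" using M[of x] M[of y] xy by auto
    ultimately have "\<bar>1/2 * (w y)\<^sup>2 - 1/2 * (w x)\<^sup>2\<bar> \<le> M * \<bar>w y - w x\<bar>"
      by (simp only: abs_mult mult_right_mono abs_ge_zero)
    then show "\<bar>1/2 * (w y)\<^sup>2 - 1/2 * (w x)\<^sup>2\<bar> \<le> M * \<bar>w y - w x\<bar> + 0 * \<bar>w y - w x\<bar>" by simp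
  qed
  note ftc = abs_continuous_fundamental_theorem[OF ac less_imp_le[OF assms]]
  have "AE t in lebesgue. t \<notin> {0, T}"
    by (rule AE_not_in) (simp flip: negligible_iff_null_sets)
  with abs_continuous_fundamental_theorem(1)[OF wT less_imp_le[OF assms]]
  have eq: "AE t in lebesgue. t \<in> {0..T} \<longrightarrow> deriv (\<lambda>t. 1/2 * (w t)\<^sup>2) t = deriv w t * w t"
  proof eventually_elim
    case (elim t)
    show ?case
    proof
      assume "t \<in> {0..T}"
      then have "(w has_real_derivative deriv w t) (at t)" using elim by auto
      then have "((\<lambda>t. 1/2 * (w t)\<^sup>2) has_real_derivative deriv w t * w t) (at t)"
        by (auto intro!: derivative_eq_intros)
      then show "deriv (\<lambda>t. 1/2 * (w t)\<^sup>2) t = deriv w t * w t" by (rule DERIV_imp_deriv)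
    qed
  qed
  show ai: "(\<lambda>t. deriv w t * w t) absolutely_integrable_on {0..T}"
    by (rule absolutely_integrable_cong_AE(1)[OF ftc(2) eq])
  show "integral {s..t} (\<lambda>t. deriv w t * w t) = 1/2 * (w t)\<^sup>2 - 1/2 * (w s)\<^sup>2"
    if st: "0 \<le> s" "s \<le> t" "t \<le> T" for s t
  proof -
    have sub: "{s..t} \<subseteq> {0..T}" using st by auto
    have "AE x in lebesgue. x \<in> {s..t} \<longrightarrow> deriv (\<lambda>t. 1/2 * (w t)\<^sup>2) x = deriv w x * w x"
      using eq by eventually_elim (use sub in auto)
    then have "(LINT x:{s..t}|lebesgue. deriv w x * w x) = 1/2 * (w t)\<^sup>2 - 1/2 * (w s)\<^sup>2"
      using absolutely_integrable_cong_AE(2)[OF set_integrable_subset[OF ftc(2) _ sub]] ftc(3)[OF st] by simp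
    moreover have "(LINT x:{s..t}|lebesgue. deriv w x * w x) = integral {s..t} (\<lambda>x. deriv w x * w x)"
      by (rule set_lebesgue_integral_eq_integral(2)[OF set_integrable_subset[OF ai _ sub]]) simp
    ultimately show ?thesis by simp
  qed
qed

section \<open>The energy balance determines the front\<close>

text \<open>These predicates isolate the conditions on the front alone that remain once the displacement is
known to be affine up to the front.\<close>

definition front :: "(real \<Rightarrow> real) \<Rightarrow> bool" where
  "front lam \<longleftrightarrow> (\<forall>t\<ge>0. lam t \<ge> l0) \<and> mono_on {0..} lam \<and> lam 0 = l0"

definition balanced :: "(real \<Rightarrow> real) \<Rightarrow> bool" where
  "balanced lam \<longleftrightarrow> (\<forall>t\<ge>0. (\<lambda>\<tau>. deriv w \<tau> * (- w \<tau> / lam \<tau>)) absolutely_integrable_on {0..t} \<and>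
     1/2 * (w t)\<^sup>2 / lam t + fracture (lam t) + (LINT \<tau>:{0..t}|lebesgue. deriv w \<tau> * (- w \<tau> / lam \<tau>))
       = 1/2 * (w 0)\<^sup>2 / l0)"

definition stable :: "(real \<Rightarrow> real) \<Rightarrow> bool" where
  "stable lam \<longleftrightarrow> (\<forall>t\<ge>0. 1/2 * (w t)\<^sup>2 \<le> phi \<kappa> (lam t))"

text \<open>Stability gives \<open>load t \<le> phi \<kappa> (lam t)\<close>, because \<open>lam\<close> and \<open>phi \<kappa>\<close> are increasing.

For the converse, the balance between times \<open>r \<le> s\<close> combined with \<open>\<integral> w w' = (w(s)\<^sup>2 - w(r)\<^sup>2) / 2\<close> bounds the
fracture energy spent by
\<open>(w(r)\<^sup>2 / 2 + \<eta>) (1 / lam r - 1 / lam s)\<close>, where \<open>\<eta>\<close> is the integral of \<open>\<bar>w w'\<bar>\<close> over \<open>[r, s]\<close>. Suppose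
\<open>phi \<kappa> (lam t) > C\<close> for \<open>C = load t\<close>, and let \<open>a < lam t\<close> be the length with \<open>phi \<kappa> a = C\<close>. The energy
\<open>P\<close> of the front truncated from below at \<open>a\<close>, under the constant load \<open>C\<close>, then grows by at most
\<open>\<eta> (1 / lam r - 1 / lam s)\<close> from \<open>r\<close> to \<open>s\<close>. Summed over a fine partition, the factors \<open>\<eta>\<close> are uniformly small
and the other factors telescope, so \<open>P\<close> does not grow at all up to time \<open>t\<close>. But the reduced energy is strictly
larger at \<open>lam t\<close> than at \<open>a\<close>.
The truncation also absorbs a jump of \<open>lam\<close> across \<open>a\<close>.\<close>

lemma front_phi_eq_load:
  assumes front: "front lam" and st: "stable lam" and bal: "balanced lam" and t: "0 \<le> t"
  shows "phi \<kappa> (lam t) = load t"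
proof -
  have ge: "\<And>s. 0 \<le> s \<Longrightarrow> l0 \<le> lam s" and mono: "\<And>r s. 0 \<le> r \<Longrightarrow> r \<le> s \<Longrightarrow> lam r \<le> lam s"
    and lam0: "lam 0 = l0"
    using front by (auto simp: front_def mono_on_def)
  have phi_le: "phi \<kappa> x \<le> phi \<kappa> y" if "l0 \<le> x" "x \<le> y" for x y
    using phi_less[of x y] that by (cases "x = y") auto
  show ?thesis
  proof (cases "t = 0")
    case True
    have "1/2 * (w 0)\<^sup>2 \<le> phi \<kappa> l0" using st lam0 by (auto simp: stable_def)
    then show ?thesis using load_properties(1,3)[of 0] True lam0 by auto
  next
    case False
    then have T: "0 < t" using t by simp
    define q where "q = (\<lambda>\<tau>. deriv w \<tau> * w \<tau>)"
    have qa: "q absolutely_integrable_on {0..t}" unfolding q_def by (rule half_square(2)[OF T])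
    have qi: "q integrable_on {r..s}" "(\<lambda>\<tau>. \<bar>q \<tau>\<bar>) integrable_on {r..s}" if "0 \<le> r" "s \<le> t" for r s
    proof -
      have "q absolutely_integrable_on {r..s}" by (rule set_integrable_subset[OF qa]) (use that in auto)
      then show "q integrable_on {r..s}" "(\<lambda>\<tau>. \<bar>q \<tau>\<bar>) integrable_on {r..s}"
        by (auto simp: absolutely_integrable_on_def)
    qed
    have q_int: "integral {r..s} q = 1/2 * (w s)\<^sup>2 - 1/2 * (w r)\<^sup>2" if "0 \<le> r" "r \<le> s" "s \<le> t" for r s
      unfolding q_def by (rule half_square(3)[OF T that])
    have pa: "(\<lambda>\<tau>. deriv w \<tau> * (- w \<tau> / lam \<tau>)) absolutely_integrable_on {0..s}"
      and eb: "1/2 * (w s)\<^sup>2 / lam s + fracture (lam s) + (LINT \<tau>:{0..s}|lebesgue. deriv w \<tau> * (- w \<tau> / lam \<tau>))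
        = 1/2 * (w 0)\<^sup>2 / l0" if "0 \<le> s" for s using bal that by (auto simp: balanced_def)
    define p where "p = (\<lambda>\<tau>. q \<tau> / lam \<tau>)"
    have p_alt: "p = (\<lambda>\<tau>. - (deriv w \<tau> * (- w \<tau> / lam \<tau>)))" by (auto simp: p_def q_def)
    have pI: "p integrable_on {r..s}" if "0 \<le> r" "s \<le> t" for r s
    proof -
      have "(\<lambda>\<tau>. deriv w \<tau> * (- w \<tau> / lam \<tau>)) integrable_on {r..s}"
        using set_lebesgue_integral_eq_integral(1)[OF pa[OF t]] by (rule integrable_on_subinterval) (use that in auto)
      then show ?thesis unfolding p_alt by (rule integrable_neg)
    qed
    have eb': "1/2 * (w s)\<^sup>2 / lam s + fracture (lam s) = 1/2 * (w 0)\<^sup>2 / l0 + integral {0..s} p" if "0 \<le> s" for s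
      using eb[OF that] set_lebesgue_integral_eq_integral(2)[OF pa[OF that]] by (simp add: p_alt)
    define H where "H = (\<lambda>s. integral {0..s} (\<lambda>\<tau>. \<bar>q \<tau>\<bar>))"
    have H: "integral {r..s} (\<lambda>\<tau>. \<bar>q \<tau>\<bar>) = H s - H r" if "0 \<le> r" "r \<le> s" "s \<le> t" for r s
      using Henstock_Kurzweil_Integration.integral_combine[OF that(1,2) qi(2)] that by (simp add: H_def)
    have step: "fracture (lam s) - fracture (lam r) \<le> (1/2 * (w r)\<^sup>2 + (H s - H r)) * (1 / lam r - 1 / lam s)"
      if rs: "0 \<le> r" "r \<le> s" "s \<le> t" for r s
    proof -
      have pos: "0 < lam r" "lam r \<le> lam s" using ge[of r] mono[of r s] l0 rs by auto
      have "1/2 * (w s)\<^sup>2 / lam s + fracture (lam s) - (1/2 * (w r)\<^sup>2 / lam r + fracture (lam r)) = integral {r..s} p"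
        using eb'[of s] eb'[of r] Henstock_Kurzweil_Integration.integral_combine[OF rs(1,2) pI] rs by simp
      moreover have "integral {r..s} (\<lambda>\<tau>. q \<tau> / lam s) = (1/2 * (w s)\<^sup>2 - 1/2 * (w r)\<^sup>2) / lam s"
        using q_int[OF rs] by simp
      moreover have "integral {r..s} p - integral {r..s} (\<lambda>\<tau>. q \<tau> / lam s) = integral {r..s} (\<lambda>\<tau>. p \<tau> - q \<tau> / lam s)"
        by (rule integral_diff[symmetric]) (use pI qi rs in \<open>auto intro: integrable_on_divide\<close>)
      moreover have "integral {r..s} (\<lambda>\<tau>. p \<tau> - q \<tau> / lam s) \<le> integral {r..s} (\<lambda>\<tau>. \<bar>q \<tau>\<bar> * (1 / lam r - 1 / lam s))"
      proof (rule integral_le)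
        fix \<tau> assume \<tau>: "\<tau> \<in> {r..s}"
        then have l: "lam r \<le> lam \<tau>" "lam \<tau> \<le> lam s" using mono rs by auto
        have "p \<tau> - q \<tau> / lam s = q \<tau> * (1 / lam \<tau> - 1 / lam s)" by (simp add: p_def right_diff_distrib)
        also have "\<dots> \<le> \<bar>q \<tau>\<bar> * (1 / lam \<tau> - 1 / lam s)"
          by (rule mult_right_mono) (use l pos in \<open>auto simp: frac_le\<close>)
        also have "\<dots> \<le> \<bar>q \<tau>\<bar> * (1 / lam r - 1 / lam s)"
          by (rule mult_left_mono) (use l pos in \<open>auto simp: frac_le\<close>)
        finally show "p \<tau> - q \<tau> / lam s \<le> \<bar>q \<tau>\<bar> * (1 / lam r - 1 / lam s)" .
      qed (use pI qi rs in \<open>auto intro!: integrable_diff integrable_on_divide integrable_on_mult_left\<close>)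
      moreover have "integral {r..s} (\<lambda>\<tau>. \<bar>q \<tau>\<bar> * (1 / lam r - 1 / lam s)) = (H s - H r) * (1 / lam r - 1 / lam s)"
        using H[OF rs] by (simp add: integral_mult_left)
      ultimately have "1/2 * (w s)\<^sup>2 / lam s + fracture (lam s) - (1/2 * (w r)\<^sup>2 / lam r + fracture (lam r))
          - (1/2 * (w s)\<^sup>2 - 1/2 * (w r)\<^sup>2) / lam s \<le> (H s - H r) * (1 / lam r - 1 / lam s)" by linarith
      then show ?thesis by (simp add: algebra_simps diff_divide_distrib)
    qed
    have "load t \<le> phi \<kappa> (lam t)"
      using load_properties(3)[OF t]
    proof
      assume "load t = phi \<kappa> l0"
      then show ?thesis using phi_le[of l0 "lam t"] ge[OF t] by simp
    next
      assume "\<exists>s\<in>{0..t}. load t = 1/2 * (w s)\<^sup>2"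
      then obtain s where s: "0 \<le> s" "s \<le> t" "load t = 1/2 * (w s)\<^sup>2" by auto
      then have "load t \<le> phi \<kappa> (lam s)" using st[unfolded stable_def, rule_format, OF s(1)] by simp
      also have "\<dots> \<le> phi \<kappa> (lam t)" by (rule phi_le[OF ge[OF s(1)] mono[OF s(1,2)]])
      finally show ?thesis .
    qed
    moreover have "phi \<kappa> (lam t) \<le> load t"
    proof (rule ccontr)
      assume "\<not> phi \<kappa> (lam t) \<le> load t"
      then have less: "load t < phi \<kappa> (lam t)" by simp
      obtain a where a: "l0 \<le> a" "a \<le> lam t" "phi \<kappa> a = load t"
        using IVT'[of "phi \<kappa>" l0 "load t" "lam t"] load_properties(1)[OF t] less ge[OF t] phi_cont[of "{l0..lam t}"] by auto
      have "a < lam t" using a less by (cases "a = lam t") auto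
      define C where "C = load t"
      define P where "P = (\<lambda>s. fracture (max a (lam s)) + C / max a (lam s))"
      have Pstep: "P s - P r \<le> (H s - H r) * (1 / lam r - 1 / lam s)" if rs: "0 \<le> r" "r \<le> s" "s \<le> t" for r s
      proof -
        have pos: "0 < lam r" "lam r \<le> lam s" "l0 \<le> lam r" using ge[of r] mono[of r s] l0 rs by auto
        have C: "1/2 * (w r)\<^sup>2 \<le> C" unfolding C_def by (rule load_properties(2)[OF t]) (use rs in auto)
        have inv: "1 / lam s \<le> 1 / lam r" using pos by (simp add: frac_le)
        have HH: "0 \<le> H s - H r"
          unfolding H[OF rs, symmetric] by (rule integral_nonneg) (use qi rs in auto)
        consider "a \<le> lam r" | "lam s \<le> a" | "lam r < a" "a < lam s" by linarith
        then show ?thesis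
        proof cases
          case 1
          have "1/2 * (w r)\<^sup>2 * (1 / lam r - 1 / lam s) \<le> C * (1 / lam r - 1 / lam s)"
            by (rule mult_right_mono[OF C]) (use inv in simp)
          then show ?thesis using step[OF rs] 1 pos by (simp add: P_def algebra_simps)
        next
          case 2
          then show ?thesis using pos HH inv by (simp add: P_def)
        next
          case 3
          \<comment> \<open>The front passes \<open>a\<close>, possibly by a jump: stability at \<open>r\<close> makes the step from \<open>lam r\<close> up to \<open>a\<close> cost energy, so dropping it by truncation is safe.\<close>
          define c where "c = 1/2 * (w r)\<^sup>2"
          have "fracture (lam r) + c / lam r < fracture a + c / a"
            by (rule reduced_energy_strict_increasing) (use pos 3 st rs in \<open>auto simp: stable_def c_def\<close>)
          moreover have "c * (1 / a - 1 / lam s) \<le> C * (1 / a - 1 / lam s)"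
            by (rule mult_right_mono[OF C[folded c_def]]) (use 3 a l0 in \<open>simp add: frac_le\<close>)
          ultimately show ?thesis using step[OF rs, folded c_def] 3 by (simp add: P_def algebra_simps add_divide_distrib)
        qed
      qed
      have "P t - P 0 \<le> 0 + \<epsilon>" if \<epsilon>: "\<epsilon> > 0" for \<epsilon>
      proof -
        have "uniformly_continuous_on {0..t} H"
          unfolding H_def by (intro compact_uniformly_continuous indefinite_integral_continuous_1 qi compact_Icc) auto
        moreover have "\<epsilon> * l0 > 0" using \<epsilon> l0 by simp
        ultimately obtain d where d: "d > 0"
          "\<forall>r\<in>{0..t}. \<forall>s\<in>{0..t}. dist s r < d \<longrightarrow> dist (H s) (H r) < \<epsilon> * l0"
          unfolding uniformly_continuous_on_def by blast
        obtain n where n: "t / d < real n" using reals_Archimedean2 by blast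
        have n0: "real n > 0" using n divide_pos_pos[OF T d(1)] by linarith
        define x where "x = (\<lambda>i. real i * (t / real n))"
        have x: "0 \<le> x i" "x i \<le> x (Suc i)" "x (Suc i) - x i < d" for i
          using T n0 n d(1) by (auto simp: x_def field_simps)
        have xt: "x (Suc i) \<le> t" if "i < n" for i
        proof -
          have "real (Suc i) * (t / real n) \<le> real n * (t / real n)"
            by (rule mult_right_mono) (use that T in auto)
          then show ?thesis using n0 by (simp add: x_def)
        qed
        have "P t - P 0 = (\<Sum>i<n. P (x (Suc i)) - P (x i))"
          using sum_lessThan_telescope[of "\<lambda>i. P (x i)" n] n0 by (simp add: x_def)
        also have "\<dots> \<le> (\<Sum>i<n. (\<epsilon> * l0) * (1 / lam (x i) - 1 / lam (x (Suc i))))"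
        proof (rule sum_mono)
          fix i assume "i \<in> {..<n}"
          then have i: "0 \<le> x i" "x i \<le> x (Suc i)" "x (Suc i) \<le> t" using x xt by auto
          have "P (x (Suc i)) - P (x i) \<le> (H (x (Suc i)) - H (x i)) * (1 / lam (x i) - 1 / lam (x (Suc i)))"
            by (rule Pstep[OF i])
          also have "\<dots> \<le> (\<epsilon> * l0) * (1 / lam (x i) - 1 / lam (x (Suc i)))"
          proof (rule mult_right_mono)
            show "H (x (Suc i)) - H (x i) \<le> \<epsilon> * l0"
              using d(2)[rule_format, of "x i" "x (Suc i)"] i x(3)[of i] by (simp add: dist_real_def)
            show "0 \<le> 1 / lam (x i) - 1 / lam (x (Suc i))"
              using mono[OF i(1,2)] ge[OF i(1)] l0 by (simp add: frac_le)
          qed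
          finally show "P (x (Suc i)) - P (x i) \<le> (\<epsilon> * l0) * (1 / lam (x i) - 1 / lam (x (Suc i)))" .
        qed
        also have "\<dots> = (\<epsilon> * l0) * (1 / lam (x 0) - 1 / lam (x n))"
          using sum_lessThan_telescope'[of "\<lambda>i. 1 / lam (x i)" n] by (simp only: sum_distrib_left[symmetric])
        also have "\<dots> \<le> (\<epsilon> * l0) * (1 / l0)"
          using \<epsilon> l0 lam0 ge[OF x(1)[of n]] by (intro mult_left_mono) (auto simp: x_def)
        finally show ?thesis using l0 by simp
      qed
      then have "P t \<le> P 0" using field_le_epsilon[of "P t - P 0" 0] by simp
      moreover have "fracture a + C / a < fracture (lam t) + C / lam t"
        by (rule reduced_energy_strict_increasing) (use a \<open>a < lam t\<close> in \<open>auto simp: C_def\<close>)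
      ultimately show False using a \<open>a < lam t\<close> by (simp add: P_def lam0)
    qed
    ultimately show ?thesis by simp
  qed
qed


section \<open>Fronts driven by the load are quasistatic\<close>

definition griffith :: "(real \<Rightarrow> real) \<Rightarrow> bool" where
  "griffith lam \<longleftrightarrow> (AE t in lebesgue. t > 0 \<longrightarrow>
        (\<exists>D. (lam has_real_derivative D) (at t) \<and> D \<ge> 0 \<and>
             1/2 * ((w t)\<^sup>2 / (lam t)\<^sup>2) \<le> \<kappa> (lam t) \<and>
             (1/2 * ((w t)\<^sup>2 / (lam t)\<^sup>2) - \<kappa> (lam t)) * D = 0))"

lemma frontD:
  assumes "front lam"
  shows "0 \<le> t \<Longrightarrow> l0 \<le> lam t" "0 \<le> s \<Longrightarrow> s \<le> t \<Longrightarrow> lam s \<le> lam t" "lam 0 = l0" "0 \<le> t \<Longrightarrow> 0 < lam t"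
  using assms l0 by (auto simp: front_def mono_on_def intro: less_le_trans)

lemma griffith_gap: "0 < l \<Longrightarrow> 1/2 * (c / l\<^sup>2) - \<kappa> l = (1/2 * c - phi \<kappa> l) / l\<^sup>2"
  by (simp add: phi_def field_simps)

text \<open>If the current \<open>w(t)\<^sup>2 / 2\<close> is below the load, then the load is attained at an earlier time or equals
the initial resistance, and times near \<open>t\<close> do not raise it. This gives the complementarity condition.\<close>

lemma load_locally_constant:
  assumes t: "0 < t" and gap: "1/2 * (w t)\<^sup>2 < load t"
  shows "\<forall>\<^sub>F s in nhds t. load s = load t"
proof -
  have "isCont w t" using w_cont t continuous_on_interior[of "{0..}" w t] by simp
  then have "isCont (\<lambda>s. 1/2 * (w s)\<^sup>2) t" by (intro continuous_intros)
  then have "((\<lambda>s. 1/2 * (w s)\<^sup>2) \<longlongrightarrow> 1/2 * (w t)\<^sup>2) (nhds t)"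
    unfolding isCont_def by (rule iffD1[OF tendsto_at_iff_tendsto_nhds])
  then have "\<forall>\<^sub>F s in nhds t. 1/2 * (w s)\<^sup>2 < load t" using gap by (rule order_tendstoD(2))
  moreover have "\<forall>\<^sub>F s in nhds t. s \<in> {0<..}" by (rule eventually_nhds_in_open) (use t in auto)
  ultimately have "\<forall>\<^sub>F s in nhds t. 0 < s \<and> 1/2 * (w s)\<^sup>2 < load t" by eventually_elim simp
  then obtain d where d: "d > 0" "\<And>s. dist s t < d \<Longrightarrow> 0 < s \<and> 1/2 * (w s)\<^sup>2 < load t"
    unfolding eventually_nhds_metric by blast
  have "load s = load t" if s: "dist s t < d" for s
  proof (rule antisym)
    have s0: "0 \<le> s" using d(2)[OF s] by simp
    show "load s \<le> load t"
      using load_properties(3)[OF s0]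
    proof
      assume "\<exists>r\<in>{0..s}. load s = 1/2 * (w r)\<^sup>2"
      then obtain r where r: "0 \<le> r" "r \<le> s" "load s = 1/2 * (w r)\<^sup>2" by auto
      show ?thesis
      proof (cases "r \<le> t")
        case True
        then show ?thesis using load_properties(2)[of t r] r t by simp
      next
        case False
        then have "dist r t < d" using r s by (simp add: dist_real_def)
        then show ?thesis using d(2)[of r] r by simp
      qed
    qed (use load_properties(1)[of t] t in simp)
    show "load t \<le> load s"
      using load_properties(3)[OF less_imp_le[OF t]]
    proof
      assume "\<exists>r\<in>{0..t}. load t = 1/2 * (w r)\<^sup>2"
      then obtain r where r: "0 \<le> r" "r \<le> t" "load t = 1/2 * (w r)\<^sup>2" by auto
      show ?thesis
      proof (cases "r \<le> s")
        case True
        then show ?thesis using load_properties(2)[of s r] r s0 by simp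
      next
        case False
        then have "dist r t < d" using r s by (simp add: dist_real_def)
        then show ?thesis using d(2)[of r] r by simp
      qed
    qed (use load_properties(1)[of s] s0 in simp)
  qed
  then show ?thesis unfolding eventually_nhds_metric using d(1) by blast
qed

text \<open>The composition \<open>phi \<kappa> \<circ> lam\<close> is the load, which is absolutely continuous as a running maximum, and
\<open>phi \<kappa>\<close> can be inverted without losing this. At almost every time \<open>lam\<close> is then differentiable; either the
load is active, so that the Griffith criterion holds with equality, or the front is locally at rest.\<close>

lemma front_from_load:
  assumes front: "front lam" and eq: "\<And>t. 0 \<le> t \<Longrightarrow> phi \<kappa> (lam t) = load t"
  shows "\<forall>T>0. abs_continuous_on {0..T} lam" and "griffith lam"
proof -
  note F = frontD[OF front]
  show ac: "\<forall>T>0. abs_continuous_on {0..T} lam"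
  proof (intro allI impI)
    fix T :: real assume T: "T > 0"
    show "abs_continuous_on {0..T} lam"
    proof (rule abs_continuous_on_of_increasing_image[where a = l0 and b = "lam T" and \<phi> = "phi \<kappa>"])
      show "continuous_on {l0..lam T} (phi \<kappa>)" by (rule phi_cont) auto
      show "mono_on {l0..lam T} (phi \<kappa>)"
      proof (rule mono_onI)
        show "phi \<kappa> r \<le> phi \<kappa> s" if "r \<in> {l0..lam T}" "r \<le> s" for r s
          using phi_less[of r s] that by (cases "r = s") auto
      qed
      show "AE x in lebesgue. l0 < x \<and> x < lam T \<longrightarrow> (\<exists>D>0. (phi \<kappa> has_real_derivative D) (at x))"
        using phi_deriv by eventually_elim simp
      show "mono_on {0..T} lam" using F(2) by (intro mono_onI) auto
      show "lam ` {0..T} \<subseteq> {l0..lam T}" using F(1,2) by auto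
      show "abs_continuous_on {0..T} (\<lambda>t. phi \<kappa> (lam t))"
      proof (rule abs_continuous_on_running_increment[OF half_square(1)[OF T]])
        fix x y assume xy: "0 \<le> x" "x \<le> y" "y \<le> T"
        show "\<exists>r\<in>{x..y}. \<bar>phi \<kappa> (lam y) - phi \<kappa> (lam x)\<bar> \<le> \<bar>1/2 * (w r)\<^sup>2 - 1/2 * (w x)\<^sup>2\<bar>"
        proof (cases "load y = load x")
          case True
          then show ?thesis using xy by (intro bexI[of _ x]) (auto simp: eq)
        next
          case False
          then have less: "load x < load y" using load_mono[OF xy(1,2)] by simp
          then have "load y \<noteq> phi \<kappa> l0" using load_properties(1)[OF xy(1)] by simp
          then obtain r where r: "0 \<le> r" "r \<le> y" "load y = 1/2 * (w r)\<^sup>2"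
            using load_properties(3)[of y] xy by auto
          then have "x \<le> r" using load_properties(2)[OF xy(1), of r] less by linarith
          moreover have "1/2 * (w x)\<^sup>2 \<le> load x" using load_properties(2)[OF xy(1), of x] xy by simp
          ultimately show ?thesis using r xy less by (intro bexI[of _ r]) (auto simp: eq)
        qed
      qed
    qed (use T in simp)
  qed
  have "AE t in lebesgue. t > 0 \<longrightarrow> (lam has_real_derivative deriv lam t) (at t)"
    by (rule locally_abs_continuous_derivative_AE[OF ac])
  then show "griffith lam"
    unfolding griffith_def
  proof eventually_elim
    case (elim t)
    show ?case
    proof
      assume t: "t > 0"
      then have D: "(lam has_real_derivative deriv lam t) (at t)" using elim by simp
      have pos: "0 < lam t" using F(4) t by simp
      have le: "1/2 * (w t)\<^sup>2 \<le> phi \<kappa> (lam t)" using load_properties(2)[of t t] eq[of t] t by simp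
      have "deriv lam t \<ge> 0"
      proof (rule mono_on_imp_deriv_nonneg[OF _ D])
        show "mono_on {0..} lam" using front by (simp add: front_def)
        show "t \<in> interior {0..}" using t by simp
      qed
      moreover have "1/2 * ((w t)\<^sup>2 / (lam t)\<^sup>2) \<le> \<kappa> (lam t)"
      proof -
        have "1/2 * ((w t)\<^sup>2 / (lam t)\<^sup>2) - \<kappa> (lam t) \<le> 0"
          unfolding griffith_gap[OF pos] using le pos by (simp add: divide_nonpos_pos)
        then show ?thesis by simp
      qed
      moreover have "(1/2 * ((w t)\<^sup>2 / (lam t)\<^sup>2) - \<kappa> (lam t)) * deriv lam t = 0"
      proof (cases "1/2 * (w t)\<^sup>2 = phi \<kappa> (lam t)")
        case True
        then show ?thesis unfolding griffith_gap[OF pos] by simp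
      next
        case False
        then have "1/2 * (w t)\<^sup>2 < load t" using le eq[of t] t by simp
        from load_locally_constant[OF t this]
        obtain d where d: "d > 0" "\<And>s. dist s t < d \<Longrightarrow> load s = load t"
          unfolding eventually_nhds_metric by blast
        have "lam s = lam t" if "s \<in> ball t (min d t)" for s
        proof -
          have "\<bar>t - s\<bar> < min d t" using that by (simp add: dist_real_def)
          then have "0 < s" "dist s t < d" by (auto simp: dist_real_def)
          then have "load s = load t" by (intro d(2))
          then have "phi \<kappa> (lam s) = phi \<kappa> (lam t)"
            unfolding eq[OF less_imp_le[OF \<open>0 < s\<close>]] eq[OF less_imp_le[OF t]] .
          then show ?thesis
            by (rule phi_inj[OF F(1)[OF less_imp_le[OF \<open>0 < s\<close>]] F(1)[OF less_imp_le[OF t]]])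
        qed
        then have const: "lam t = lam s" if "s \<in> ball t (min d t)" for s using that by simp
        have "(lam has_real_derivative 0) (at t)"
        proof (rule has_field_derivative_transform_within_open[where f = "\<lambda>_. lam t" and S = "ball t (min d t)"])
          show "t \<in> ball t (min d t)" using d(1) t by simp
          show "lam t = lam s" if "s \<in> ball t (min d t)" for s by (rule const[OF that])
        qed (rule DERIV_const open_ball)+
        then have "deriv lam t = 0" by (rule DERIV_imp_deriv)
        then show ?thesis by simp
      qed
      ultimately show "\<exists>D. (lam has_real_derivative D) (at t) \<and> D \<ge> 0 \<and>
             1/2 * ((w t)\<^sup>2 / (lam t)\<^sup>2) \<le> \<kappa> (lam t) \<and>
             (1/2 * ((w t)\<^sup>2 / (lam t)\<^sup>2) - \<kappa> (lam t)) * D = 0"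
        by (intro exI[of _ "deriv lam t"] conjI D)
    qed
  qed
qed

lemma griffith_imp_stable:
  assumes front: "front lam" and ac: "\<forall>T>0. abs_continuous_on {0..T} lam" and g: "griffith lam"
  shows "stable lam"
  unfolding stable_def
proof (intro allI impI)
  fix t :: real assume t: "0 \<le> t"
  note F = frontD[OF front]
  have "continuous_on {0..t + 1} lam"
    using ac t by (intro abs_continuous_on_imp_continuous_on) auto
  then have c: "continuous_on {0..t + 1} (\<lambda>s. phi \<kappa> (lam s) - 1/2 * (w s)\<^sup>2)"
    using F(1) by (intro continuous_intros continuous_on_compose2[OF phi_cont[of "{l0..}"]] continuous_on_subset[OF w_cont]) auto
  have ae: "AE s in lebesgue. 0 < s \<and> s < t + 1 \<longrightarrow> 0 \<le> phi \<kappa> (lam s) - 1/2 * (w s)\<^sup>2"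
    using g unfolding griffith_def
  proof eventually_elim
    case (elim s)
    show ?case
    proof
      assume "0 < s \<and> s < t + 1"
      then have pos: "0 < lam s" and "1/2 * ((w s)\<^sup>2 / (lam s)\<^sup>2) - \<kappa> (lam s) \<le> 0" using elim F(4) by auto
      then show "0 \<le> phi \<kappa> (lam s) - 1/2 * (w s)\<^sup>2"
        unfolding griffith_gap[OF pos] by (simp add: divide_le_0_iff)
    qed
  qed
  have "0 \<le> phi \<kappa> (lam t) - 1/2 * (w t)\<^sup>2"
    by (rule continuous_nonneg_from_AE[OF c _ ae]) (use t in auto)
  then show "1/2 * (w t)\<^sup>2 \<le> phi \<kappa> (lam t)" by simp
qed

text \<open>The total energy \<open>E\<close> is absolutely continuous along the front. By complementarity the terms with
\<open>lam'\<close> cancel, so \<open>E' = w w' / lam\<close> almost everywhere, and this is the power of the boundary load because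
\<open>v\<^sub>x(t, 0) = - w / lam\<close>.\<close>

lemma griffith_imp_balanced:
  assumes front: "front lam" and ac: "\<forall>T>0. abs_continuous_on {0..T} lam" and g: "griffith lam"
  shows "balanced lam"
  unfolding balanced_def
proof (intro allI impI)
  fix T0 :: real assume T0: "0 \<le> T0"
  note F = frontD[OF front]
  define T where "T = T0 + 1"
  have T: "0 < T" "T0 \<le> T" "0 \<le> T" using T0 by (auto simp: T_def)
  define E where "E = (\<lambda>t. 1/2 * (w t)\<^sup>2 / lam t + fracture (lam t))"
  have "compact (w ` {0..T})"
    by (intro compact_continuous_image continuous_on_subset[OF w_cont]) auto
  then obtain M where M: "\<And>t. 0 \<le> t \<Longrightarrow> t \<le> T \<Longrightarrow> \<bar>w t\<bar> \<le> M"
    using compact_imp_bounded bounded_iff by (metis atLeastAtMost_iff imageI real_norm_def)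
  have "compact (\<kappa> ` {l0..lam T})"
    by (intro compact_continuous_image continuous_on_subset[OF \<kappa>_cont]) auto
  then obtain B where B: "\<And>x. l0 \<le> x \<Longrightarrow> x \<le> lam T \<Longrightarrow> \<bar>\<kappa> x\<bar> \<le> B"
    using compact_imp_bounded bounded_iff by (metis atLeastAtMost_iff imageI real_norm_def)
  have M0: "0 \<le> M" using M[of 0] T by auto
  have E_ac: "abs_continuous_on {0..T} E"
  proof (rule abs_continuous_on_dominated[where F = "\<lambda>t. 1/2 * (w t)\<^sup>2" and G = lam
        and A = "1 / l0" and B = "1/2 * M\<^sup>2 / l0\<^sup>2 + B"])
    show "abs_continuous_on {0..T} (\<lambda>t. 1/2 * (w t)\<^sup>2)" by (rule half_square(1)[OF T(1)])
    show "abs_continuous_on {0..T} lam" using ac T by simp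
    fix x y assume xy: "0 \<le> x" "x \<le> y" "y \<le> T"
    have l: "l0 \<le> lam x" "lam x \<le> lam y" "lam y \<le> lam T" "0 < lam x" "0 < lam y" using F xy by auto
    have "fracture (lam y) - fracture (lam x) = integral {lam x..lam y} \<kappa>"
      unfolding fracture_def
      using Henstock_Kurzweil_Integration.integral_combine[OF l(1,2), of \<kappa>]
        integrable_continuous_real[OF continuous_on_subset[OF \<kappa>_cont], of l0 "lam y"] by auto
    moreover have "norm (integral {lam x..lam y} \<kappa>) \<le> B * (lam y - lam x)"
      by (rule integral_bound[OF l(2) continuous_on_subset[OF \<kappa>_cont]]) (use l B in auto)
    ultimately have 1: "\<bar>fracture (lam y) - fracture (lam x)\<bar> \<le> B * (lam y - lam x)" by simp
    have "\<bar>(1/2 * (w y)\<^sup>2 - 1/2 * (w x)\<^sup>2) / lam y\<bar> = \<bar>1/2 * (w y)\<^sup>2 - 1/2 * (w x)\<^sup>2\<bar> / lam y"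
      using l by (simp add: abs_divide)
    also have "\<dots> \<le> \<bar>1/2 * (w y)\<^sup>2 - 1/2 * (w x)\<^sup>2\<bar> / l0"
      using l l0 by (intro divide_left_mono) auto
    finally have 2: "\<bar>(1/2 * (w y)\<^sup>2 - 1/2 * (w x)\<^sup>2) / lam y\<bar> \<le> 1 / l0 * \<bar>1/2 * (w y)\<^sup>2 - 1/2 * (w x)\<^sup>2\<bar>"
      by simp
    define c m where "c = 1/2 * (w x)\<^sup>2" and "m = 1/2 * M\<^sup>2"
    have c: "0 \<le> c" "c \<le> m" using M[of x] xy by (simp_all add: c_def m_def power2_le_iff_abs_le M0)
    have "(lam y - lam x) / (lam x * lam y) = - (1 / lam y - 1 / lam x)" using l by (simp add: field_simps)
    moreover have "1 / lam y - 1 / lam x \<le> 0" using l by (simp add: frac_le)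
    ultimately have "\<bar>c * (1 / lam y - 1 / lam x)\<bar> = c * ((lam y - lam x) / (lam x * lam y))"
      using c by (simp add: abs_mult)
    also have "\<dots> \<le> m * ((lam y - lam x) / l0\<^sup>2)"
      using l l0 c by (intro mult_mono divide_left_mono) (auto simp: power2_eq_square intro: mult_mono)
    finally have 3: "\<bar>1/2 * (w x)\<^sup>2 * (1 / lam y - 1 / lam x)\<bar> \<le> 1/2 * M\<^sup>2 / l0\<^sup>2 * (lam y - lam x)"
      by (simp add: c_def m_def)
    have "E y - E x = (1/2 * (w y)\<^sup>2 - 1/2 * (w x)\<^sup>2) / lam y + 1/2 * (w x)\<^sup>2 * (1 / lam y - 1 / lam x)
        + (fracture (lam y) - fracture (lam x))"
      by (simp add: E_def algebra_simps diff_divide_distrib)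
    then have "\<bar>E y - E x\<bar> \<le> 1 / l0 * \<bar>1/2 * (w y)\<^sup>2 - 1/2 * (w x)\<^sup>2\<bar> + 1/2 * M\<^sup>2 / l0\<^sup>2 * (lam y - lam x) + B * (lam y - lam x)"
      using 1 2 3 by linarith
    then show "\<bar>E y - E x\<bar> \<le> 1 / l0 * \<bar>1/2 * (w y)\<^sup>2 - 1/2 * (w x)\<^sup>2\<bar> + (1/2 * M\<^sup>2 / l0\<^sup>2 + B) * \<bar>lam y - lam x\<bar>"
      using l by (simp add: distrib_right)
  qed
  note ftc = abs_continuous_fundamental_theorem[OF E_ac T(3)]
  have "AE t in lebesgue. t \<notin> {0}"
    by (rule AE_not_in) (simp flip: negligible_iff_null_sets)
  with g[unfolded griffith_def] locally_abs_continuous_derivative_AE[OF w_ac]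
  have eq: "AE t in lebesgue. t \<in> {0..T0} \<longrightarrow> deriv E t = deriv w t * (w t / lam t)"
  proof eventually_elim
    case (elim t)
    show ?case
    proof
      assume "t \<in> {0..T0}"
      then have t: "0 < t" using elim by auto
      obtain D where D: "(lam has_real_derivative D) (at t)"
        and comp: "(1/2 * ((w t)\<^sup>2 / (lam t)\<^sup>2) - \<kappa> (lam t)) * D = 0" using elim t by auto
      have W: "(w has_real_derivative deriv w t) (at t)" using elim t by simp
      have pos: "0 < lam t" using F(4) t by simp
      \<comment> \<open>Only the derivative within \<open>{l0..}\<close> is used, since \<open>lam t = l0\<close> is possible and \<open>fracture\<close>, constant to the left of \<open>l0\<close>, can have a kink there.\<close>
      have "(fracture \<circ> lam has_real_derivative \<kappa> (lam t) * D) (at t within {0<..})"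
      proof (rule DERIV_image_chain)
        show "(fracture has_real_derivative \<kappa> (lam t)) (at (lam t) within lam ` {0<..})"
          by (rule has_field_derivative_subset[OF fracture_derivative_within]) (use F(1) t in auto)
        show "(lam has_real_derivative D) (at t within {0<..})" by (rule has_field_derivative_at_within[OF D])
      qed
      then have fr: "((\<lambda>s. fracture (lam s)) has_real_derivative \<kappa> (lam t) * D) (at t)"
        using t by (simp add: at_within_open[of t "{0<..}"] comp_def)
      have "((\<lambda>s. 1/2 * (w s)\<^sup>2 / lam s) has_real_derivative
          deriv w t * (w t / lam t) - 1/2 * ((w t)\<^sup>2 / (lam t)\<^sup>2) * D) (at t)"
        using pos by (auto intro!: derivative_eq_intros W D simp: field_simps power2_eq_square)
      from DERIV_add[OF this fr]
      have "(E has_real_derivative deriv w t * (w t / lam t) - (1/2 * ((w t)\<^sup>2 / (lam t)\<^sup>2) - \<kappa> (lam t)) * D) (at t)"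
        unfolding E_def by (simp add: algebra_simps)
      then show "deriv E t = deriv w t * (w t / lam t)" unfolding comp by (simp add: DERIV_imp_deriv)
    qed
  qed
  have dE: "deriv E absolutely_integrable_on {0..T0}"
    by (rule set_integrable_subset[OF ftc(2)]) (use T in auto)
  have ai: "(\<lambda>t. deriv w t * (w t / lam t)) absolutely_integrable_on {0..T0}"
    by (rule absolutely_integrable_cong_AE(1)[OF dE eq])
  have neg: "(\<lambda>\<tau>. deriv w \<tau> * (- w \<tau> / lam \<tau>)) = (\<lambda>\<tau>. - (deriv w \<tau> * (w \<tau> / lam \<tau>)))" by auto
  have "(LINT \<tau>:{0..T0}|lebesgue. deriv w \<tau> * (w \<tau> / lam \<tau>)) = E T0 - E 0"
    using absolutely_integrable_cong_AE(2)[OF dE eq] ftc(3)[of 0 T0] T T0 by simp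
  moreover have "(\<lambda>\<tau>. - (deriv w \<tau> * (w \<tau> / lam \<tau>))) absolutely_integrable_on {0..T0}"
    using ai by (simp add: set_integrable_def)
  moreover have "(LINT \<tau>:{0..T0}|lebesgue. - (deriv w \<tau> * (w \<tau> / lam \<tau>))) = - (LINT \<tau>:{0..T0}|lebesgue. deriv w \<tau> * (w \<tau> / lam \<tau>))"
    unfolding set_lebesgue_integral_def by simp
  moreover have "E 0 = 1/2 * (w 0)\<^sup>2 / l0" by (simp add: E_def F(3) fracture_def)
  ultimately show "(\<lambda>\<tau>. deriv w \<tau> * (- w \<tau> / lam \<tau>)) absolutely_integrable_on {0..T0} \<and>
     1/2 * (w T0)\<^sup>2 / lam T0 + fracture (lam T0) + (LINT \<tau>:{0..T0}|lebesgue. deriv w \<tau> * (- w \<tau> / lam \<tau>))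
       = 1/2 * (w 0)\<^sup>2 / l0"
    unfolding neg by (simp add: E_def)
qed



section \<open>Energetic and quasistatic evolutions\<close>

definition profile :: "(real \<Rightarrow> real \<Rightarrow> real) \<Rightarrow> (real \<Rightarrow> real) \<Rightarrow> bool" where
  "profile v lam \<longleftrightarrow> (\<forall>t\<ge>0. \<forall>x\<ge>0. v t x = w t * (1 - x / lam t) * indicat_real {0..lam t} x)"

lemma affine_has_derivative_at_0:
  assumes L: "0 < L" and v: "\<And>x. 0 \<le> x \<Longrightarrow> x \<le> L \<Longrightarrow> v x = a * (1 - x / L)"
  shows "(v has_vector_derivative - a / L) (at_right 0)"
proof -
  have "((\<lambda>x. a * (1 - x / L)) has_real_derivative - a / L) (at 0 within {0..})"
    using L by (auto intro!: derivative_eq_intros simp: field_simps)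
  then have "((\<lambda>x. a * (1 - x / L)) has_vector_derivative - a / L) (at 0 within {0..})"
    by (simp add: has_real_derivative_iff_has_vector_derivative)
  then have "(v has_vector_derivative - a / L) (at 0 within {0..})"
    by (rule has_vector_derivative_transform_within[OF _ L]) (use v in \<open>auto simp: dist_real_def\<close>)
  then show ?thesis by (rule has_vector_derivative_within_subset) auto
qed

lemma profile_imp_admissible:
  assumes front: "front lam" and p: "profile v lam"
  shows "admissible_pair l0 w v lam"
proof -
  note F = frontD[OF front]
  have v: "v t x = (if x < lam t then w t * (1 - x / lam t) else 0)" if "0 \<le> t" "0 \<le> x" for t x
    using p that F(4)[OF that(1)] by (auto simp: profile_def indicator_def)
  have "v t \<in> H1 {0<..}" if t: "0 \<le> t" for t
  proof (rule affine_profile_in_H1[OF F(4)[OF t]])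
    have "continuous_on {0..} (\<lambda>x. w t * max 0 (1 - x / lam t))"
      using F(4)[OF t] by (intro continuous_intros) auto
    then have "continuous_on {0..} (v t)"
      by (rule continuous_on_eq) (use v[OF t] F(4)[OF t] in \<open>auto simp: max_def field_simps\<close>)
    then show "continuous_on (closure {0<..}) (v t)" by simp
  qed (use v t in auto)
  moreover have "v t 0 = w t" "\<forall>x\<ge>lam t. v t x = 0" if "0 \<le> t" for t
    using v[OF that] F(4)[OF that] by auto
  moreover have "v t differentiable (at_right 0)" if "0 < t" for t
    using affine_has_derivative_at_0[of "lam t" "v t" "w t"] v[of t] F(4)[of t] that
    by (fastforce simp: has_vector_derivative_def differentiable_def)
  ultimately show ?thesis
    using front by (auto simp: admissible_pair_def front_def intro!: always_eventually)
qed

text \<open>The competitor with the same length forces the profile to be affine, as the unique minimizer of the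
Dirichlet energy. Longer competitors may be taken affine, which reduces stability to minimality of the reduced
energy at \<open>lam t\<close> among larger lengths.\<close>

lemma stability_iff:
  assumes adm: "admissible_pair l0 w v lam" and t: "0 \<le> t"
  shows "(\<forall>l\<ge>lam t. \<forall>u \<in> H1 {0<..<l}. u 0 = w t \<and> u l = 0 \<longrightarrow>
           energy l0 \<kappa> (wderiv {0<..} (v t)) (lam t) \<le> energy l0 \<kappa> (wderiv {0<..<l} u) l)
     \<longleftrightarrow> (\<forall>x\<in>{0..lam t}. v t x = w t * (1 - x / lam t)) \<and> 1/2 * (w t)\<^sup>2 \<le> phi \<kappa> (lam t)"
    and "(\<forall>x\<in>{0..lam t}. v t x = w t * (1 - x / lam t)) \<Longrightarrow>
       energy l0 \<kappa> (wderiv {0<..} (v t)) (lam t) = 1/2 * (w t)\<^sup>2 / lam t + fracture (lam t)"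
proof -
  have L: "l0 \<le> lam t" "0 < lam t" and vH: "v t \<in> H1 {0<..}" and v0: "v t 0 = w t" and vL: "v t (lam t) = 0"
    using adm t l0 by (auto simp: admissible_pair_def intro: less_le_trans)
  have "{0<..<lam t} \<subseteq> {0<..}" by auto
  note dv = H1_dirichlet_energy[OF vH this L(2) v0 vL]
  have du: "(w t)\<^sup>2 / l \<le> (LINT x:{0..l}|lebesgue. (wderiv {0<..<l} u x)\<^sup>2)"
    "(LINT x:{0..l}|lebesgue. (wderiv {0<..<l} u x)\<^sup>2) = (w t)\<^sup>2 / l \<longleftrightarrow> (\<forall>x\<in>{0..l}. u x = w t * (1 - x / l))"
    if "0 < l" "u \<in> H1 {0<..<l}" "u 0 = w t" "u l = 0" for l u
    using H1_dirichlet_energy[OF that(2) _ that(1,3,4)] by auto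
  have aff: "\<exists>u\<in>H1 {0<..<l}. u 0 = w t \<and> u l = 0 \<and> energy l0 \<kappa> (wderiv {0<..<l} u) l = 1/2 * (w t)\<^sup>2 / l + fracture l"
    if l: "0 < l" for l
  proof
    let ?u = "\<lambda>x. w t * (1 - x / l)"
    show H: "?u \<in> H1 {0<..<l}"
      by (rule affine_profile_in_H1[OF l]) (use l in \<open>auto intro!: continuous_intros\<close>)
    show "?u 0 = w t \<and> ?u l = 0 \<and> energy l0 \<kappa> (wderiv {0<..<l} ?u) l = 1/2 * (w t)\<^sup>2 / l + fracture l"
      using du(2)[OF l H] l by (simp add: energy_def fracture_eq)
  qed
  show en: "energy l0 \<kappa> (wderiv {0<..} (v t)) (lam t) = 1/2 * (w t)\<^sup>2 / lam t + fracture (lam t)"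
    if "\<forall>x\<in>{0..lam t}. v t x = w t * (1 - x / lam t)"
    using dv(2) that by (simp add: energy_def fracture_eq)
  show "(\<forall>l\<ge>lam t. \<forall>u \<in> H1 {0<..<l}. u 0 = w t \<and> u l = 0 \<longrightarrow>
           energy l0 \<kappa> (wderiv {0<..} (v t)) (lam t) \<le> energy l0 \<kappa> (wderiv {0<..<l} u) l)
     \<longleftrightarrow> (\<forall>x\<in>{0..lam t}. v t x = w t * (1 - x / lam t)) \<and> 1/2 * (w t)\<^sup>2 \<le> phi \<kappa> (lam t)" (is "?S \<longleftrightarrow> ?A \<and> ?G")
  proof
    assume S: ?S
    have le: "energy l0 \<kappa> (wderiv {0<..} (v t)) (lam t) \<le> 1/2 * (w t)\<^sup>2 / l + fracture l" if "lam t \<le> l" for l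
      using aff[of l] S that L by fastforce
    have A: ?A
      using le[OF order_refl] dv by (simp add: energy_def fracture_eq)
    moreover have ?G
    proof (rule reduced_energy_minimal_imp[OF L(1)])
      fix l assume "lam t \<le> l"
      then show "fracture (lam t) + 1/2 * (w t)\<^sup>2 / lam t \<le> fracture l + 1/2 * (w t)\<^sup>2 / l"
        using le[of l] en[OF A] by simp
    qed
    ultimately show "?A \<and> ?G" by blast
  next
    assume AG: "?A \<and> ?G"
    show ?S
    proof (intro allI impI ballI)
      fix l u assume l: "lam t \<le> l" and u: "u \<in> H1 {0<..<l}" "u 0 = w t \<and> u l = 0"
      have "energy l0 \<kappa> (wderiv {0<..} (v t)) (lam t) = fracture (lam t) + 1/2 * (w t)\<^sup>2 / lam t"
        using en AG by simp
      also have "\<dots> \<le> fracture l + 1/2 * (w t)\<^sup>2 / l"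
        using reduced_energy_strict_increasing[of "lam t" l "1/2 * (w t)\<^sup>2"] L l AG by (cases "l = lam t") auto
      also have "\<dots> \<le> energy l0 \<kappa> (wderiv {0<..<l} u) l"
        using du(1)[OF _ u(1)] u(2) L l by (simp add: energy_def fracture_eq)
      finally show "energy l0 \<kappa> (wderiv {0<..} (v t)) (lam t) \<le> energy l0 \<kappa> (wderiv {0<..<l} u) l" .
    qed
  qed
qed

lemma energetic_evolution_iff:
  "energetic_evolution l0 w \<kappa> v lam \<longleftrightarrow> front lam \<and> profile v lam \<and> stable lam \<and> balanced lam"
proof -
  have adm_iff: "(\<forall>t\<ge>0. \<forall>x\<in>{0..lam t}. v t x = w t * (1 - x / lam t)) \<longleftrightarrow> profile v lam"
    if adm: "admissible_pair l0 w v lam"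
  proof
    have zero: "v t x = 0" if "0 \<le> t" "lam t \<le> x" for t x
      using adm that by (simp add: admissible_pair_def)
    assume A: "\<forall>t\<ge>0. \<forall>x\<in>{0..lam t}. v t x = w t * (1 - x / lam t)"
    show "profile v lam"
      unfolding profile_def
    proof (intro allI impI)
      fix t x :: real assume "0 \<le> t" "0 \<le> x"
      then show "v t x = w t * (1 - x / lam t) * indicat_real {0..lam t} x"
        using A zero[of t x] by (cases "x \<le> lam t") simp_all
    qed
  qed (simp add: profile_def)
  have front: "front lam" if "admissible_pair l0 w v lam"
    using that by (simp add: admissible_pair_def front_def)
  have main: "energetic_evolution l0 w \<kappa> v lam \<longleftrightarrow> profile v lam \<and> stable lam \<and> balanced lam"
    if adm: "admissible_pair l0 w v lam"
  proof -
    have st: "(\<forall>t\<ge>0. \<forall>l\<ge>lam t. \<forall>u \<in> H1 {0<..<l}. u 0 = w t \<and> u l = 0 \<longrightarrow>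
           energy l0 \<kappa> (wderiv {0<..} (v t)) (lam t) \<le> energy l0 \<kappa> (wderiv {0<..<l} u) l)
       \<longleftrightarrow> profile v lam \<and> stable lam" (is "?S \<longleftrightarrow> _")
    proof -
      have "?S \<longleftrightarrow> (\<forall>t\<ge>0. (\<forall>x\<in>{0..lam t}. v t x = w t * (1 - x / lam t)) \<and> 1/2 * (w t)\<^sup>2 \<le> phi \<kappa> (lam t))"
        by (intro all_cong1 imp_cong refl stability_iff(1)[OF adm])
      also have "\<dots> \<longleftrightarrow> (\<forall>t\<ge>0. \<forall>x\<in>{0..lam t}. v t x = w t * (1 - x / lam t)) \<and> stable lam"
        unfolding stable_def by blast
      finally show ?thesis unfolding adm_iff[OF adm] .
    qed
    have bal: "(\<forall>t\<ge>0. set_integrable lebesgue {0..t}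
          (\<lambda>\<tau>. deriv w \<tau> * vector_derivative (v \<tau>) (at_right 0)) \<and>
        energy l0 \<kappa> (wderiv {0<..} (v t)) (lam t)
          + (LINT \<tau>:{0..t}|lebesgue. deriv w \<tau> * vector_derivative (v \<tau>) (at_right 0))
          = 1/2 * (LINT \<sigma>:{0..l0}|lebesgue. (wderiv {0<..} (v 0) \<sigma>)\<^sup>2)) \<longleftrightarrow> balanced lam"
      if p: "profile v lam"
    proof -
      note F = frontD[OF front[OF adm]]
      have aff: "\<forall>x\<in>{0..lam t}. v t x = w t * (1 - x / lam t)" if "0 \<le> t" for t
        using adm_iff[OF adm] p that by blast
      have vd: "vector_derivative (v t) (at_right 0) = - w t / lam t" if "0 \<le> t" for t
      proof (rule vector_derivative_within)
        show "(v t has_vector_derivative - w t / lam t) (at_right 0)"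
          by (rule affine_has_derivative_at_0[OF F(4)[OF that]]) (use aff[OF that] in auto)
      qed (simp add: trivial_limit_at_right_real)
      have ind: "indicator {0..t} \<tau> *\<^sub>R (deriv w \<tau> * vector_derivative (v \<tau>) (at_right 0))
          = indicator {0..t} \<tau> *\<^sub>R (deriv w \<tau> * (- w \<tau> / lam \<tau>))" for t \<tau> :: real
        using vd[of \<tau>] by (cases "\<tau> \<in> {0..t}") auto
      have "1/2 * (LINT \<sigma>:{0..l0}|lebesgue. (wderiv {0<..} (v 0) \<sigma>)\<^sup>2) = 1/2 * (w 0)\<^sup>2 / l0"
        using stability_iff(2)[OF adm order_refl aff[OF order_refl]]
        unfolding energy_def fracture_eq F(3) by simp
      then show ?thesis
        unfolding balanced_def set_integrable_def set_lebesgue_integral_def ind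
        by (intro all_cong1 imp_cong refl) (simp only: stability_iff(2)[OF adm _ aff])
    qed
    have split: "(\<forall>t\<ge>0. S t \<and> I t \<and> B t) \<longleftrightarrow> (\<forall>t\<ge>0. S t) \<and> (\<forall>t\<ge>0. I t \<and> B t)" for S I B :: "real \<Rightarrow> bool"
      by blast
    show ?thesis
      unfolding energetic_evolution_def split st using bal adm by argo
  qed
  have "admissible_pair l0 w v lam" if "energetic_evolution l0 w \<kappa> v lam"
    using that unfolding energetic_evolution_def by (rule conjunct1)
  then show ?thesis
    using main front profile_imp_admissible[of lam v] by argo
qed

lemma quasistatic_evolution_iff:
  "quasistatic_evolution l0 w \<kappa> v lam \<longleftrightarrow>
     front lam \<and> profile v lam \<and> (\<forall>T>0. abs_continuous_on {0..T} lam) \<and> griffith lam"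
proof -
  have "quasistatic_evolution l0 w \<kappa> v lam \<longleftrightarrow> admissible_pair l0 w v lam \<and>
      (\<forall>T>0. abs_continuous_on {0..T} lam) \<and> lam 0 = l0 \<and> profile v lam \<and> griffith lam"
    by (simp only: quasistatic_evolution_def profile_def griffith_def)
  moreover have "admissible_pair l0 w v lam \<Longrightarrow> front lam" by (simp add: admissible_pair_def front_def)
  ultimately show ?thesis using profile_imp_admissible[of lam v] frontD(3)[of lam] by argo
qed

text \<open>Both notions of evolution describe the same front: \<open>phi \<kappa> (lam t)\<close> equals the load at every time.\<close>

theorem evolutions_iff_load:
  shows "energetic_evolution l0 w \<kappa> v lam \<longleftrightarrow>
      front lam \<and> profile v lam \<and> (\<forall>t\<ge>0. phi \<kappa> (lam t) = load t)"
    and "quasistatic_evolution l0 w \<kappa> v lam \<longleftrightarrow>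
      front lam \<and> profile v lam \<and> (\<forall>t\<ge>0. phi \<kappa> (lam t) = load t)"
proof -
  have "stable lam \<and> balanced lam \<longleftrightarrow> (\<forall>t\<ge>0. phi \<kappa> (lam t) = load t)"
    "(\<forall>T>0. abs_continuous_on {0..T} lam) \<and> griffith lam \<longleftrightarrow> (\<forall>t\<ge>0. phi \<kappa> (lam t) = load t)"
    if front: "front lam"
    using front_phi_eq_load[OF front] front_from_load[OF front]
      griffith_imp_stable[OF front] griffith_imp_balanced[OF front] by blast+
  then show "energetic_evolution l0 w \<kappa> v lam \<longleftrightarrow>
      front lam \<and> profile v lam \<and> (\<forall>t\<ge>0. phi \<kappa> (lam t) = load t)"
    "quasistatic_evolution l0 w \<kappa> v lam \<longleftrightarrow>
      front lam \<and> profile v lam \<and> (\<forall>t\<ge>0. phi \<kappa> (lam t) = load t)"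
    unfolding energetic_evolution_iff quasistatic_evolution_iff by argo+
qed

text \<open>The growth assumption puts the load into the range of \<open>phi \<kappa>\<close>. It is applied at \<open>t + 1\<close> because it is
stated for positive times only.\<close>

lemma inv_phi_load:
  assumes lim: "\<forall>T>0. ereal (1/2 * max_square w T) < Lim at_top (\<lambda>x. ereal (phi \<kappa> x))" and t: "0 \<le> t"
  shows "l0 \<le> lam_bar l0 w \<kappa> t" "phi \<kappa> (lam_bar l0 w \<kappa> t) = load t"
proof -
  define S where "S = (SUP x\<in>{l0..}. ereal (phi \<kappa> x))"
  have "((\<lambda>x. ereal (phi \<kappa> x)) \<longlongrightarrow> S) at_top"
  proof (rule increasing_tendsto)
    show "\<forall>\<^sub>F x in at_top. ereal (phi \<kappa> x) \<le> S"
      using eventually_ge_at_top[of l0] by eventually_elim (auto simp: S_def intro: SUP_upper)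
    fix y assume "y < S"
    then obtain x0 where x0: "l0 \<le> x0" "y < ereal (phi \<kappa> x0)" by (auto simp: S_def less_SUP_iff)
    show "\<forall>\<^sub>F x in at_top. y < ereal (phi \<kappa> x)"
      using eventually_gt_at_top[of x0]
      by eventually_elim (use x0 phi_less in \<open>auto intro: less_trans\<close>)
  qed
  then have Lim_S: "Lim at_top (\<lambda>x. ereal (phi \<kappa> x)) = S" by (intro tendsto_Lim) auto
  have "load t \<in> phi \<kappa> ` {l0..}"
  proof (cases "load t = phi \<kappa> l0")
    case False
    have "load t \<le> load (t + 1)" using load_mono[OF t] by simp
    then have eq: "load (t + 1) = 1/2 * max_square w (t + 1)"
      using False load_properties(1)[OF t] by (auto simp: load_def[of "t + 1"])
    have "0 < t + 1" using t by simp
    from lim[rule_format, OF this] have "ereal (load (t + 1)) < S"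
      unfolding eq Lim_S .
    then obtain x where x: "l0 \<le> x" "load (t + 1) < phi \<kappa> x" by (auto simp: S_def less_SUP_iff)
    then obtain y where "l0 \<le> y" "phi \<kappa> y = load t"
      using IVT'[of "phi \<kappa>" l0 "load t" x] \<open>load t \<le> load (t + 1)\<close> load_properties(1)[OF t] phi_cont[of "{l0..x}"] by auto
    then show ?thesis by (intro image_eqI[of _ _ y]) auto
  qed auto
  moreover have "lam_bar l0 w \<kappa> t = inv_into {l0..} (phi \<kappa>) (load t)" by (simp add: lam_bar_def load_def)
  ultimately show "l0 \<le> lam_bar l0 w \<kappa> t" "phi \<kappa> (lam_bar l0 w \<kappa> t) = load t"
    using inv_into_into[of "load t" "phi \<kappa>" "{l0..}"] f_inv_into_f[of "load t" "phi \<kappa>" "{l0..}"] by auto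
qed

lemma quasistatic_evolution_unique:
  assumes lim: "\<forall>T>0. ereal (1/2 * max_square w T) < Lim at_top (\<lambda>x. ereal (phi \<kappa> x))"
    and init: "1/2 * (w 0)\<^sup>2 \<le> phi \<kappa> l0"
  shows "quasistatic_evolution l0 w \<kappa> v lam \<longleftrightarrow>
     (\<forall>t\<ge>0. lam t = lam_bar l0 w \<kappa> t \<and> (\<forall>x\<ge>0. v t x = v_bar l0 w \<kappa> t x))"
proof -
  note bar = inv_phi_load[OF lim]
  have lam_iff: "front lam \<and> (\<forall>t\<ge>0. phi \<kappa> (lam t) = load t) \<longleftrightarrow> (\<forall>t\<ge>0. lam t = lam_bar l0 w \<kappa> t)"
  proof
    assume fl: "front lam \<and> (\<forall>t\<ge>0. phi \<kappa> (lam t) = load t)"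
    show "\<forall>t\<ge>0. lam t = lam_bar l0 w \<kappa> t"
    proof (intro allI impI)
      fix t :: real assume t: "0 \<le> t"
      show "lam t = lam_bar l0 w \<kappa> t"
        by (rule phi_inj) (use fl frontD(1)[of lam t] bar[OF t] t in auto)
    qed
  next
    assume lam: "\<forall>t\<ge>0. lam t = lam_bar l0 w \<kappa> t"
    have ge: "l0 \<le> lam t" and ph: "phi \<kappa> (lam t) = load t" if "0 \<le> t" for t
      using bar[OF that] lam that by auto
    have "lam s \<le> lam t" if "0 \<le> s" "s \<le> t" for s t
    proof (rule ccontr)
      assume "\<not> lam s \<le> lam t"
      then have "phi \<kappa> (lam t) < phi \<kappa> (lam s)" using ge[of t] that by (intro phi_less) auto
      then show False using ph[of s] ph[of t] load_mono[OF that] that by simp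
    qed
    moreover have "lam 0 = l0"
    proof (rule phi_inj)
      have "load 0 = phi \<kappa> l0"
        using load_properties(1,3)[of 0] init by auto
      then show "phi \<kappa> (lam 0) = phi \<kappa> l0" using ph[of 0] by simp
    qed (use ge in auto)
    ultimately have "front lam" using ge by (simp add: front_def mono_on_def)
    then show "front lam \<and> (\<forall>t\<ge>0. phi \<kappa> (lam t) = load t)" using ph by simp
  qed
  have "profile v lam \<longleftrightarrow> (\<forall>t\<ge>0. \<forall>x\<ge>0. v t x = v_bar l0 w \<kappa> t x)" if "\<forall>t\<ge>0. lam t = lam_bar l0 w \<kappa> t"
    using that by (simp add: profile_def v_bar_def)
  moreover have "(\<forall>t\<ge>0. lam t = lam_bar l0 w \<kappa> t \<and> (\<forall>x\<ge>0. v t x = v_bar l0 w \<kappa> t x)) \<longleftrightarrow>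
      (\<forall>t\<ge>0. lam t = lam_bar l0 w \<kappa> t) \<and> (\<forall>t\<ge>0. \<forall>x\<ge>0. v t x = v_bar l0 w \<kappa> t x)"
    by blast
  ultimately show ?thesis
    unfolding evolutions_iff_load(2) using lam_iff by argo
qed

end

theorem theorem2p9:
  fixes l0 :: real and w \<kappa> :: "real \<Rightarrow> real"
  assumes "l0 > 0"
    and "continuous_on {0..} w"
    and "\<forall>T>0. abs_continuous_on {0..T} w"
    and "continuous_on {l0..} \<kappa>"
    and "\<forall>x\<ge>l0. \<kappa> x > 0"
    and "strict_mono_on {l0..} (phi \<kappa>)"
    and "AE x in lebesgue. x > l0 \<longrightarrow> (\<exists>D>0. (phi \<kappa> has_real_derivative D) (at x))"
  shows "(\<forall>v lam. energetic_evolution l0 w \<kappa> v lam \<longleftrightarrow> quasistatic_evolution l0 w \<kappa> v lam)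
    \<and> ((\<forall>T>0. Lim at_top (\<lambda>x. ereal (phi \<kappa> x)) > ereal (1/2 * max_square w T))
        \<and> phi \<kappa> l0 \<ge> 1/2 * (w 0)\<^sup>2
       \<longrightarrow> (\<forall>v lam. quasistatic_evolution l0 w \<kappa> v lam \<longleftrightarrow>
              (\<forall>t\<ge>0. lam t = lam_bar l0 w \<kappa> t \<and> (\<forall>x\<ge>0. v t x = v_bar l0 w \<kappa> t x))))"
proof -
  interpret debonding l0 w \<kappa> by (rule debonding.intro) (fact assms)+
  show ?thesis
  proof (intro conjI allI impI)
    fix v lam
    show "energetic_evolution l0 w \<kappa> v lam \<longleftrightarrow> quasistatic_evolution l0 w \<kappa> v lam"
      unfolding evolutions_iff_load ..
  next
    fix v lam
    assume "(\<forall>T>0. Lim at_top (\<lambda>x. ereal (phi \<kappa> x)) > ereal (1/2 * max_square w T))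
        \<and> phi \<kappa> l0 \<ge> 1/2 * (w 0)\<^sup>2"
    then show "quasistatic_evolution l0 w \<kappa> v lam \<longleftrightarrow>
        (\<forall>t\<ge>0. lam t = lam_bar l0 w \<kappa> t \<and> (\<forall>x\<ge>0. v t x = v_bar l0 w \<kappa> t x))"
      by (elim conjE) (rule quasistatic_evolution_unique)
  qed
qed

end
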